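(* Let $M$ be a smooth closed oriented Riemannian manifold, let $v$ be a gradient-like Morse–Smale vector field on $M$ in general position, and let $(M',\phi,V)$ be a triangulation of $v$. Then for every $\varepsilon>0$ there exists $N\in\mathbb{N}$, and there exist choices of cells for the first $N$ barycentric subdivisions of $V$, such that, for any choices of cells in all subsequent subdivisions, for all $n\ge N$ we have $$d_I\big(X(v),X(\Delta^n(V))\big)<\varepsilon .$$
   Context: Coefficients: $\mathbb{F}=\mathbb{Z}/2\mathbb{Z}$. Chain complexes are over $\mathbb{F}$, non-negative and compact (finite-dimensional in each degree, zero in all but finitely many). A parametrized chain complex is a functor from the poset $[0,\infty)$ to such complexes, with internal maps $X^{s\le t}$. Interleaving distance: with shifts $(X_\varepsilon)^t=X^{t+\varepsilon}$, $(\phi_\varepsilon)^t=\phi^{t+\varepsilon}$, an $\varepsilon$-interleaving is a pair of natural transformations $\phi\colon X\to Y_\varepsilon$, $\psi\colon Y\to X_\varepsilon$ with $(\psi_\varepsilon\circ\phi)^t=X^{t\le t+2\varepsilon}$, $(\phi_\varepsilon\circ\psi)^t=Y^{t\le t+2\varepsilon}$ for all $t$; $d_I(X,Y)$ is the infimum of the $\varepsilon>0$ admitting an $\varepsilon$-interleaving. Smooth side: $d_M$ is the distance on $M$ induced by the Riemannian structure (if $M$ is not connected, the distance between points of different components is set to a fixed number at least as large as the maximal distance between two points of the same component). For a smooth vector field $v$ with flow $\phi_v$, $\mathrm{Sing}(v)$ is its set of zeros; $p$ is chain-recurrent if for all $T,\varepsilon>0$ there are $x_0,\dots,x_m$ with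 $x_0=x_m=p$ and $t_i>T$ with $d_M(\phi_v(t_i,x_i),x_{i+1})\le\varepsilon$ for all $i<m$. $v$ is a gradient-like Morse–Smale vector field if its chain-recurrent set consists of finitely many fixed points, all hyperbolic, and all stable manifolds $W^s(p)$ and unstable manifolds $W^u(p)$ of fixed points intersect transversally; the index of $p$ is $\dim W^u(p)$. It is in general position if no two different unordered pairs of distinct singular points have the same distance $d_M$. Its Morse complex $\mathrm{MC}_\bullet(v)$ has in degree $k$ the basis of singular points of index $k$, and $\partial p=\sum_q\alpha(p,q)q$ over $q$ of index $k-1$, $\alpha(p,q)$ being the number mod 2 of flow lines from $p$ to $q$. It is weighted by $\mathrm{w}(p,q)=d_M(p,q)$. Combinatorial side: a combinatorial vector field on a simplicial complex $K$ is a function $V\colon K\to K\cup\{0\}$ such that for all $\sigma\in K$: either $V(\sigma)=0$, or $\dim V(\sigma)=\dim\sigma+1$, $\sigma$ is a face of $V(\sigma)$ and $V(V(\sigma))=0$; and $|V^{-1}(\sigma)|\le1$. A cell $\sigma$ is critical if $V(\sigma)=0$ and $V^{-1}(\sigma)=\emptyset$. A $V$-path of dimension $k$ is a sequence $\sigma_0,\dots,\sigma_r$ of $k$-simplices with $\sigma_i\ne\sigma_{i+1}$ and $\sigma_{i+1}$ a hyperface of $V(\sigma_i)$ for all $i<r$; it is stationary if $r=0$ and closed if $\sigma_r=\sigma_0$. $V$ is gradient-like if it has no closed non-stationary $V$-paths. Its combinatorial Morse complex $\overline{\mathrm{MC}}_\bullet(V)$ has in degree $k$ the basis of critical $k$-cells,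 with the coefficient of a critical $(k-1)$-cell $\sigma$ in $\partial\tau$ being the number mod 2 of $V$-paths from a hyperface of $\tau$ to $\sigma$. A triangulation of $v$ is a triple $(M',\phi,V)$ where $M'$ is a simplicial complex, $\phi\colon|M'|\to M$ a homeomorphism, and $V$ a gradient-like combinatorial vector field on $M'$ such that: (i) for every $k$ there is a bijection between singular points of $v$ of index $k$ and critical $k$-cells of $V$, and if $p$ corresponds to $\sigma$ then $p\in\phi(|\sigma|)$; (ii) for singular points $p,q$ of index $k+1,k$ with corresponding critical cells $\tau,\sigma$ there is a bijection between flow lines from $p$ to $q$ and $V$-paths from a hyperface of $\tau$ to $\sigma$; (iii) the bijection in (i) induces an isomorphism $\mathrm{MC}_\bullet(v)\cong\overline{\mathrm{MC}}_\bullet(V)$. Subdivision: $\Delta(K)$ is the barycentric subdivision of $K$, and $|\Delta(K)|$ is identified with $|K|$. Given a gradient-like combinatorial vector field $V$ on $K$ and, for each critical $k$-cell $\sigma$ of $V$, a choice of a $k$-cell of $\Delta(K)$ lying in $\sigma$, the canonical construction of Zhukova yields a combinatorial vector field $\Delta(V)$ on $\Delta(K)$, depending on the choices, which enters only through its following known properties: $\Delta(V)$ is gradient-like; its critical cells are exactly the chosen cells, giving a bijection between critical $k$-cells of $V$ and of $\Delta(V)$ for all $k$; and there is a one-to-one correspondence between gradient paths of $V$ and of $\Delta(V)$ respecting this bijection, so that the bijection induces an isomorphism $\overline{\mathrm{MC}}_\bullet(V)\cong\overline{\mathrm{MC}}_\bullet(\Delta(V))$. $\Delta^n(V)$ on $\Delta^n(M')$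 is obtained by iterating, with new choices at each step. For each $n$, $\overline{\mathrm{MC}}_\bullet(\Delta^n(V))$ is weighted by $\mathrm{w}(\tau,\sigma)=d_M(\phi(b(\tau)),\phi(b(\sigma)))$, where $b(\sigma)\in|\sigma|$ is the barycenter. Construction of $X$: let $C_\bullet$ be a chain complex with bases $\mathcal{B}_k$ and positive weights $\mathrm{w}$ on pairs in $\mathcal{B}_k\times\mathcal{B}_{k-1}$ (pairs of equal weight, if any, being totally ordered). For basis elements $a\in\mathcal{B}_m$, $b\in\mathcal{B}_{m-1}$ with the coefficient $\langle\partial a,b\rangle$ of $b$ in $\partial a$ non-zero, simplifying $(a,b)$ gives the complex with $C_m$ replaced by $C_m/\mathrm{Span}(a)$, $C_{m-1}$ by $C_{m-1}/\mathrm{Span}(\partial a)$, other degrees unchanged, induced differentials, bases the classes of basis elements other than $a,b$, and inherited weights and orders. As long as the differential is non-zero, simplify the pair of minimal weight (the first in the order in case of ties) among pairs with $\langle\partial a,b\rangle\ne0$. This yields pairs $(a_1,b_1),\dots,(a_r,b_r)$ and complexes $C_\bullet=C^{(0)},\dots,C^{(r)}$ with quotient maps. With $t_0=0$, $t_i=\sum_{j\le i}\mathrm{w}(a_j,b_j)$, $t_{r+1}=\infty$, put $X(C_\bullet)^t=C^{(i)}$ for $t_i\le t<t_{i+1}$, with internal maps identities and compositions of quotient maps. $X(v):=X(\mathrm{MC}_\bullet(v))$ and $X(\Delta^n(V)):=X(\overline{\mathrm{MC}}_\bullet(\Delta^n(V)))$. *)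

theory Defs
  imports
    "HOL-Analysis.Analysis"
    "HOL-Algebra.Module"
    "HOL-Library.Z2"
    "Jordan_Normal_Form.Char_Poly"
begin

section \<open>Chain complexes over the field with two elements\<close>

definition F2 :: "bit ring" where
  "F2 = \<lparr>carrier = UNIV, mult = (*), one = 1, zero = 0, add = (+)\<rparr>"

definition f2_linear :: "(bit, 'a) module \<Rightarrow> (bit, 'b) module \<Rightarrow> ('a \<Rightarrow> 'b) \<Rightarrow> bool" where
  "f2_linear V W f \<longleftrightarrow>
     f \<in> carrier V \<rightarrow> carrier W \<and>
     (\<forall>x\<in>carrier V. \<forall>y\<in>carrier V. f (x \<oplus>\<^bsub>V\<^esub> y) = f x \<oplus>\<^bsub>W\<^esub> f y) \<and>
     (\<forall>c. \<forall>x\<in>carrier V. f (c \<odot>\<^bsub>V\<^esub> x) = c \<odot>\<^bsub>W\<^esub> f x)"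

subsection \<open>Parametrized chain complexes and the interleaving distance\<close>

text \<open>Only parameters \<open>t \<ge> 0\<close> matter. \<open>pdiff X t k\<close> is the differential from degree
  \<open>k + 1\<close> to degree \<open>k\<close>; there is no differential out of degree \<open>0\<close>.\<close>

record 'a pcomplex =
  pobj :: "real \<Rightarrow> nat \<Rightarrow> (bit, 'a) module"
  pdiff :: "real \<Rightarrow> nat \<Rightarrow> 'a \<Rightarrow> 'a"
  ptrans :: "real \<Rightarrow> real \<Rightarrow> nat \<Rightarrow> 'a \<Rightarrow> 'a"

text \<open>Over a finite field a vector space is finite-dimensional iff its carrier is finite.\<close>

definition parametrized_complex :: "'a pcomplex \<Rightarrow> bool" where
  "parametrized_complex X \<longleftrightarrow>
     (\<forall>t\<ge>0.
        (\<forall>k. module F2 (pobj X t k) \<and> finite (carrier (pobj X t k))) \<and>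
        finite {k. carrier (pobj X t k) \<noteq> {\<zero>\<^bsub>pobj X t k\<^esub>}} \<and>
        (\<forall>k. f2_linear (pobj X t (Suc k)) (pobj X t k) (pdiff X t k)) \<and>
        (\<forall>k. \<forall>x\<in>carrier (pobj X t (Suc (Suc k))).
           pdiff X t k (pdiff X t (Suc k) x) = \<zero>\<^bsub>pobj X t k\<^esub>) \<and>
        (\<forall>k. \<forall>x\<in>carrier (pobj X t k). ptrans X t t k x = x)) \<and>
     (\<forall>s t. 0 \<le> s \<and> s \<le> t \<longrightarrow>
        (\<forall>k. f2_linear (pobj X s k) (pobj X t k) (ptrans X s t k)) \<and>
        (\<forall>k. \<forall>x\<in>carrier (pobj X s (Suc k)).
           pdiff X t k (ptrans X s t (Suc k) x) = ptrans X s t k (pdiff X s k x))) \<and>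
     (\<forall>r s t. 0 \<le> r \<and> r \<le> s \<and> s \<le> t \<longrightarrow>
        (\<forall>k. \<forall>x\<in>carrier (pobj X r k).
           ptrans X s t k (ptrans X r s k x) = ptrans X r t k x))"

definition pshift :: "real \<Rightarrow> 'a pcomplex \<Rightarrow> 'a pcomplex" where
  "pshift e X = \<lparr>pobj = (\<lambda>t. pobj X (t + e)), pdiff = (\<lambda>t. pdiff X (t + e)),
                 ptrans = (\<lambda>s t. ptrans X (s + e) (t + e))\<rparr>"

definition natural_transformation ::
  "'a pcomplex \<Rightarrow> 'b pcomplex \<Rightarrow> (real \<Rightarrow> nat \<Rightarrow> 'a \<Rightarrow> 'b) \<Rightarrow> bool" where
  "natural_transformation X Y \<phi> \<longleftrightarrow>
     (\<forall>t\<ge>0. \<forall>k. f2_linear (pobj X t k) (pobj Y t k) (\<phi> t k)) \<and>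
     (\<forall>t\<ge>0. \<forall>k. \<forall>x\<in>carrier (pobj X t (Suc k)).
        pdiff Y t k (\<phi> t (Suc k) x) = \<phi> t k (pdiff X t k x)) \<and>
     (\<forall>s t. 0 \<le> s \<and> s \<le> t \<longrightarrow>
        (\<forall>k. \<forall>x\<in>carrier (pobj X s k). ptrans Y s t k (\<phi> s k x) = \<phi> t k (ptrans X s t k x)))"

definition interleaving ::
  "real \<Rightarrow> 'a pcomplex \<Rightarrow> 'b pcomplex \<Rightarrow>
   (real \<Rightarrow> nat \<Rightarrow> 'a \<Rightarrow> 'b) \<Rightarrow> (real \<Rightarrow> nat \<Rightarrow> 'b \<Rightarrow> 'a) \<Rightarrow> bool" where
  "interleaving e X Y \<phi> \<psi> \<longleftrightarrow>
     natural_transformation X (pshift e Y) \<phi> \<and>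
     natural_transformation Y (pshift e X) \<psi> \<and>
     (\<forall>t\<ge>0. \<forall>k. \<forall>x\<in>carrier (pobj X t k). \<psi> (t + e) k (\<phi> t k x) = ptrans X t (t + 2 * e) k x) \<and>
     (\<forall>t\<ge>0. \<forall>k. \<forall>y\<in>carrier (pobj Y t k). \<phi> (t + e) k (\<psi> t k y) = ptrans Y t (t + 2 * e) k y)"

text \<open>The value is \<open>\<infinity>\<close> if there is no interleaving; this is also the value given to
  arguments that are not parametrized chain complexes.\<close>

definition interleaving_distance :: "'a pcomplex \<Rightarrow> 'b pcomplex \<Rightarrow> ereal" where
  "interleaving_distance X Y =
     Inf {ereal e | e. e > 0 \<and> parametrized_complex X \<and> parametrized_complex Y \<and>
                       (\<exists>\<phi> \<psi>. interleaving e X Y \<phi> \<psi>)}"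

subsection \<open>Chain complexes with bases\<close>

text \<open>\<open>bcoef C a b\<close> is the coefficient of \<open>b\<close> in \<open>\<partial>a\<close>; only its values for \<open>a\<close>, \<open>b\<close> in bases of
  consecutive degrees matter. A chain is identified with its coefficient function.\<close>

record 'b based_complex =
  basis :: "nat \<Rightarrow> 'b set"
  bcoef :: "'b \<Rightarrow> 'b \<Rightarrow> bit"

definition chains :: "'b based_complex \<Rightarrow> nat \<Rightarrow> ('b \<Rightarrow> bit) set" where
  "chains C k = {x. \<forall>a. a \<notin> basis C k \<longrightarrow> x a = 0}"

definition gen :: "'b \<Rightarrow> 'b \<Rightarrow> bit" where
  "gen a = (\<lambda>b. if b = a then 1 else 0)"

text \<open>The differential from degree \<open>k + 1\<close> to degree \<open>k\<close>.\<close>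

definition bdry :: "'b based_complex \<Rightarrow> nat \<Rightarrow> ('b \<Rightarrow> bit) \<Rightarrow> 'b \<Rightarrow> bit" where
  "bdry C k x = (\<lambda>b. if b \<in> basis C k then \<Sum>a\<in>basis C (Suc k). x a * bcoef C a b else 0)"

definition is_complex :: "'b based_complex \<Rightarrow> bool" where
  "is_complex C \<longleftrightarrow>
     (\<forall>k. finite (basis C k)) \<and> finite {k. basis C k \<noteq> {}} \<and>
     (\<forall>k. \<forall>x\<in>chains C (Suc (Suc k)). bdry C k (bdry C (Suc k) x) = (\<lambda>_. 0))"

definition induced_map :: "'b based_complex \<Rightarrow> ('b \<Rightarrow> 'c) \<Rightarrow> nat \<Rightarrow> ('b \<Rightarrow> bit) \<Rightarrow> 'c \<Rightarrow> bit" where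
  "induced_map C \<beta> k x = (\<lambda>d. \<Sum>a | a \<in> basis C k \<and> \<beta> a = d. x a)"

text \<open>\<open>\<beta>\<close> induces an isomorphism of chain complexes (both sides being chain complexes).\<close>

definition induces_iso :: "'b based_complex \<Rightarrow> 'c based_complex \<Rightarrow> ('b \<Rightarrow> 'c) \<Rightarrow> bool" where
  "induces_iso C D \<beta> \<longleftrightarrow>
     is_complex C \<and> is_complex D \<and>
     (\<forall>k. bij_betw (induced_map C \<beta> k) (chains C k) (chains D k)) \<and>
     (\<forall>k. \<forall>x\<in>chains C (Suc k).
        induced_map C \<beta> k (bdry C k x) = bdry D k (induced_map C \<beta> (Suc k) x))"

subsection \<open>Successive simplification of a based complex\<close>

text \<open>Over the two-element field, linear combinations are sums over finite subsets.\<close>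

definition f2_span :: "('b \<Rightarrow> bit) set \<Rightarrow> ('b \<Rightarrow> bit) set" where
  "f2_span S = {(\<lambda>b. \<Sum>y\<in>T. y b) | T. finite T \<and> T \<subseteq> S}"

text \<open>Let \<open>ps\<close> be the list of pairs simplified so far. Iterated quotients are taken in one step:
  in degree \<open>k\<close> the simplified complex is the quotient of \<open>chains C k\<close> by \<open>killed C ps k\<close>, the
  span of all \<open>a\<close> and all \<open>\<partial>a\<close> of that degree, \<open>(a, b)\<close> ranging over \<open>ps\<close>. Its elements are
  cosets, and its basis consists of the classes of \<open>remaining C ps k\<close>.\<close>

definition killed :: "'b based_complex \<Rightarrow> ('b \<times> 'b) list \<Rightarrow> nat \<Rightarrow> ('b \<Rightarrow> bit) set" where
  "killed C ps k =
     f2_span ({gen a | a. a \<in> basis C k \<and> a \<in> fst ` set ps} \<union>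
              {bdry C k (gen a) | a. a \<in> basis C (Suc k) \<and> a \<in> fst ` set ps})"

definition coset_of :: "('b \<Rightarrow> bit) set \<Rightarrow> ('b \<Rightarrow> bit) \<Rightarrow> ('b \<Rightarrow> bit) set" where
  "coset_of W x = {(\<lambda>b. x b + u b) | u. u \<in> W}"

text \<open>The fields \<open>mult\<close> and \<open>one\<close>, inherited by the record type of modules from rings, are
  irrelevant.\<close>

definition simplified_space ::
  "'b based_complex \<Rightarrow> ('b \<times> 'b) list \<Rightarrow> nat \<Rightarrow> (bit, ('b \<Rightarrow> bit) set) module" where
  "simplified_space C ps k =
     \<lparr>carrier = coset_of (killed C ps k) ` chains C k,
      mult = undefined, one = undefined,
      zero = killed C ps k,
      add = (\<lambda>A B. {(\<lambda>b. x b + y b) | x y. x \<in> A \<and> y \<in> B}),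
      smult = (\<lambda>c A. {(\<lambda>b. c * x b + u b) | x u. x \<in> A \<and> u \<in> killed C ps k})\<rparr>"

definition remaining :: "'b based_complex \<Rightarrow> ('b \<times> 'b) list \<Rightarrow> nat \<Rightarrow> 'b set" where
  "remaining C ps k = basis C k - fst ` set ps - snd ` set ps"

text \<open>The pairs of basis classes \<open>(a, b)\<close> of the simplified complex such that \<open>b\<close> occurs in the
  expansion \<open>y\<close> of the differential of \<open>a\<close> in terms of the basis.\<close>

definition incident_pairs :: "'b based_complex \<Rightarrow> ('b \<times> 'b) list \<Rightarrow> ('b \<times> 'b) set" where
  "incident_pairs C ps =
     {(a, b). \<exists>k. a \<in> remaining C ps (Suc k) \<and> b \<in> remaining C ps k \<and>
        (\<exists>y. (\<forall>d. d \<notin> remaining C ps k \<longrightarrow> y d = 0) \<and>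
             coset_of (killed C ps k) (bdry C k (gen a)) = coset_of (killed C ps k) y \<and>
             y b \<noteq> 0)}"

text \<open>A linear order on all pairs, used only to break ties between pairs of equal weight.\<close>

definition tie_order :: "'b based_complex \<Rightarrow> ('b \<times> 'b) rel \<Rightarrow> bool" where
  "tie_order C r \<longleftrightarrow> linear_order_on {(a, b). \<exists>k. a \<in> basis C (Suc k) \<and> b \<in> basis C k} r"

definition next_pair ::
  "'b based_complex \<Rightarrow> ('b \<Rightarrow> 'b \<Rightarrow> real) \<Rightarrow> ('b \<times> 'b) rel \<Rightarrow> ('b \<times> 'b) list \<Rightarrow> 'b \<times> 'b" where
  "next_pair C w r ps =
     (THE p. p \<in> incident_pairs C ps \<and>
        (\<forall>q\<in>incident_pairs C ps.
           case_prod w p < case_prod w q \<or> case_prod w p = case_prod w q \<and> (p, q) \<in> r))"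

primrec simplified_pairs ::
  "'b based_complex \<Rightarrow> ('b \<Rightarrow> 'b \<Rightarrow> real) \<Rightarrow> ('b \<times> 'b) rel \<Rightarrow> nat \<Rightarrow> ('b \<times> 'b) list" where
  "simplified_pairs C w r 0 = []"
| "simplified_pairs C w r (Suc i) =
     (let ps = simplified_pairs C w r i
      in if incident_pairs C ps = {} then ps else ps @ [next_pair C w r ps])"

definition simp_time ::
  "'b based_complex \<Rightarrow> ('b \<Rightarrow> 'b \<Rightarrow> real) \<Rightarrow> ('b \<times> 'b) rel \<Rightarrow> nat \<Rightarrow> real" where
  "simp_time C w r i = (\<Sum>p\<leftarrow>simplified_pairs C w r i. case_prod w p)"

text \<open>The index \<open>i\<close> with \<open>t\<^sub>i \<le> t < t\<^sub>i\<^sub>+\<^sub>1\<close>, where \<open>t\<^sub>i\<^sub>+\<^sub>1 = \<infinity>\<close> once the differential vanishes.\<close>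

definition simp_stage ::
  "'b based_complex \<Rightarrow> ('b \<Rightarrow> 'b \<Rightarrow> real) \<Rightarrow> ('b \<times> 'b) rel \<Rightarrow> real \<Rightarrow> nat" where
  "simp_stage C w r t =
     (LEAST i. incident_pairs C (simplified_pairs C w r i) = {} \<or> t < simp_time C w r (Suc i))"

definition pairs_at ::
  "'b based_complex \<Rightarrow> ('b \<Rightarrow> 'b \<Rightarrow> real) \<Rightarrow> ('b \<times> 'b) rel \<Rightarrow> real \<Rightarrow> ('b \<times> 'b) list" where
  "pairs_at C w r t = simplified_pairs C w r (simp_stage C w r t)"

definition pcomplex_of ::
  "'b based_complex \<Rightarrow> ('b \<Rightarrow> 'b \<Rightarrow> real) \<Rightarrow> ('b \<times> 'b) rel \<Rightarrow> ('b \<Rightarrow> bit) set pcomplex" where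
  "pcomplex_of C w r =
     \<lparr>pobj = (\<lambda>t. simplified_space C (pairs_at C w r t)),
      pdiff = (\<lambda>t k A. {(\<lambda>b. bdry C k x b + u b) | x u.
                           x \<in> A \<and> u \<in> killed C (pairs_at C w r t) k}),
      ptrans = (\<lambda>s t k A. {(\<lambda>b. x b + u b) | x u.
                           x \<in> A \<and> u \<in> killed C (pairs_at C w r t) k})\<rparr>"

section \<open>Manifolds and Morse--Smale vector fields\<close>

subsection \<open>Smooth functions on open subsets of Euclidean space\<close>

text \<open>Points of n-dimensional Euclidean space are sequences vanishing from index \<open>n\<close> on
  (\<^const>\<open>Euclidean_space\<close>), so the dimension is a number, possibly \<open>0\<close>.\<close>

definition partial :: "nat \<Rightarrow> ((nat \<Rightarrow> real) \<Rightarrow> real) \<Rightarrow> (nat \<Rightarrow> real) \<Rightarrow> real" where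
  "partial i f y = deriv (\<lambda>s. f (y(i := s))) (y i)"

primrec Ck_on :: "nat \<Rightarrow> nat \<Rightarrow> (nat \<Rightarrow> real) set \<Rightarrow> ((nat \<Rightarrow> real) \<Rightarrow> real) \<Rightarrow> bool" where
  "Ck_on n 0 S f \<longleftrightarrow> continuous_map (subtopology (Euclidean_space n) S) euclideanreal f"
| "Ck_on n (Suc k) S f \<longleftrightarrow>
     continuous_map (subtopology (Euclidean_space n) S) euclideanreal f \<and>
     (\<forall>i<n. (\<forall>y\<in>S. (\<lambda>s. f (y(i := s))) differentiable (at (y i))) \<and> Ck_on n k S (partial i f))"

definition smooth_on :: "nat \<Rightarrow> (nat \<Rightarrow> real) set \<Rightarrow> ((nat \<Rightarrow> real) \<Rightarrow> real) \<Rightarrow> bool" where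
  "smooth_on n S f \<longleftrightarrow> (\<forall>k. Ck_on n k S f)"

subsection \<open>Closed oriented Riemannian manifolds\<close>

text \<open>A chart is a domain together with a coordinate map. Vector fields and the metric are given by
  their components in each chart of the atlas, as functions of the point of the manifold.
  \<open>far\<close> is the value of the distance between points of different components.\<close>

type_synonym 'm chart = "'m set \<times> ('m \<Rightarrow> nat \<Rightarrow> real)"

record 'm manifold =
  mtop :: "'m topology"
  mdim :: nat
  atlas :: "'m chart set"
  rmetric :: "'m chart \<Rightarrow> 'm \<Rightarrow> nat \<Rightarrow> nat \<Rightarrow> real"
  far :: real

definition chart_inv :: "'m chart \<Rightarrow> (nat \<Rightarrow> real) \<Rightarrow> 'm" where
  "chart_inv c = inv_into (fst c) (snd c)"

text \<open>The Jacobian, at the point \<open>p\<close>, of the change of coordinates from \<open>c\<close> to \<open>c'\<close>.\<close>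

definition jacobian :: "'m chart \<Rightarrow> 'm chart \<Rightarrow> 'm \<Rightarrow> nat \<Rightarrow> nat \<Rightarrow> real" where
  "jacobian c c' p k i = partial i (\<lambda>y. snd c' (chart_inv c y) k) (snd c p)"

definition is_chart :: "'m topology \<Rightarrow> nat \<Rightarrow> 'm chart \<Rightarrow> bool" where
  "is_chart T n c \<longleftrightarrow>
     openin T (fst c) \<and> openin (Euclidean_space n) (snd c ` fst c) \<and>
     homeomorphic_map (subtopology T (fst c)) (subtopology (Euclidean_space n) (snd c ` fst c))
       (snd c)"

text \<open>A compact Hausdorff locally Euclidean space is automatically second countable.
  The orientation is given by an atlas with orientation preserving coordinate changes.\<close>

definition closed_oriented_manifold :: "'m manifold \<Rightarrow> bool" where
  "closed_oriented_manifold M \<longleftrightarrow>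
     (let n = mdim M in
      compact_space (mtop M) \<and> Hausdorff_space (mtop M) \<and>
      (\<forall>c\<in>atlas M. is_chart (mtop M) n c) \<and>
      (\<Union>c\<in>atlas M. fst c) = topspace (mtop M) \<and>
      (\<forall>c\<in>atlas M. \<forall>c'\<in>atlas M.
         (\<forall>k<n. smooth_on n (snd c ` (fst c \<inter> fst c')) (\<lambda>y. snd c' (chart_inv c y) k)) \<and>
         (\<forall>p\<in>fst c \<inter> fst c'.
            Determinant.det (Matrix.mat n n (\<lambda>(k, i). jacobian c c' p k i)) > 0)))"

definition riemannian_metric :: "'m manifold \<Rightarrow> bool" where
  "riemannian_metric M \<longleftrightarrow>
     (let n = mdim M; g = rmetric M in
      (\<forall>c\<in>atlas M.
         (\<forall>i<n. \<forall>j<n. smooth_on n (snd c ` fst c) (\<lambda>y. g c (chart_inv c y) i j)) \<and>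
         (\<forall>p\<in>fst c.
            (\<forall>i<n. \<forall>j<n. g c p i j = g c p j i) \<and>
            (\<forall>u. (\<exists>i<n. u i \<noteq> 0) \<longrightarrow> (\<Sum>i<n. \<Sum>j<n. g c p i j * u i * u j) > 0))) \<and>
      (\<forall>c\<in>atlas M. \<forall>c'\<in>atlas M. \<forall>p\<in>fst c \<inter> fst c'. \<forall>i<n. \<forall>j<n.
         g c p i j = (\<Sum>k<n. \<Sum>l<n. jacobian c c' p k i * jacobian c c' p l j * g c' p k l)))"

text \<open>The speed does not depend on the chart.\<close>

definition speed :: "'m manifold \<Rightarrow> (real \<Rightarrow> 'm) \<Rightarrow> real \<Rightarrow> real" where
  "speed M \<gamma> t =
     (let c = (SOME c. c \<in> atlas M \<and> \<gamma> t \<in> fst c);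
          u = (\<lambda>i. deriv (\<lambda>s. snd c (\<gamma> s) i) t)
      in sqrt (\<Sum>i<mdim M. \<Sum>j<mdim M. rmetric M c (\<gamma> t) i j * u i * u j))"

definition piecewise_C1_path :: "'m manifold \<Rightarrow> (real \<Rightarrow> 'm) \<Rightarrow> bool" where
  "piecewise_C1_path M \<gamma> \<longleftrightarrow>
     pathin (mtop M) \<gamma> \<and>
     (\<exists>S. finite S \<and>
        (\<forall>c\<in>atlas M. \<forall>i<mdim M.
           (\<lambda>t. snd c (\<gamma> t) i) C1_differentiable_on {t \<in> {0..1} - S. \<gamma> t \<in> fst c}))"

definition path_length :: "'m manifold \<Rightarrow> (real \<Rightarrow> 'm) \<Rightarrow> ennreal" where
  "path_length M \<gamma> = (\<integral>\<^sup>+t\<in>{0..1}. ennreal (speed M \<gamma> t) \<partial>lborel)"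

definition length_distance :: "'m manifold \<Rightarrow> 'm \<Rightarrow> 'm \<Rightarrow> real" where
  "length_distance M p q =
     enn2real (INF \<gamma>\<in>{\<gamma>. piecewise_C1_path M \<gamma> \<and> \<gamma> 0 = p \<and> \<gamma> 1 = q}. path_length M \<gamma>)"

definition dist_M :: "'m manifold \<Rightarrow> 'm \<Rightarrow> 'm \<Rightarrow> real" where
  "dist_M M p q = (if connected_component_of (mtop M) p q then length_distance M p q else far M)"

definition closed_oriented_riemannian_manifold :: "'m manifold \<Rightarrow> bool" where
  "closed_oriented_riemannian_manifold M \<longleftrightarrow>
     closed_oriented_manifold M \<and> riemannian_metric M \<and>
     (\<forall>p q. connected_component_of (mtop M) p q \<longrightarrow> length_distance M p q \<le> far M)"

subsection \<open>Vector fields and flows\<close>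

type_synonym 'm vector_field = "'m chart \<Rightarrow> 'm \<Rightarrow> nat \<Rightarrow> real"

definition smooth_vector_field :: "'m manifold \<Rightarrow> 'm vector_field \<Rightarrow> bool" where
  "smooth_vector_field M v \<longleftrightarrow>
     (let n = mdim M in
      (\<forall>c\<in>atlas M. \<forall>i<n. smooth_on n (snd c ` fst c) (\<lambda>y. v c (chart_inv c y) i)) \<and>
      (\<forall>c\<in>atlas M. \<forall>c'\<in>atlas M. \<forall>p\<in>fst c \<inter> fst c'. \<forall>k<n.
         v c' p k = (\<Sum>i<n. jacobian c c' p k i * v c p i)))"

definition integral_curve :: "'m manifold \<Rightarrow> 'm vector_field \<Rightarrow> (real \<Rightarrow> 'm) \<Rightarrow> bool" where
  "integral_curve M v \<gamma> \<longleftrightarrow>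
     continuous_map euclideanreal (mtop M) \<gamma> \<and>
     (\<forall>t. \<forall>c\<in>atlas M. \<gamma> t \<in> fst c \<longrightarrow>
        (\<forall>i<mdim M. ((\<lambda>s. snd c (\<gamma> s) i) has_real_derivative v c (\<gamma> t) i) (at t)))"

text \<open>On a closed manifold the integral curve through a point exists for all times and is unique.\<close>

definition flow :: "'m manifold \<Rightarrow> 'm vector_field \<Rightarrow> real \<Rightarrow> 'm \<Rightarrow> 'm" where
  "flow M v t p = (THE q. \<exists>\<gamma>. integral_curve M v \<gamma> \<and> \<gamma> 0 = p \<and> \<gamma> t = q)"

definition Sing :: "'m manifold \<Rightarrow> 'm vector_field \<Rightarrow> 'm set" where
  "Sing M v = {p \<in> topspace (mtop M). \<forall>c\<in>atlas M. p \<in> fst c \<longrightarrow> (\<forall>i<mdim M. v c p i = 0)}"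

text \<open>Chains consist of at least one step.\<close>

definition chain_recurrent :: "'m manifold \<Rightarrow> 'm vector_field \<Rightarrow> 'm set" where
  "chain_recurrent M v =
     {p \<in> topspace (mtop M). \<forall>T>0. \<forall>e>0. \<exists>m x t. m \<ge> 1 \<and> x 0 = p \<and> x m = p \<and>
        (\<forall>i\<le>m. x i \<in> topspace (mtop M)) \<and>
        (\<forall>i<m. t i > T \<and> dist_M M (flow M v (t i) (x i)) (x (Suc i)) \<le> e)}"

definition hyperbolic :: "'m manifold \<Rightarrow> 'm vector_field \<Rightarrow> 'm \<Rightarrow> bool" where
  "hyperbolic M v p \<longleftrightarrow>
     (\<forall>c\<in>atlas M. p \<in> fst c \<longrightarrow>
        (\<forall>z. eigenvalue (Matrix.mat (mdim M) (mdim M)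
                 (\<lambda>(i, j). complex_of_real
                    (partial j (\<lambda>y. v c (chart_inv c y) i) (snd c p)))) z \<longrightarrow> Re z \<noteq> 0))"

definition stable_manifold :: "'m manifold \<Rightarrow> 'm vector_field \<Rightarrow> 'm \<Rightarrow> 'm set" where
  "stable_manifold M v p =
     {q \<in> topspace (mtop M). limitin (mtop M) (\<lambda>t. flow M v t q) p at_top}"

definition unstable_manifold :: "'m manifold \<Rightarrow> 'm vector_field \<Rightarrow> 'm \<Rightarrow> 'm set" where
  "unstable_manifold M v p =
     {q \<in> topspace (mtop M). limitin (mtop M) (\<lambda>t. flow M v t q) p at_bot}"

text \<open>Stable and unstable manifolds of hyperbolic fixed points are injectively immersed copies of
  Euclidean spaces; this is the submanifold structure that defines their dimension and their
  tangent spaces. Tangent vectors at \<open>x\<close> are given by their components in a chart around \<open>x\<close>.\<close>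

definition immersed_as :: "'m manifold \<Rightarrow> nat \<Rightarrow> ((nat \<Rightarrow> real) \<Rightarrow> 'm) \<Rightarrow> 'm set \<Rightarrow> bool" where
  "immersed_as M k \<iota> W \<longleftrightarrow>
     (let R = topspace (Euclidean_space k) in
      continuous_map (Euclidean_space k) (mtop M) \<iota> \<and> inj_on \<iota> R \<and> \<iota> ` R = W \<and>
      (\<forall>c\<in>atlas M.
         (\<forall>i<mdim M. smooth_on k {y \<in> R. \<iota> y \<in> fst c} (\<lambda>y. snd c (\<iota> y) i)) \<and>
         (\<forall>y\<in>R. \<iota> y \<in> fst c \<longrightarrow>
            (\<forall>u. (\<forall>i<mdim M. (\<Sum>j<k. partial j (\<lambda>y. snd c (\<iota> y) i) y * u j) = 0) \<longrightarrow>
                 (\<forall>j<k. u j = 0)))))"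

definition submanifold_dim :: "'m manifold \<Rightarrow> 'm set \<Rightarrow> nat" where
  "submanifold_dim M W = (THE k. \<exists>\<iota>. immersed_as M k \<iota> W)"

definition tangent_space :: "'m manifold \<Rightarrow> 'm chart \<Rightarrow> 'm set \<Rightarrow> 'm \<Rightarrow> (nat \<Rightarrow> real) set" where
  "tangent_space M c W x =
     {(\<lambda>i. \<Sum>j<k. partial j (\<lambda>y. snd c (\<iota> y) i) y * u j) | k \<iota> y u.
        immersed_as M k \<iota> W \<and> y \<in> topspace (Euclidean_space k) \<and> \<iota> y = x}"

definition intersect_transversally :: "'m manifold \<Rightarrow> 'm set \<Rightarrow> 'm set \<Rightarrow> bool" where
  "intersect_transversally M W W' \<longleftrightarrow>
     (\<forall>x\<in>W \<inter> W'. \<forall>c\<in>atlas M. x \<in> fst c \<longrightarrow>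
        (\<forall>u. \<exists>a\<in>tangent_space M c W x. \<exists>b\<in>tangent_space M c W' x. \<forall>i<mdim M. u i = a i + b i))"

definition gradient_like_morse_smale :: "'m manifold \<Rightarrow> 'm vector_field \<Rightarrow> bool" where
  "gradient_like_morse_smale M v \<longleftrightarrow>
     smooth_vector_field M v \<and>
     finite (chain_recurrent M v) \<and> chain_recurrent M v \<subseteq> Sing M v \<and>
     (\<forall>p\<in>chain_recurrent M v. hyperbolic M v p) \<and>
     (\<forall>p\<in>Sing M v. \<forall>q\<in>Sing M v.
        intersect_transversally M (stable_manifold M v p) (unstable_manifold M v q))"

definition general_position :: "'m manifold \<Rightarrow> 'm vector_field \<Rightarrow> bool" where
  "general_position M v \<longleftrightarrow>
     (\<forall>p\<in>Sing M v. \<forall>q\<in>Sing M v. \<forall>p'\<in>Sing M v. \<forall>q'\<in>Sing M v.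
        p \<noteq> q \<and> p' \<noteq> q' \<and> {p, q} \<noteq> {p', q'} \<longrightarrow> dist_M M p q \<noteq> dist_M M p' q')"

subsection \<open>The Morse complex\<close>

definition Sing_index :: "'m manifold \<Rightarrow> 'm vector_field \<Rightarrow> nat \<Rightarrow> 'm set" where
  "Sing_index M v k = {p \<in> Sing M v. submanifold_dim M (unstable_manifold M v p) = k}"

text \<open>Flow lines are unparametrized. For \<open>p \<noteq> q\<close> none of them is constant.\<close>

definition flow_lines :: "'m manifold \<Rightarrow> 'm vector_field \<Rightarrow> 'm \<Rightarrow> 'm \<Rightarrow> 'm set set" where
  "flow_lines M v p q =
     {range (\<lambda>t. flow M v t x) | x. x \<in> unstable_manifold M v p \<inter> stable_manifold M v q}"

definition morse_complex :: "'m manifold \<Rightarrow> 'm vector_field \<Rightarrow> 'm based_complex" where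
  "morse_complex M v =
     \<lparr>basis = Sing_index M v, bcoef = (\<lambda>p q. of_nat (card (flow_lines M v p q)))\<rparr>"

section \<open>Combinatorial vector fields\<close>

text \<open>Simplicial complexes are finite geometric complexes in a Euclidean space, as in
  \<^const>\<open>simplicial_complex\<close>; a simplex is the point set \<open>\<bar>\<sigma>\<bar>\<close>, the realization of \<open>K\<close> is \<open>\<Union>K\<close>, and
  the empty face, which the library includes, is not a cell. A combinatorial vector field maps a
  cell to \<open>None\<close> (the value \<open>0\<close>) or to \<open>Some\<close> cell.\<close>

type_synonym 'w cvf = "'w set \<Rightarrow> 'w set option"

definition cells :: "'w::euclidean_space set set \<Rightarrow> 'w set set" where
  "cells K = {\<sigma> \<in> K. \<sigma> \<noteq> {}}"

definition combinatorial_vector_field :: "'w::euclidean_space set set \<Rightarrow> 'w cvf \<Rightarrow> bool" where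
  "combinatorial_vector_field K V \<longleftrightarrow>
     (\<forall>\<sigma>\<in>cells K.
        (V \<sigma> = None \<or>
         (\<exists>\<tau>\<in>cells K. V \<sigma> = Some \<tau> \<and> aff_dim \<tau> = aff_dim \<sigma> + 1 \<and> \<sigma> face_of \<tau> \<and> V \<tau> = None)) \<and>
        card {\<rho> \<in> cells K. V \<rho> = Some \<sigma>} \<le> 1)"

definition critical_cells :: "'w::euclidean_space set set \<Rightarrow> 'w cvf \<Rightarrow> nat \<Rightarrow> 'w set set" where
  "critical_cells K V k =
     {\<sigma> \<in> cells K. aff_dim \<sigma> = int k \<and> V \<sigma> = None \<and> {\<rho> \<in> cells K. V \<rho> = Some \<sigma>} = {}}"

definition V_path :: "'w::euclidean_space set set \<Rightarrow> 'w cvf \<Rightarrow> 'w set list \<Rightarrow> bool" where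
  "V_path K V ss \<longleftrightarrow>
     ss \<noteq> [] \<and> set ss \<subseteq> cells K \<and>
     (\<exists>k. \<forall>\<sigma>\<in>set ss. aff_dim \<sigma> = k) \<and>
     (\<forall>i. Suc i < length ss \<longrightarrow>
        ss ! i \<noteq> ss ! Suc i \<and> (\<exists>\<tau>. V (ss ! i) = Some \<tau> \<and> ss ! Suc i facet_of \<tau>))"

definition gradient_like_cvf :: "'w::euclidean_space set set \<Rightarrow> 'w cvf \<Rightarrow> bool" where
  "gradient_like_cvf K V \<longleftrightarrow>
     combinatorial_vector_field K V \<and>
     \<not> (\<exists>ss. V_path K V ss \<and> length ss > 1 \<and> hd ss = last ss)"

definition V_paths_between ::
  "'w::euclidean_space set set \<Rightarrow> 'w cvf \<Rightarrow> 'w set \<Rightarrow> 'w set \<Rightarrow> 'w set list set" where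
  "V_paths_between K V \<tau> \<sigma> = {ss. V_path K V ss \<and> hd ss facet_of \<tau> \<and> last ss = \<sigma>}"

definition comb_morse_complex ::
  "'w::euclidean_space set set \<Rightarrow> 'w cvf \<Rightarrow> 'w set based_complex" where
  "comb_morse_complex K V =
     \<lparr>basis = critical_cells K V,
      bcoef = (\<lambda>\<tau> \<sigma>. of_nat (card (V_paths_between K V \<tau> \<sigma>)))\<rparr>"

definition vf_triangulation ::
  "'m manifold \<Rightarrow> 'm vector_field \<Rightarrow>
   'w::euclidean_space set set \<Rightarrow> ('w \<Rightarrow> 'm) \<Rightarrow> 'w cvf \<Rightarrow> bool" where
  "vf_triangulation M v K \<phi> V \<longleftrightarrow>
     simplicial_complex K \<and>
     homeomorphic_map (top_of_set (\<Union>K)) (mtop M) \<phi> \<and>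
     gradient_like_cvf K V \<and>
     (\<exists>\<beta>. (\<forall>k. bij_betw \<beta> (Sing_index M v k) (critical_cells K V k) \<and>
                (\<forall>p\<in>Sing_index M v k. p \<in> \<phi> ` \<beta> p)) \<and>
          (\<forall>k. \<forall>p\<in>Sing_index M v (Suc k). \<forall>q\<in>Sing_index M v k.
             \<exists>f. bij_betw f (flow_lines M v p q) (V_paths_between K V (\<beta> p) (\<beta> q))) \<and>
          induces_iso (morse_complex M v) (comb_morse_complex K V) \<beta>)"

subsection \<open>Barycentric subdivision\<close>

definition barycenter :: "'w::euclidean_space set \<Rightarrow> 'w" where
  "barycenter \<sigma> =
     (\<Sum>x | x extreme_point_of \<sigma>. x) /\<^sub>R real (card {x. x extreme_point_of \<sigma>})"

text \<open>The simplices are spanned by the barycenters of flags of cells; the empty flag gives the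
  empty simplex. The realizations of \<open>K\<close> and \<open>sd K\<close> are the same subset of the ambient space.\<close>

definition sd :: "'w::euclidean_space set set \<Rightarrow> 'w set set" where
  "sd K = {convex hull (barycenter ` F) | F.
             finite F \<and> F \<subseteq> cells K \<and> (\<forall>\<sigma>\<in>F. \<forall>\<tau>\<in>F. \<sigma> \<subseteq> \<tau> \<or> \<tau> \<subseteq> \<sigma>)}"

definition valid_choice ::
  "'w::euclidean_space set set \<Rightarrow> 'w cvf \<Rightarrow> ('w set \<Rightarrow> 'w set) \<Rightarrow> bool" where
  "valid_choice K V c \<longleftrightarrow>
     (\<forall>k. \<forall>\<sigma>\<in>critical_cells K V k. c \<sigma> \<in> cells (sd K) \<and> aff_dim (c \<sigma>) = int k \<and> c \<sigma> \<subseteq> \<sigma>)"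

text \<open>The properties of Zhukova's construction, \<open>Z K V c\<close> being the field \<open>\<Delta>(V)\<close> on \<open>\<Delta>(K)\<close>
  obtained from the choice \<open>c\<close> of a cell in each critical cell.\<close>

definition subdivision_construction ::
  "('w::euclidean_space set set \<Rightarrow> 'w cvf \<Rightarrow> ('w set \<Rightarrow> 'w set) \<Rightarrow> 'w cvf) \<Rightarrow> bool" where
  "subdivision_construction Z \<longleftrightarrow>
     (\<forall>K V c. simplicial_complex K \<and> gradient_like_cvf K V \<and> valid_choice K V c \<longrightarrow>
        gradient_like_cvf (sd K) (Z K V c) \<and>
        (\<forall>k. bij_betw c (critical_cells K V k) (critical_cells (sd K) (Z K V c) k)) \<and>
        (\<forall>k. \<forall>\<tau>\<in>critical_cells K V (Suc k). \<forall>\<sigma>\<in>critical_cells K V k.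
           \<exists>f. bij_betw f (V_paths_between K V \<tau> \<sigma>)
                          (V_paths_between (sd K) (Z K V c) (c \<tau>) (c \<sigma>))) \<and>
        induces_iso (comb_morse_complex K V) (comb_morse_complex (sd K) (Z K V c)) c)"

text \<open>\<open>c n\<close> is the choice of cells made in the step from the \<open>n\<close>-th to the \<open>n + 1\<close>-st
  subdivision.\<close>

primrec iterated_cvf ::
  "('w::euclidean_space set set \<Rightarrow> 'w cvf \<Rightarrow> ('w set \<Rightarrow> 'w set) \<Rightarrow> 'w cvf) \<Rightarrow>
   'w set set \<Rightarrow> 'w cvf \<Rightarrow> (nat \<Rightarrow> 'w set \<Rightarrow> 'w set) \<Rightarrow> nat \<Rightarrow> 'w cvf" where
  "iterated_cvf Z K V c 0 = V"
| "iterated_cvf Z K V c (Suc n) = Z ((sd ^^ n) K) (iterated_cvf Z K V c n) (c n)"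

definition valid_choice_at ::
  "('w::euclidean_space set set \<Rightarrow> 'w cvf \<Rightarrow> ('w set \<Rightarrow> 'w set) \<Rightarrow> 'w cvf) \<Rightarrow>
   'w set set \<Rightarrow> 'w cvf \<Rightarrow> (nat \<Rightarrow> 'w set \<Rightarrow> 'w set) \<Rightarrow> nat \<Rightarrow> bool" where
  "valid_choice_at Z K V c n \<longleftrightarrow> valid_choice ((sd ^^ n) K) (iterated_cvf Z K V c n) (c n)"

definition iterated_complex ::
  "('w::euclidean_space set set \<Rightarrow> 'w cvf \<Rightarrow> ('w set \<Rightarrow> 'w set) \<Rightarrow> 'w cvf) \<Rightarrow>
   'w set set \<Rightarrow> 'w cvf \<Rightarrow> (nat \<Rightarrow> 'w set \<Rightarrow> 'w set) \<Rightarrow> nat \<Rightarrow> 'w set based_complex" where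
  "iterated_complex Z K V c n = comb_morse_complex ((sd ^^ n) K) (iterated_cvf Z K V c n)"

definition cell_weight :: "'m manifold \<Rightarrow> ('w::euclidean_space \<Rightarrow> 'm) \<Rightarrow> 'w set \<Rightarrow> 'w set \<Rightarrow> real" where
  "cell_weight M \<phi> \<tau> \<sigma> = dist_M M (\<phi> (barycenter \<tau>)) (\<phi> (barycenter \<sigma>))"

end

theory Submission
  imports Defs
begin

text \<open>
  The Morse complex of \<open>v\<close> and the complexes of all subdivisions are the same based complex, by bijections
  of bases that preserve the incidence coefficients; only the weights differ. If at each of the first \<open>N\<close>
  steps the chosen cell contains the singular point to which it corresponds, and the mesh of the \<open>N\<close>-th
  subdivision is small, then, whatever is chosen later, the barycenters of the critical cells stay close to the
  singular points, so the weights are close to those of \<open>v\<close> because \<open>d\<^sub>M\<close> is continuous. In general position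
  all weights of \<open>v\<close> are different; weights sufficiently close to them are in the same order, hence the same
  pairs are simplified in the same order, at times differing by at most \<open>\<epsilon> / 2\<close>, and the quotient maps
  give an interleaving.
\<close>

text \<open>With distinct weights, the pairs to be simplified depend on the incidence coefficients
  and on the order of the weights, and the values of the weights enter only through the times; so
  closeness is needed on two scales, the smallest gap between two weights of \<open>v\<close> and
  \<open>\<epsilon>\<close> divided by the number of pairs. Of the distance one needs only that it
  changes by at most \<open>2 * \<delta>\<close> when both points move by \<delta>. The triangle
  inequality behind this is proved for the infimum of lengths with values in \<open>ennreal\<close>,
  where no path means infinity, and is carried over to \<open>dist_M\<close> only at the end. Short
  paths are found in a chart, moving along one coordinate at a time. On the combinatorial side the
  properties of the construction are granted over simplicial complexes, so \<open>sd K\<close> has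
  to be shown to be one before it can be iterated; this rests on the uniqueness of the coefficients
  of a point with respect to the barycenters of a flag. Finally, a choice is a function of cells and
  not of singular points, so the choices that follow the singular points are found by a recursion
  that also keeps the correspondence between points and cells injective.\<close>

section \<open>Linear algebra over the field with two elements\<close>

text \<open>These default rules turn sums and products of bits into bitwise operations.\<close>

declare add_bit_eq_xor [simp del] mult_bit_eq_and [simp del]

lemma bit_add_self [simp]: "x + x = (0 :: bit)" "x + (x + y) = (y :: bit)"
  by (cases x; simp add: add.assoc[symmetric])+

lemma finite_UNIV_bit: "finite (UNIV :: bit set)"
proof -
  have "UNIV = {0, 1 :: bit}" by (auto intro: bit.exhaust)
  then show ?thesis by (metis finite.simps)
qed

abbreviation vadd :: "('b \<Rightarrow> bit) \<Rightarrow> ('b \<Rightarrow> bit) \<Rightarrow> 'b \<Rightarrow> bit" (infixl \<open>\<boxplus>\<close> 65) where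
  "x \<boxplus> y \<equiv> (\<lambda>b. x b + y b)"

text \<open>The only scalars are 0 and 1, so closure under scalars is automatic.\<close>

definition vec_subspace :: "('b \<Rightarrow> bit) set \<Rightarrow> bool" where
  "vec_subspace W \<longleftrightarrow> (\<lambda>_. 0) \<in> W \<and> (\<forall>x\<in>W. \<forall>y\<in>W. x \<boxplus> y \<in> W)"

text \<open>Additivity is required on all coefficient functions, as \<open>bdry\<close> and
  \<open>induced_map\<close> make sense beyond the chains; compatibility with the scalars 0 and 1
  follows.\<close>

definition vec_additive :: "(('b \<Rightarrow> bit) \<Rightarrow> 'c \<Rightarrow> bit) \<Rightarrow> bool" where
  "vec_additive f \<longleftrightarrow> (\<forall>x y. f (x \<boxplus> y) = f x \<boxplus> f y)"

lemma vec_additive_zero: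
  assumes "vec_additive f"
  shows "f (\<lambda>_. 0) = (\<lambda>_. 0)"
  using assms[unfolded vec_additive_def, rule_format, of "\<lambda>_. 0" "\<lambda>_. 0"] by (simp add: fun_eq_iff)

lemma vec_additive_scale:
  assumes "vec_additive f"
  shows "f (\<lambda>b. c * x b) = (\<lambda>d. c * f x d)"
  using vec_additive_zero[OF assms] by (cases c) simp_all

lemma f2_span_base: "x \<in> S \<Longrightarrow> x \<in> f2_span S"
  by (auto simp: f2_span_def intro!: exI[of _ "{x}"])

text \<open>A span consists of sums over sets, in which no generator occurs twice. This is no loss,
  because adding a generator that is already present cancels it.\<close>

lemma f2_span_subspace: "vec_subspace (f2_span S)"
proof -
  have step: "x \<boxplus> y \<in> f2_span S" if x: "x \<in> f2_span S" and y: "y \<in> S" for x y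
  proof -
    obtain T where T: "finite T" "T \<subseteq> S" "x = (\<lambda>b. \<Sum>z\<in>T. z b)"
      using x by (auto simp: f2_span_def)
    show ?thesis
    proof (cases "y \<in> T")
      case True
      have "x \<boxplus> y = (\<lambda>b. \<Sum>z\<in>T - {y}. z b)"
        unfolding T(3) sum.remove[OF T(1) True] by (simp add: fun_eq_iff add_ac)
      then show ?thesis using T by (auto simp: f2_span_def)
    next
      case False
      then have "x \<boxplus> y = (\<lambda>b. \<Sum>z\<in>insert y T. z b)"
        using T by (simp add: fun_eq_iff add.commute)
      then show ?thesis using T y by (auto simp: f2_span_def intro!: exI[of _ "insert y T"])
    qed
  qed
  have "x \<boxplus> y \<in> f2_span S" if x: "x \<in> f2_span S" and y: "y \<in> f2_span S" for x y
  proof -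
    obtain T where T: "finite T" "T \<subseteq> S" "y = (\<lambda>b. \<Sum>z\<in>T. z b)"
      using y by (auto simp: f2_span_def)
    have "x \<boxplus> (\<lambda>b. \<Sum>z\<in>T. z b) \<in> f2_span S" using T(1,2)
    proof (induction T)
      case empty
      then show ?case using x by simp
    next
      case (insert z T)
      then have "x \<boxplus> (\<lambda>b. \<Sum>z\<in>T. z b) \<boxplus> z \<in> f2_span S"
        using step[of "x \<boxplus> (\<lambda>b. \<Sum>z\<in>T. z b)" z] by simp
      also have "x \<boxplus> (\<lambda>b. \<Sum>z\<in>T. z b) \<boxplus> z = x \<boxplus> (\<lambda>b. \<Sum>z\<in>insert z T. z b)"
        using insert by (simp add: fun_eq_iff add_ac)
      finally show ?case .
    qed
    then show ?thesis using T(3) by simp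
  qed
  moreover have "(\<lambda>_. 0) \<in> f2_span S" by (auto simp: f2_span_def intro!: exI[of _ "{}"])
  ultimately show ?thesis by (simp add: vec_subspace_def)
qed

lemma f2_span_minimal:
  assumes "S \<subseteq> W" "vec_subspace W"
  shows "f2_span S \<subseteq> W"
proof
  fix x assume "x \<in> f2_span S"
  then obtain T where T: "finite T" "T \<subseteq> S" "x = (\<lambda>b. \<Sum>z\<in>T. z b)" by (auto simp: f2_span_def)
  have "(\<lambda>b. \<Sum>z\<in>T. z b) \<in> W" using T(1,2)
    by (induction T) (use assms in \<open>auto simp: vec_subspace_def subset_iff\<close>)
  then show "x \<in> W" using T by simp
qed

lemma f2_span_image:
  assumes f: "vec_additive f" and sub: "f ` S \<subseteq> S'"
  shows "f ` f2_span S \<subseteq> f2_span S'"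
proof -
  have "vec_subspace {x. f x \<in> f2_span S'}"
    using f2_span_subspace[of S'] vec_additive_zero[OF f] f by (auto simp: vec_subspace_def vec_additive_def)
  then have "f2_span S \<subseteq> {x. f x \<in> f2_span S'}"
    using sub f2_span_base by (intro f2_span_minimal) auto
  then show ?thesis by auto
qed

section \<open>Quotient spaces\<close>

text \<open>In characteristic 2 the sum of \<open>x\<close> and \<open>y\<close> is also their
  difference.\<close>

lemma coset_of_eq_iff:
  assumes "vec_subspace W"
  shows "coset_of W x = coset_of W y \<longleftrightarrow> x \<boxplus> y \<in> W"
proof
  assume eq: "coset_of W x = coset_of W y"
  have "x \<in> coset_of W x" using assms by (auto simp: coset_of_def vec_subspace_def intro!: exI[of _ "\<lambda>_. 0"])
  then obtain u where "u \<in> W" "x = y \<boxplus> u" unfolding eq by (auto simp: coset_of_def)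
  then show "x \<boxplus> y \<in> W" by (simp add: add_ac)
next
  have sub: "coset_of W x \<subseteq> coset_of W y" if "x \<boxplus> y \<in> W" for x y
  proof
    fix z assume "z \<in> coset_of W x"
    then obtain u where u: "u \<in> W" "z = x \<boxplus> u" by (auto simp: coset_of_def)
    then have "z = y \<boxplus> (x \<boxplus> y \<boxplus> u)" by (simp add: fun_eq_iff add_ac)
    moreover have "x \<boxplus> y \<boxplus> u \<in> W" using assms u that by (auto simp: vec_subspace_def)
    ultimately show "z \<in> coset_of W y" unfolding coset_of_def
      by (intro CollectI exI[of _ "x \<boxplus> y \<boxplus> u"] conjI)
  qed
  assume "x \<boxplus> y \<in> W"
  moreover from this have "y \<boxplus> x \<in> W" by (simp add: add.commute)
  ultimately show "coset_of W x = coset_of W y" using sub by blast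
qed

lemma coset_of_zero: "coset_of W (\<lambda>_. 0) = W"
  by (simp add: coset_of_def)

text \<open>With \<open>bdry\<close> and with the identity as \<open>f\<close>, these are the fields
  \<open>pdiff\<close> and \<open>ptrans\<close> of \<open>pcomplex_of\<close>. Adding
  \<open>W\<close> turns the image of a coset into a full coset.\<close>

definition quot_map :: "('c \<Rightarrow> bit) set \<Rightarrow> (('b \<Rightarrow> bit) \<Rightarrow> 'c \<Rightarrow> bit) \<Rightarrow> ('b \<Rightarrow> bit) set \<Rightarrow> ('c \<Rightarrow> bit) set" where
  "quot_map W f A = {f x \<boxplus> u | x u. x \<in> A \<and> u \<in> W}"

lemma quot_map_coset:
  assumes W: "vec_subspace W" "vec_subspace W'" and f: "vec_additive f" "f ` W \<subseteq> W'"
  shows "quot_map W' f (coset_of W x) = coset_of W' (f x)"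
proof
  show "quot_map W' f (coset_of W x) \<subseteq> coset_of W' (f x)"
  proof
    fix z assume "z \<in> quot_map W' f (coset_of W x)"
    then obtain u v where uv: "u \<in> W" "v \<in> W'" "z = f (x \<boxplus> u) \<boxplus> v" by (auto simp: quot_map_def coset_of_def)
    then have "z = f x \<boxplus> (f u \<boxplus> v)" using f(1) by (simp add: vec_additive_def add.assoc)
    moreover have "f u \<boxplus> v \<in> W'" using uv f(2) W(2) by (auto simp: vec_subspace_def)
    ultimately show "z \<in> coset_of W' (f x)" by (auto simp: coset_of_def)
  qed
  have "x \<in> coset_of W x" using W by (auto simp: coset_of_def vec_subspace_def intro!: exI[of _ "\<lambda>_. 0"])
  then show "coset_of W' (f x) \<subseteq> quot_map W' f (coset_of W x)"
    by (auto simp: quot_map_def coset_of_def[of W'])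
qed

text \<open>The fields \<open>mult\<close> and \<open>one\<close> are as in
  \<open>simplified_space\<close>, so that the latter is literally an instance, with the chains as
  \<open>U\<close> and the killed space as \<open>W\<close>.\<close>

definition quot_space :: "('b \<Rightarrow> bit) set \<Rightarrow> ('b \<Rightarrow> bit) set \<Rightarrow> (bit, ('b \<Rightarrow> bit) set) module" where
  "quot_space U W =
     \<lparr>carrier = coset_of W ` U, mult = undefined, one = undefined, zero = W,
      add = (\<lambda>A B. {x \<boxplus> y | x y. x \<in> A \<and> y \<in> B}),
      smult = (\<lambda>c A. {(\<lambda>b. c * x b + u b) | x u. x \<in> A \<and> u \<in> W})\<rparr>"

lemma quot_space_simps:
  "carrier (quot_space U W) = coset_of W ` U" "\<zero>\<^bsub>quot_space U W\<^esub> = W"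
  by (simp_all add: quot_space_def)

lemma quot_space_add:
  assumes "vec_subspace W"
  shows "coset_of W x \<oplus>\<^bsub>quot_space U W\<^esub> coset_of W y = coset_of W (x \<boxplus> y)"
proof -
  have W: "(\<lambda>_. 0) \<in> W" "\<And>u v. u \<in> W \<Longrightarrow> v \<in> W \<Longrightarrow> u \<boxplus> v \<in> W"
    using assms by (auto simp: vec_subspace_def)
  have "{a \<boxplus> b | a b. a \<in> coset_of W x \<and> b \<in> coset_of W y} = coset_of W (x \<boxplus> y)"
  proof (intro Set.set_eqI iffI)
    fix z assume "z \<in> {a \<boxplus> b | a b. a \<in> coset_of W x \<and> b \<in> coset_of W y}"
    then obtain u v where uv: "z = x \<boxplus> u \<boxplus> (y \<boxplus> v)" "u \<in> W" "v \<in> W" by (auto simp: coset_of_def)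
    then have "z = x \<boxplus> y \<boxplus> (u \<boxplus> v)" by (simp add: fun_eq_iff add_ac)
    then show "z \<in> coset_of W (x \<boxplus> y)"
      unfolding coset_of_def using W(2)[OF uv(2,3)] by (intro CollectI exI[of _ "u \<boxplus> v"] conjI)
  next
    fix z assume "z \<in> coset_of W (x \<boxplus> y)"
    then obtain u where u: "z = x \<boxplus> u \<boxplus> y" "u \<in> W" by (auto simp: coset_of_def add_ac)
    have "x \<boxplus> u \<in> coset_of W x" using u(2) by (auto simp: coset_of_def)
    moreover have "y \<in> coset_of W y" using W(1) by (auto simp: coset_of_def intro!: exI[of _ "\<lambda>_. 0"])
    ultimately show "z \<in> {a \<boxplus> b | a b. a \<in> coset_of W x \<and> b \<in> coset_of W y}"
      unfolding u(1) by (intro CollectI exI[of _ "x \<boxplus> u"] exI[of _ y] conjI refl)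
  qed
  then show ?thesis by (simp add: quot_space_def)
qed

text \<open>Multiplication by \<open>c\<close> is the map induced on the quotient by an additive map
  that preserves \<open>W\<close>, so \<open>quot_map_coset\<close> applies.\<close>

lemma quot_space_smult:
  assumes "vec_subspace W"
  shows "c \<odot>\<^bsub>quot_space U W\<^esub> coset_of W x = coset_of W (\<lambda>b. c * x b)"
proof -
  have "vec_additive (\<lambda>x b. c * x b)" by (simp add: vec_additive_def distrib_left)
  moreover have "(\<lambda>x b. c * x b) ` W \<subseteq> W" using assms by (cases c) (auto simp: vec_subspace_def)
  ultimately show ?thesis
    using quot_map_coset[OF assms assms, of "\<lambda>x b. c * x b" x] by (simp add: quot_space_def quot_map_def)
qed

lemma cring_F2: "cring F2"
proof (rule cringI)
  show "abelian_group F2"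
  proof (rule abelian_groupI)
    show "\<exists>y\<in>carrier F2. y \<oplus>\<^bsub>F2\<^esub> x = \<zero>\<^bsub>F2\<^esub>" for x
      by (intro bexI[of _ x]) (auto simp: F2_def)
  qed (auto simp: F2_def add_ac)
  show "comm_monoid F2" by (rule comm_monoidI) (auto simp: F2_def mult_ac)
qed (auto simp: F2_def distrib_right)

lemma module_quot_space:
  assumes U: "vec_subspace U" and W: "vec_subspace W"
  shows "module F2 (quot_space U W)"
proof (rule moduleI[OF cring_F2])
  note [simp] = quot_space_simps quot_space_add[OF W] quot_space_smult[OF W]
  note W0 = coset_of_zero[of W]
  have zero: "(\<lambda>_. 0) \<in> U" and add: "\<And>x y. x \<in> U \<Longrightarrow> y \<in> U \<Longrightarrow> x \<boxplus> y \<in> U"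
    using U by (auto simp: vec_subspace_def)
  show "abelian_group (quot_space U W)"
  proof (rule abelian_groupI)
    show "\<zero>\<^bsub>quot_space U W\<^esub> \<in> carrier (quot_space U W)"
      using zero W0 by (auto simp: image_iff intro!: bexI[of _ "\<lambda>_. 0"])
    fix A assume "A \<in> carrier (quot_space U W)"
    then obtain x where x: "x \<in> U" "A = coset_of W x" by auto
    have "\<zero>\<^bsub>quot_space U W\<^esub> \<oplus>\<^bsub>quot_space U W\<^esub> A = coset_of W (\<lambda>_. 0) \<oplus>\<^bsub>quot_space U W\<^esub> coset_of W x"
      using x W0 by simp
    then show "\<zero>\<^bsub>quot_space U W\<^esub> \<oplus>\<^bsub>quot_space U W\<^esub> A = A" using x by simp
    have "A \<oplus>\<^bsub>quot_space U W\<^esub> A = \<zero>\<^bsub>quot_space U W\<^esub>" using x W0 by simp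
    then show "\<exists>y\<in>carrier (quot_space U W). y \<oplus>\<^bsub>quot_space U W\<^esub> A = \<zero>\<^bsub>quot_space U W\<^esub>"
      using x by (intro bexI[of _ A]) auto
  qed (auto simp: add add_ac)
  show "a \<odot>\<^bsub>quot_space U W\<^esub> A \<in> carrier (quot_space U W)" if "A \<in> carrier (quot_space U W)" for a A
    using that zero by (cases a) auto
qed (auto simp: F2_def quot_space_simps quot_space_add[OF W] quot_space_smult[OF W] distrib_left distrib_right mult.assoc)

lemma f2_linear_quot_map:
  assumes W: "vec_subspace W" "vec_subspace W'" and f: "vec_additive f" "f ` W \<subseteq> W'" and U: "f ` U \<subseteq> U'"
  shows "f2_linear (quot_space U W) (quot_space U' W') (quot_map W' f)"
  unfolding f2_linear_def
proof (intro conjI ballI allI)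
  note [simp] = quot_space_simps quot_map_coset[OF W f] quot_space_add[OF W(1)] quot_space_add[OF W(2)]
    quot_space_smult[OF W(1)] quot_space_smult[OF W(2)]
  show "quot_map W' f \<in> carrier (quot_space U W) \<rightarrow> carrier (quot_space U' W')" using U by auto
  fix A assume "A \<in> carrier (quot_space U W)"
  then obtain x where x: "A = coset_of W x" by auto
  show "quot_map W' f (c \<odot>\<^bsub>quot_space U W\<^esub> A) = c \<odot>\<^bsub>quot_space U' W'\<^esub> quot_map W' f A" for c
    using vec_additive_scale[OF f(1)] by (simp add: x)
  fix B assume "B \<in> carrier (quot_space U W)"
  then obtain y where y: "B = coset_of W y" by auto
  show "quot_map W' f (A \<oplus>\<^bsub>quot_space U W\<^esub> B) = quot_map W' f A \<oplus>\<^bsub>quot_space U' W'\<^esub> quot_map W' f B"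
    using f(1) by (simp add: x y vec_additive_def)
qed

section \<open>The parametrized complex of a based complex\<close>

lemma chains_subspace: "vec_subspace (chains C k)"
  by (auto simp: vec_subspace_def chains_def)

lemma finite_chains:
  assumes "finite (basis C k)"
  shows "finite (chains C k)"
proof -
  have "chains C k = {f. \<forall>x. (x \<in> basis C k \<longrightarrow> f x \<in> (UNIV :: bit set)) \<and> (x \<notin> basis C k \<longrightarrow> f x = 0)}"
    by (auto simp: chains_def)
  then show ?thesis using finite_set_of_finite_funs[OF assms finite_UNIV_bit, of 0] by (simp only:)
qed

lemma bdry_additive: "vec_additive (bdry C k)"
  by (auto simp: vec_additive_def bdry_def fun_eq_iff distrib_right sum.distrib)

lemma bdry_chains: "bdry C k x \<in> chains C k"
  by (auto simp: bdry_def chains_def)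

lemma gen_chains: "a \<in> basis C k \<Longrightarrow> gen a \<in> chains C k"
  by (auto simp: gen_def chains_def)

lemma killed_subspace: "vec_subspace (killed C ps k)"
  unfolding killed_def by (rule f2_span_subspace)

lemma killed_mono:
  assumes "set ps \<subseteq> set qs"
  shows "killed C ps k \<subseteq> killed C qs k"
  unfolding killed_def using assms
  by (intro f2_span_minimal[OF _ f2_span_subspace] subsetI f2_span_base) blast

text \<open>The killed spaces form a subcomplex: the boundary of a killed basis element is itself
  among the generators one degree lower, and the boundary of a boundary vanishes. Hence the
  differential descends to the quotients.\<close>

lemma bdry_killed:
  assumes "is_complex C"
  shows "bdry C k ` killed C ps (Suc k) \<subseteq> killed C ps k"
proof -
  have "f2_span ({gen a | a. a \<in> basis C (Suc k) \<and> a \<in> fst ` set ps} \<union>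
         {bdry C (Suc k) (gen a) | a. a \<in> basis C (Suc (Suc k)) \<and> a \<in> fst ` set ps}) \<subseteq> {x. bdry C k x \<in> killed C ps k}"
  proof (rule f2_span_minimal)
    show "vec_subspace {x. bdry C k x \<in> killed C ps k}"
      using killed_subspace[of C ps k] vec_additive_zero[OF bdry_additive, of C k] bdry_additive[of C k]
      by (auto simp: vec_subspace_def vec_additive_def)
    have "bdry C k (gen a) \<in> killed C ps k" if "a \<in> basis C (Suc k)" "a \<in> fst ` set ps" for a
      unfolding killed_def using that by (intro f2_span_base) blast
    moreover have "bdry C k (bdry C (Suc k) (gen a)) \<in> killed C ps k" if "a \<in> basis C (Suc (Suc k))" for a
      using assms gen_chains[OF that] killed_subspace[of C ps k] by (auto simp: is_complex_def vec_subspace_def)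
    ultimately show "{gen a | a. a \<in> basis C (Suc k) \<and> a \<in> fst ` set ps} \<union>
         {bdry C (Suc k) (gen a) | a. a \<in> basis C (Suc (Suc k)) \<and> a \<in> fst ` set ps} \<subseteq> {x. bdry C k x \<in> killed C ps k}"
      by auto
  qed
  then show ?thesis unfolding killed_def[of C ps "Suc k"] by auto
qed

lemma pcomplex_of_simps:
  "pobj (pcomplex_of C w r) t k = quot_space (chains C k) (killed C (pairs_at C w r t) k)"
  "pdiff (pcomplex_of C w r) t k = quot_map (killed C (pairs_at C w r t) k) (bdry C k)"
  "ptrans (pcomplex_of C w r) s t k = quot_map (killed C (pairs_at C w r t) k) (\<lambda>x. x)"
  by (auto simp: pcomplex_of_def quot_space_def simplified_space_def quot_map_def fun_eq_iff)

lemma pshift_simps: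
  "pobj (pshift e X) t = pobj X (t + e)" "pdiff (pshift e X) t = pdiff X (t + e)"
  "ptrans (pshift e X) s t = ptrans X (s + e) (t + e)"
  by (simp_all add: pshift_def)

lemma id_additive: "vec_additive (\<lambda>x. x)"
  by (simp add: vec_additive_def)

text \<open>All transition maps are induced by the identity of the chains, so functoriality reduces
  to the inclusion of the killed spaces, that is, to the growth of the set of simplified pairs with
  time.\<close>

lemma parametrized_complex_pcomplex_of:
  assumes C: "is_complex C"
    and mono: "\<And>s t. 0 \<le> s \<Longrightarrow> s \<le> t \<Longrightarrow> set (pairs_at C w r s) \<subseteq> set (pairs_at C w r t)"
  shows "parametrized_complex (pcomplex_of C w r)"
proof -
  let ?W = "\<lambda>t k. killed C (pairs_at C w r t) k"
  have W: "?W s k \<subseteq> ?W t k" if "0 \<le> s" "s \<le> t" for s t :: real and k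
    using mono[OF that] by (rule killed_mono)
  have tr: "quot_map (?W t k) (\<lambda>x. x) (coset_of (?W s k) x) = coset_of (?W t k) x" if "0 \<le> s" "s \<le> t" for s t :: real and k x
    using quot_map_coset[OF killed_subspace killed_subspace id_additive] W[OF that] by (metis image_ident)
  have bd: "quot_map (?W t k) (bdry C k) (coset_of (?W t (Suc k)) x) = coset_of (?W t k) (bdry C k x)" for t k x
    by (rule quot_map_coset[OF killed_subspace killed_subspace bdry_additive bdry_killed[OF C]])
  have dd: "bdry C k (bdry C (Suc k) x) = (\<lambda>_. 0)" if "x \<in> chains C (Suc (Suc k))" for x k
    using C that by (auto simp: is_complex_def)
  have supp: "finite {k. coset_of (?W t k) ` chains C k \<noteq> {?W t k}}" for t
  proof (rule finite_subset)
    show "{k. coset_of (?W t k) ` chains C k \<noteq> {?W t k}} \<subseteq> {k. basis C k \<noteq> {}}"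
    proof (rule Collect_mono, rule impI, erule contrapos_nn)
      fix k assume "basis C k = {}"
      then have "chains C k = {\<lambda>_. 0}" by (auto simp: chains_def)
      then show "coset_of (?W t k) ` chains C k = {?W t k}" by (simp add: coset_of_zero)
    qed
    show "finite {k. basis C k \<noteq> {}}" using C by (simp add: is_complex_def)
  qed
  show ?thesis
    unfolding parametrized_complex_def pcomplex_of_simps
  proof (intro conjI allI impI ballI)
    fix t k assume "(0 :: real) \<le> t"
    show "module F2 (quot_space (chains C k) (?W t k))"
      by (rule module_quot_space[OF chains_subspace killed_subspace])
    show "finite (carrier (quot_space (chains C k) (?W t k)))"
      using C by (simp add: quot_space_simps finite_chains is_complex_def)
    show "f2_linear (quot_space (chains C (Suc k)) (?W t (Suc k))) (quot_space (chains C k) (?W t k))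
            (quot_map (?W t k) (bdry C k))"
      using bdry_chains by (intro f2_linear_quot_map killed_subspace bdry_additive bdry_killed[OF C]) blast
  next
    fix s t :: real and k assume st: "0 \<le> s \<and> s \<le> t"
    show "f2_linear (quot_space (chains C k) (?W s k)) (quot_space (chains C k) (?W t k)) (quot_map (?W t k) (\<lambda>x. x))"
      using W st by (intro f2_linear_quot_map killed_subspace id_additive) auto
  qed (auto simp: quot_space_simps tr bd dd coset_of_zero supp)
qed

section \<open>The order of simplification\<close>

text \<open>This is the set that \<open>tie_order\<close> orders; its size bounds the number of
  simplifications.\<close>

definition basis_pairs :: "'b based_complex \<Rightarrow> ('b \<times> 'b) set" where
  "basis_pairs C = {(a, b). \<exists>k. a \<in> basis C (Suc k) \<and> b \<in> basis C k}"

lemma finite_basis_pairs: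
  assumes "is_complex C"
  shows "finite (basis_pairs C)"
proof (rule finite_subset)
  have "finite (\<Union>k\<in>{k. basis C k \<noteq> {}}. basis C k)"
    using assms by (intro finite_UN_I) (auto simp: is_complex_def)
  then show "finite ((\<Union>k\<in>{k. basis C k \<noteq> {}}. basis C k) \<times> (\<Union>k\<in>{k. basis C k \<noteq> {}}. basis C k))" by blast
  show "basis_pairs C \<subseteq> (\<Union>k\<in>{k. basis C k \<noteq> {}}. basis C k) \<times> (\<Union>k\<in>{k. basis C k \<noteq> {}}. basis C k)"
    by (fastforce simp: basis_pairs_def)
qed

lemma incident_pairs_subset: "incident_pairs C ps \<subseteq> basis_pairs C"
  by (auto simp: incident_pairs_def basis_pairs_def remaining_def)

lemma incident_pairs_fresh: "p \<in> incident_pairs C ps \<Longrightarrow> p \<notin> set ps"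
  by (force simp: incident_pairs_def remaining_def)

text \<open>Distinct weights leave nothing for the tie order to decide between different pairs, so
  the next pair is characterized by minimal weight alone.\<close>

locale distinct_weights =
  fixes C :: "'b based_complex" and w :: "'b \<Rightarrow> 'b \<Rightarrow> real" and r :: "('b \<times> 'b) rel"
  assumes C: "is_complex C" and inj: "inj_on (case_prod w) (basis_pairs C)" and tie: "tie_order C r"
begin

lemma next_pair_eqI:
  assumes p: "p \<in> incident_pairs C ps" and min: "\<And>q. q \<in> incident_pairs C ps \<Longrightarrow> case_prod w p \<le> case_prod w q"
  shows "next_pair C w r ps = p"
  unfolding next_pair_def
proof (rule the_equality)
  \<comment> \<open>The condition in \<open>next_pair\<close> also compares the minimal pair with
    itself, where the weights agree and reflexivity of the order is called for.\<close>
  have refl: "(q, q) \<in> r" if "q \<in> basis_pairs C" for q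
    using tie that unfolding tie_order_def linear_order_on_def partial_order_on_def preorder_on_def refl_on_def basis_pairs_def
    by blast
  show "p \<in> incident_pairs C ps \<and> (\<forall>q\<in>incident_pairs C ps.
         case_prod w p < case_prod w q \<or> case_prod w p = case_prod w q \<and> (p, q) \<in> r)"
  proof (intro conjI ballI p)
    fix q assume q: "q \<in> incident_pairs C ps"
    show "case_prod w p < case_prod w q \<or> case_prod w p = case_prod w q \<and> (p, q) \<in> r"
    proof (cases "p = q")
      case True
      then show ?thesis using refl q incident_pairs_subset by blast
    next
      case False
      then have "case_prod w p \<noteq> case_prod w q"
        using inj p q incident_pairs_subset by (meson inj_on_contraD subsetD)
      then show ?thesis using min[OF q] by linarith
    qed
  qed
  fix p' assume p': "p' \<in> incident_pairs C ps \<and> (\<forall>q\<in>incident_pairs C ps.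
         case_prod w p' < case_prod w q \<or> case_prod w p' = case_prod w q \<and> (p', q) \<in> r)"
  then have "case_prod w p' \<le> case_prod w p" using p by (metis less_imp_le order_refl)
  then have "case_prod w p' = case_prod w p" using min p' by (simp add: antisym)
  then show "p' = p" using inj p p' incident_pairs_subset by (meson inj_onD subsetD)
qed

lemma next_pair:
  assumes "incident_pairs C ps \<noteq> {}"
  shows "next_pair C w r ps \<in> incident_pairs C ps"
    "q \<in> incident_pairs C ps \<Longrightarrow> case_prod w (next_pair C w r ps) \<le> case_prod w q"
proof -
  have fin: "finite (incident_pairs C ps)"
    using finite_basis_pairs[OF C] incident_pairs_subset by (rule finite_subset[rotated])
  define p where "p = arg_min_on (case_prod w) (incident_pairs C ps)"
  have p: "p \<in> incident_pairs C ps" "\<And>q. q \<in> incident_pairs C ps \<Longrightarrow> case_prod w p \<le> case_prod w q"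
    using arg_min_if_finite(1)[OF fin assms, of "case_prod w", folded p_def]
      arg_min_least[OF fin assms, of _ "case_prod w", folded p_def] by blast+
  then have "next_pair C w r ps = p" by (rule next_pair_eqI)
  then show "next_pair C w r ps \<in> incident_pairs C ps"
    "q \<in> incident_pairs C ps \<Longrightarrow> case_prod w (next_pair C w r ps) \<le> case_prod w q" using p by auto
qed

lemma simplified_pairs_distinct:
  "distinct (simplified_pairs C w r i)" "set (simplified_pairs C w r i) \<subseteq> basis_pairs C"
proof (induction i)
  case (Suc i)
  let ?ps = "simplified_pairs C w r i"
  have new: "next_pair C w r ?ps \<in> basis_pairs C - set ?ps" if "incident_pairs C ?ps \<noteq> {}"
    using next_pair(1)[OF that] incident_pairs_fresh incident_pairs_subset by blast
  { case 1 show ?case using Suc new by (cases "incident_pairs C ?ps = {}") (auto simp: Let_def) }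
  { case 2 show ?case using Suc new by (cases "incident_pairs C ?ps = {}") (auto simp: Let_def) }
qed simp_all

lemma simplified_pairs_mono: "i \<le> j \<Longrightarrow> set (simplified_pairs C w r i) \<subseteq> set (simplified_pairs C w r j)"
  by (induction j rule: dec_induct) (auto simp: Let_def)

lemma length_simplified_pairs: "length (simplified_pairs C w r i) \<le> card (basis_pairs C)"
  using simplified_pairs_distinct[of i] card_mono[OF finite_basis_pairs[OF C]]
  by (metis distinct_card)

text \<open>Otherwise every step would add a new pair, and there would be more distinct pairs than
  basis pairs.\<close>

lemma simplification_terminates: "\<exists>i. incident_pairs C (simplified_pairs C w r i) = {}"
proof (rule ccontr)
  assume "\<not> ?thesis"
  then have len: "length (simplified_pairs C w r i) = i" for i by (induction i) (auto simp: Let_def)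
  show False using length_simplified_pairs[of "Suc (card (basis_pairs C))"] unfolding len by simp
qed

text \<open>The least index is attained because the simplification terminates; a
  \<open>LEAST\<close> without a witness would say nothing.\<close>

lemma simp_stage:
  "incident_pairs C (simplified_pairs C w r (simp_stage C w r t)) = {} \<or> t < simp_time C w r (Suc (simp_stage C w r t))"
proof -
  obtain i where "incident_pairs C (simplified_pairs C w r i) = {}" using simplification_terminates by blast
  then show ?thesis unfolding simp_stage_def by (intro LeastI) (rule disjI1)
qed

text \<open>An index that passes the test in \<open>simp_stage\<close> at the later time passes it
  at the earlier one, so the least index can only grow.\<close>

lemma pairs_at_mono:
  assumes "s \<le> t"
  shows "set (pairs_at C w r s) \<subseteq> set (pairs_at C w r t)"
proof -
  have "simp_stage C w r s \<le> simp_stage C w r t"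
    unfolding simp_stage_def[of C w r s] using simp_stage[of t] assms by (intro Least_le) auto
  then show ?thesis unfolding pairs_at_def by (rule simplified_pairs_mono)
qed

lemma parametrized_complex: "parametrized_complex (pcomplex_of C w r)"
  using C pairs_at_mono by (rule parametrized_complex_pcomplex_of)

end

section \<open>Isomorphic based complexes\<close>

text \<open>Injectivity is required across all degrees, because the lists of simplified pairs do not
  record degrees. Coefficients are compared only in consecutive degrees, the others being
  meaningless.\<close>

definition based_iso :: "'b based_complex \<Rightarrow> 'c based_complex \<Rightarrow> ('b \<Rightarrow> 'c) \<Rightarrow> bool" where
  "based_iso C D \<beta> \<longleftrightarrow>
     inj_on \<beta> (\<Union>k. basis C k) \<and> (\<forall>k. \<beta> ` basis C k = basis D k) \<and>
     (\<forall>k. \<forall>a\<in>basis C (Suc k). \<forall>b\<in>basis C k. bcoef D (\<beta> a) (\<beta> b) = bcoef C a b)"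

lemma based_iso_inverse_apply:
  assumes "based_iso C D \<beta>" "a \<in> basis C k"
  shows "inv_into (\<Union>k. basis C k) \<beta> (\<beta> a) = a"
  using assms unfolding based_iso_def by (intro inv_into_f_f) auto

lemma based_iso_inverse:
  assumes "based_iso C D \<beta>"
  shows "based_iso D C (inv_into (\<Union>k. basis C k) \<beta>)"
proof -
  let ?U = "\<Union>k. basis C k" and ?\<gamma> = "inv_into (\<Union>k. basis C k) \<beta>"
  have b: "inj_on \<beta> ?U" "\<And>k. \<beta> ` basis C k = basis D k"
    using assms by (auto simp: based_iso_def)
  note inv = based_iso_inverse_apply[OF assms]
  have "?\<gamma> ` basis D k = basis C k" for k
    unfolding b(2)[symmetric] image_image using inv by (simp cong: image_cong)
  moreover have "bcoef C (?\<gamma> c) (?\<gamma> d) = bcoef D c d" if "c \<in> basis D (Suc k)" "d \<in> basis D k" for c d k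
  proof -
    have "c \<in> \<beta> ` basis C (Suc k)" "d \<in> \<beta> ` basis C k" using that b(2) by auto
    then obtain a b where "a \<in> basis C (Suc k)" "c = \<beta> a" "b \<in> basis C k" "d = \<beta> b" by blast
    then show ?thesis using assms inv by (simp add: based_iso_def)
  qed
  moreover have "inj_on ?\<gamma> (\<Union>k. basis D k)"
    by (rule inj_on_inv_into) (auto simp: b(2)[symmetric])
  ultimately show ?thesis unfolding based_iso_def by blast
qed

lemma induced_map_additive: "vec_additive (induced_map C \<beta> k)"
  by (simp add: vec_additive_def induced_map_def sum.distrib)

lemma induced_map_outside: "d \<notin> \<beta> ` basis C k \<Longrightarrow> induced_map C \<beta> k x d = 0"
  by (auto simp: induced_map_def intro!: sum.neutral)

context
  fixes C :: "'b based_complex" and D :: "'c based_complex" and \<beta> :: "'b \<Rightarrow> 'c"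
  assumes iso: "based_iso C D \<beta>"
begin

lemma based_iso_image: "\<beta> ` basis C k = basis D k"
  using iso by (simp add: based_iso_def)

lemma based_iso_eq_iff: "a \<in> basis C k \<Longrightarrow> b \<in> basis C l \<Longrightarrow> \<beta> a = \<beta> b \<longleftrightarrow> a = b"
  using iso unfolding based_iso_def inj_on_def by blast

lemma induced_map_apply:
  assumes "a \<in> basis C k"
  shows "induced_map C \<beta> k x (\<beta> a) = x a"
proof -
  have "{a'. a' \<in> basis C k \<and> \<beta> a' = \<beta> a} = {a}" using based_iso_eq_iff assms by blast
  then show ?thesis by (simp add: induced_map_def)
qed

lemma induced_map_chains: "induced_map C \<beta> k x \<in> chains D k"
  using induced_map_outside[of _ \<beta> C k x] by (auto simp: chains_def based_iso_image)

lemma induced_map_gen: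
  assumes "a \<in> basis C k"
  shows "induced_map C \<beta> k (gen a) = gen (\<beta> a)"
proof
  fix d show "induced_map C \<beta> k (gen a) d = gen (\<beta> a) d"
  proof (cases "d \<in> \<beta> ` basis C k")
    case True
    then show ?thesis using assms based_iso_eq_iff by (auto simp: induced_map_apply gen_def)
  next
    case False
    then show ?thesis using assms induced_map_outside[OF False] by (auto simp: gen_def)
  qed
qed

text \<open>The sum over the basis is reindexed by \<beta>. This works for every function
  \<open>x\<close>, as both sides read only its values on the basis.\<close>

lemma induced_map_bdry: "induced_map C \<beta> k (bdry C k x) = bdry D k (induced_map C \<beta> (Suc k) x)"
proof
  fix d show "induced_map C \<beta> k (bdry C k x) d = bdry D k (induced_map C \<beta> (Suc k) x) d"
  proof (cases "d \<in> \<beta> ` basis C k")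
    case True
    then obtain b where b: "b \<in> basis C k" "d = \<beta> b" by blast
    have inj: "inj_on \<beta> (basis C (Suc k))" using based_iso_eq_iff by (blast intro: inj_onI)
    have "bdry D k (induced_map C \<beta> (Suc k) x) d = (\<Sum>c\<in>\<beta> ` basis C (Suc k). induced_map C \<beta> (Suc k) x c * bcoef D c d)"
      using b by (auto simp: bdry_def based_iso_image[symmetric])
    also have "\<dots> = (\<Sum>a\<in>basis C (Suc k). x a * bcoef C a b)"
      unfolding sum.reindex[OF inj] b(2)
      by (intro sum.cong refl) (use iso b(1) in \<open>simp add: induced_map_apply based_iso_def\<close>)
    also have "\<dots> = induced_map C \<beta> k (bdry C k x) d" using b by (simp add: induced_map_apply bdry_def)
    finally show ?thesis by simp
  next
    case False
    then show ?thesis using induced_map_outside[OF False] by (simp add: bdry_def based_iso_image)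
  qed
qed

text \<open>Generators go to generators: the induced map sends \<open>gen a\<close> to
  \<open>gen (\<beta> a)\<close> and commutes with the boundary.\<close>

lemma induced_map_killed:
  "induced_map C \<beta> k ` killed C ps k \<subseteq> killed D (map (map_prod \<beta> \<beta>) ps) k"
  unfolding killed_def
proof (rule f2_span_image[OF induced_map_additive])
  have fst: "\<beta> a \<in> fst ` set (map (map_prod \<beta> \<beta>) ps)" if "a \<in> fst ` set ps" for a
    using that by force
  have gen: "induced_map C \<beta> k (gen a) = gen (\<beta> a) \<and> \<beta> a \<in> basis D k" if "a \<in> basis C k" for a
    using that induced_map_gen based_iso_image by blast
  have bd: "induced_map C \<beta> k (bdry C k (gen a)) = bdry D k (gen (\<beta> a)) \<and> \<beta> a \<in> basis D (Suc k)"
    if "a \<in> basis C (Suc k)" for a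
    using that induced_map_gen[OF that] based_iso_image by (auto simp: induced_map_bdry)
  show "induced_map C \<beta> k ` ({gen a |a. a \<in> basis C k \<and> a \<in> fst ` set ps} \<union>
      {bdry C k (gen a) |a. a \<in> basis C (Suc k) \<and> a \<in> fst ` set ps})
    \<subseteq> {gen a |a. a \<in> basis D k \<and> a \<in> fst ` set (map (map_prod \<beta> \<beta>) ps)} \<union>
      {bdry D k (gen a) |a. a \<in> basis D (Suc k) \<and> a \<in> fst ` set (map (map_prod \<beta> \<beta>) ps)}"
    (is "_ ` (?A \<union> ?B) \<subseteq> ?A' \<union> ?B'")
  proof (intro image_subsetI)
    fix x assume "x \<in> ?A \<union> ?B"
    then consider a where "x = gen a" "a \<in> basis C k" "a \<in> fst ` set ps"
      | a where "x = bdry C k (gen a)" "a \<in> basis C (Suc k)" "a \<in> fst ` set ps" by blast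
    then show "induced_map C \<beta> k x \<in> ?A' \<union> ?B'"
    proof cases
      case 1
      then have "induced_map C \<beta> k x \<in> ?A'" using gen fst by (intro CollectI exI[of _ "\<beta> a"]) simp
      then show ?thesis ..
    next
      case 2
      then have "induced_map C \<beta> k x \<in> ?B'" using bd fst by (intro CollectI exI[of _ "\<beta> a"]) simp
      then show ?thesis ..
    qed
  qed
qed

text \<open>The components of the pairs may lie in any degree, so this uses the injectivity of
  \<beta> across degrees; \<open>ps\<close> consists of basis pairs because \<beta> is arbitrary off
  the bases.\<close>

lemma basis_pair_image_iff:
  assumes ps: "set ps \<subseteq> basis_pairs C" and a: "a \<in> basis C k"
  shows "\<beta> a \<in> fst ` set (map (map_prod \<beta> \<beta>) ps) \<longleftrightarrow> a \<in> fst ` set ps"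
    "\<beta> a \<in> snd ` set (map (map_prod \<beta> \<beta>) ps) \<longleftrightarrow> a \<in> snd ` set ps"
proof -
  have 1: "\<beta> a = \<beta> (fst p) \<longleftrightarrow> a = fst p" "\<beta> a = \<beta> (snd p) \<longleftrightarrow> a = snd p" if p: "p \<in> set ps" for p
  proof -
    obtain l where "fst p \<in> basis C (Suc l)" "snd p \<in> basis C l"
      using subsetD[OF ps p] by (cases p) (auto simp: basis_pairs_def)
    then show "\<beta> a = \<beta> (fst p) \<longleftrightarrow> a = fst p" "\<beta> a = \<beta> (snd p) \<longleftrightarrow> a = snd p"
      using based_iso_eq_iff[OF a] by blast+
  qed
  have "\<beta> a \<in> fst ` set (map (map_prod \<beta> \<beta>) ps) \<longleftrightarrow> (\<exists>p\<in>set ps. \<beta> a = \<beta> (fst p))"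
    "\<beta> a \<in> snd ` set (map (map_prod \<beta> \<beta>) ps) \<longleftrightarrow> (\<exists>p\<in>set ps. \<beta> a = \<beta> (snd p))"
    by (auto simp: image_iff)
  then show "\<beta> a \<in> fst ` set (map (map_prod \<beta> \<beta>) ps) \<longleftrightarrow> a \<in> fst ` set ps"
    "\<beta> a \<in> snd ` set (map (map_prod \<beta> \<beta>) ps) \<longleftrightarrow> a \<in> snd ` set ps"
    using 1 by (simp_all add: image_iff)
qed

lemma remaining_image:
  assumes "set ps \<subseteq> basis_pairs C" "a \<in> basis C k"
  shows "\<beta> a \<in> remaining D (map (map_prod \<beta> \<beta>) ps) k \<longleftrightarrow> a \<in> remaining C ps k"
  using basis_pair_image_iff[OF assms] assms(2) based_iso_image unfolding remaining_def by blast

text \<open>An expansion \<open>y\<close> of the differential modulo the killed space is carried by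
  the induced map to an expansion on the other side, with the same coefficient at the image of
  \<open>b\<close>. Equality will follow by applying this inclusion to the inverse
  bijection.\<close>

lemma incident_pairs_image_le:
  assumes ps: "set ps \<subseteq> basis_pairs C"
  shows "map_prod \<beta> \<beta> ` incident_pairs C ps \<subseteq> incident_pairs D (map (map_prod \<beta> \<beta>) ps)"
proof (rule image_subsetI)
  let ?qs = "map (map_prod \<beta> \<beta>) ps"
  fix p assume "p \<in> incident_pairs C ps"
  then obtain a b k y where p: "p = (a, b)" and ab: "a \<in> remaining C ps (Suc k)" "b \<in> remaining C ps k"
    and y: "\<And>d. d \<notin> remaining C ps k \<Longrightarrow> y d = 0"
      "coset_of (killed C ps k) (bdry C k (gen a)) = coset_of (killed C ps k) y" "y b \<noteq> 0"
    unfolding incident_pairs_def by blast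
  have a: "a \<in> basis C (Suc k)" and b: "b \<in> basis C k" using ab by (auto simp: remaining_def)
  have "induced_map C \<beta> k (bdry C k (gen a) \<boxplus> y) \<in> killed D ?qs k"
    using y(2) induced_map_killed unfolding coset_of_eq_iff[OF killed_subspace] by blast
  then have "bdry D k (gen (\<beta> a)) \<boxplus> induced_map C \<beta> k y \<in> killed D ?qs k"
    using induced_map_additive[of C \<beta> k] by (simp add: vec_additive_def induced_map_bdry induced_map_gen[OF a])
  then have "coset_of (killed D ?qs k) (bdry D k (gen (\<beta> a))) = coset_of (killed D ?qs k) (induced_map C \<beta> k y)"
    by (simp add: coset_of_eq_iff[OF killed_subspace])
  moreover have "induced_map C \<beta> k y d = 0" if "d \<notin> remaining D ?qs k" for d
  proof (cases "d \<in> \<beta> ` basis C k")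
    case True
    then obtain b where b: "b \<in> basis C k" "d = \<beta> b" by blast
    then have "b \<notin> remaining C ps k" using that remaining_image[OF ps b(1)] by simp
    then show ?thesis using y(1) induced_map_apply[OF b(1)] b(2) by simp
  qed (rule induced_map_outside)
  moreover have "induced_map C \<beta> k y (\<beta> b) \<noteq> 0" using y(3) induced_map_apply[OF b] by simp
  moreover have "\<beta> a \<in> remaining D ?qs (Suc k)" "\<beta> b \<in> remaining D ?qs k"
    using ab remaining_image[OF ps] a b by blast+
  ultimately show "map_prod \<beta> \<beta> p \<in> incident_pairs D ?qs"
    unfolding p incident_pairs_def by auto
qed

lemma basis_pairs_image: "map_prod \<beta> \<beta> ` basis_pairs C = basis_pairs D"
proof
  show "map_prod \<beta> \<beta> ` basis_pairs C \<subseteq> basis_pairs D"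
    unfolding basis_pairs_def using based_iso_image by fastforce
  show "basis_pairs D \<subseteq> map_prod \<beta> \<beta> ` basis_pairs C"
  proof clarify
    fix c d assume "(c, d) \<in> basis_pairs D"
    then obtain k where "c \<in> \<beta> ` basis C (Suc k)" "d \<in> \<beta> ` basis C k"
      unfolding basis_pairs_def based_iso_image by blast
    then show "(c, d) \<in> map_prod \<beta> \<beta> ` basis_pairs C" by (auto simp: basis_pairs_def image_iff)
  qed
qed

end

lemma incident_pairs_image:
  assumes iso: "based_iso C D \<beta>" and ps: "set ps \<subseteq> basis_pairs C"
  shows "incident_pairs D (map (map_prod \<beta> \<beta>) ps) = map_prod \<beta> \<beta> ` incident_pairs C ps"
proof
  let ?\<gamma> = "inv_into (\<Union>k. basis C k) \<beta>" and ?qs = "map (map_prod \<beta> \<beta>) ps"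
  note iso' = based_iso_inverse[OF iso]
  note inv = based_iso_inverse_apply[OF iso]
  have inv': "map_prod ?\<gamma> ?\<gamma> (map_prod \<beta> \<beta> p) = p" if "p \<in> basis_pairs C" for p
    using that inv by (auto simp: basis_pairs_def)
  have "map (map_prod ?\<gamma> ?\<gamma>) ?qs = map (\<lambda>p. p) ps"
    unfolding map_map by (rule map_cong) (use ps inv' in auto)
  then have qs: "map (map_prod ?\<gamma> ?\<gamma>) ?qs = ps" by simp
  have "set ?qs \<subseteq> basis_pairs D" using ps basis_pairs_image[OF iso] by auto
  \<comment> \<open>The other inclusion is the same lemma for the inverse bijection, which takes the
    image list back to \<open>ps\<close>.\<close>
  from incident_pairs_image_le[OF iso' this]
  have sub: "map_prod ?\<gamma> ?\<gamma> ` incident_pairs D ?qs \<subseteq> incident_pairs C ps" unfolding qs .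
  show "incident_pairs D ?qs \<subseteq> map_prod \<beta> \<beta> ` incident_pairs C ps"
  proof
    fix q assume q: "q \<in> incident_pairs D ?qs"
    have "q \<in> map_prod \<beta> \<beta> ` basis_pairs C"
      unfolding basis_pairs_image[OF iso] using incident_pairs_subset q by (rule subsetD)
    then obtain p where p: "q = map_prod \<beta> \<beta> p" "p \<in> basis_pairs C" by (rule imageE)
    have "p \<in> incident_pairs C ps" using subsetD[OF sub imageI[OF q]] by (simp add: p inv')
    then show "q \<in> map_prod \<beta> \<beta> ` incident_pairs C ps" unfolding p(1) by (rule imageI)
  qed
qed (rule incident_pairs_image_le[OF iso ps])

lemma induced_map_inverse:
  assumes iso: "based_iso C D \<beta>" and x: "x \<in> chains C k"
  shows "induced_map D (inv_into (\<Union>k. basis C k) \<beta>) k (induced_map C \<beta> k x) = x"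
proof
  let ?\<gamma> = "inv_into (\<Union>k. basis C k) \<beta>"
  note iso' = based_iso_inverse[OF iso]
  fix a show "induced_map D ?\<gamma> k (induced_map C \<beta> k x) a = x a"
  proof (cases "a \<in> basis C k")
    case True
    then have "\<beta> a \<in> basis D k" "?\<gamma> (\<beta> a) = a"
      using based_iso_image[OF iso] based_iso_inverse_apply[OF iso] by auto
    then show ?thesis
      using induced_map_apply[OF iso', of "\<beta> a" k] induced_map_apply[OF iso True] by simp
  next
    case False
    then show ?thesis
      using induced_map_outside[of a ?\<gamma> D k] x by (simp add: based_iso_image[OF iso'] chains_def)
  qed
qed

text \<open>Injectivity in each degree becomes injectivity on all degrees together, because elements
  of different degrees have images in disjoint bases of \<open>D\<close>.\<close>

lemma based_isoI:
  assumes "\<And>k. bij_betw \<beta> (basis C k) (basis D k)"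
    and disj: "\<And>k l. k \<noteq> l \<Longrightarrow> basis D k \<inter> basis D l = {}"
    and "\<And>k a b. a \<in> basis C (Suc k) \<Longrightarrow> b \<in> basis C k \<Longrightarrow> bcoef D (\<beta> a) (\<beta> b) = bcoef C a b"
  shows "based_iso C D \<beta>"
proof -
  have inj: "inj_on \<beta> (basis C k)" and im: "\<beta> ` basis C k = basis D k" for k
    using assms(1)[of k] by (auto simp: bij_betw_def)
  have "inj_on \<beta> (\<Union>k. basis C k)"
  proof (rule inj_onI, clarify)
    fix a b k l assume ab: "a \<in> basis C k" "b \<in> basis C l" "\<beta> a = \<beta> b"
    then have "\<beta> a \<in> basis D k \<inter> basis D l" using im[of k] im[of l] by (metis IntI imageI)
    then have "k = l" using disj by blast
    then show "a = b" using inj_onD[OF inj[of k] ab(3)] ab by simp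
  qed
  then show ?thesis using im assms(3) by (simp add: based_iso_def)
qed

lemma based_iso_trans:
  assumes "based_iso C D \<beta>" "based_iso D E \<gamma>"
  shows "based_iso C E (\<gamma> \<circ> \<beta>)"
proof -
  have im: "\<beta> ` basis C k = basis D k" "\<gamma> ` basis D k = basis E k" for k
    using assms by (auto simp: based_iso_def)
  then have mem: "\<beta> a \<in> basis D k" if "a \<in> basis C k" for a k using that by blast
  have "inj_on (\<gamma> \<circ> \<beta>) (\<Union>k. basis C k)"
    using assms unfolding based_iso_def by (intro comp_inj_on) (simp_all add: image_UN)
  moreover have "(\<gamma> \<circ> \<beta>) ` basis C k = basis E k" for k
    by (simp only: image_comp[symmetric] im)
  moreover have "bcoef E ((\<gamma> \<circ> \<beta>) a) ((\<gamma> \<circ> \<beta>) b) = bcoef C a b"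
    if "a \<in> basis C (Suc k)" "b \<in> basis C k" for a b k
    using assms mem[OF that(1)] mem[OF that(2)] that unfolding based_iso_def o_apply by metis
  ultimately show ?thesis unfolding based_iso_def by blast
qed

section \<open>Interleavings from close weights\<close>

text \<open>By the assumption \<open>stage\<close>, whatever is killed in \<open>C\<close> at time
  \<open>t\<close> has its image killed in \<open>D\<close> at time \<open>t + e\<close>, so the
  chain map induced by \<beta> descends to the quotients. The second conclusion evaluates it on
  cosets, for use in the composites.\<close>

lemma natural_transformation_induced:
  assumes C: "is_complex C" and D: "is_complex D" and iso: "based_iso C D \<beta>" and e: "e \<ge> 0"
    and stage: "\<And>t. t \<ge> 0 \<Longrightarrow> map_prod \<beta> \<beta> ` set (pairs_at C w r t) \<subseteq> set (pairs_at D w' r' (t + e))"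
    and mono: "mono (\<lambda>t. set (pairs_at C w r t))" "mono (\<lambda>t. set (pairs_at D w' r' t))"
  defines "\<phi> \<equiv> \<lambda>t k. quot_map (killed D (pairs_at D w' r' (t + e)) k) (induced_map C \<beta> k)"
  shows "natural_transformation (pcomplex_of C w r) (pshift e (pcomplex_of D w' r')) \<phi>"
    "\<And>t k x. t \<ge> 0 \<Longrightarrow> \<phi> t k (coset_of (killed C (pairs_at C w r t) k) x)
       = coset_of (killed D (pairs_at D w' r' (t + e)) k) (induced_map C \<beta> k x)"
proof -
  let ?W = "\<lambda>t k. killed C (pairs_at C w r t) k" and ?W' = "\<lambda>t k. killed D (pairs_at D w' r' t) k"
  have sub: "induced_map C \<beta> k ` ?W t k \<subseteq> ?W' (t + e) k" if "t \<ge> 0" for t k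
  proof -
    have "induced_map C \<beta> k ` ?W t k \<subseteq> killed D (map (map_prod \<beta> \<beta>) (pairs_at C w r t)) k"
      by (rule induced_map_killed[OF iso])
    also have "\<dots> \<subseteq> ?W' (t + e) k" using stage[OF that] by (intro killed_mono) simp
    finally show ?thesis .
  qed
  show \<phi>: "\<phi> t k (coset_of (?W t k) x) = coset_of (?W' (t + e) k) (induced_map C \<beta> k x)" if "t \<ge> 0" for t k x
    unfolding \<phi>_def by (rule quot_map_coset[OF killed_subspace killed_subspace induced_map_additive sub[OF that]])
  have tr: "quot_map (?W t k) (\<lambda>x. x) (coset_of (?W s k) x) = coset_of (?W t k) x" if "0 \<le> s" "s \<le> t" for s t :: real and k x
    using quot_map_coset[OF killed_subspace killed_subspace id_additive] killed_mono[OF monoD[OF mono(1) that(2)]] by (metis image_ident)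
  have tr': "quot_map (?W' t k) (\<lambda>x. x) (coset_of (?W' s k) x) = coset_of (?W' t k) x" if "0 \<le> s" "s \<le> t" for s t :: real and k x
    using quot_map_coset[OF killed_subspace killed_subspace id_additive] killed_mono[OF monoD[OF mono(2) that(2)]] by (metis image_ident)
  have bd: "quot_map (?W t k) (bdry C k) (coset_of (?W t (Suc k)) x) = coset_of (?W t k) (bdry C k x)" for t k x
    by (rule quot_map_coset[OF killed_subspace killed_subspace bdry_additive bdry_killed[OF C]])
  have bd': "quot_map (?W' t k) (bdry D k) (coset_of (?W' t (Suc k)) x) = coset_of (?W' t k) (bdry D k x)" for t k x
    by (rule quot_map_coset[OF killed_subspace killed_subspace bdry_additive bdry_killed[OF D]])
  show "natural_transformation (pcomplex_of C w r) (pshift e (pcomplex_of D w' r')) \<phi>"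
    unfolding natural_transformation_def pshift_simps pcomplex_of_simps
  proof (intro conjI allI impI ballI)
    fix t k assume t: "(0 :: real) \<le> t"
    show "f2_linear (quot_space (chains C k) (?W t k)) (quot_space (chains D k) (?W' (t + e) k)) (\<phi> t k)"
      unfolding \<phi>_def using induced_map_chains[OF iso] sub[OF t]
      by (intro f2_linear_quot_map killed_subspace induced_map_additive) auto
  qed (use e in \<open>auto simp: quot_space_simps tr tr' bd bd' \<phi> induced_map_bdry[OF iso]\<close>)
qed

text \<open>The order of the weights makes both complexes simplify corresponding pairs in the same
  order; the bound on the weights, summed over at most \<open>card (basis_pairs C)\<close> pairs,
  makes corresponding times differ by at most \<open>e\<close>.\<close>

lemma interleaving_distance_le:
  fixes C :: "'b based_complex" and D :: "'c based_complex"
  assumes C: "distinct_weights C w r" and D: "is_complex D" "tie_order D r'" and iso: "based_iso C D \<beta>"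
    and order: "\<And>p q. p \<in> basis_pairs C \<Longrightarrow> q \<in> basis_pairs C \<Longrightarrow> case_prod w p < case_prod w q \<Longrightarrow>
      case_prod w' (map_prod \<beta> \<beta> p) < case_prod w' (map_prod \<beta> \<beta> q)"
    and close: "\<And>p. p \<in> basis_pairs C \<Longrightarrow> \<bar>case_prod w' (map_prod \<beta> \<beta> p) - case_prod w p\<bar> \<le> \<delta>"
    and e: "e > 0" "real (card (basis_pairs C)) * \<delta> \<le> e" and \<delta>: "\<delta> \<ge> 0"
  shows "interleaving_distance (pcomplex_of C w r) (pcomplex_of D w' r') \<le> ereal e"
proof -
  interpret C: distinct_weights C w r by (rule C)
  let ?\<beta> = "map_prod \<beta> \<beta>" and ?\<gamma> = "inv_into (\<Union>k. basis C k) \<beta>"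
  note iso' = based_iso_inverse[OF iso]
  \<comment> \<open>Distinct weights of \<open>C\<close> are strictly ordered, hence so are their
    counterparts: \<open>D\<close> has distinct weights too.\<close>
  have "inj_on (case_prod w') (basis_pairs D)"
  proof (rule inj_onI)
    fix p q assume "p \<in> basis_pairs D" "q \<in> basis_pairs D" and eq: "case_prod w' p = case_prod w' q"
    then have "p \<in> ?\<beta> ` basis_pairs C" "q \<in> ?\<beta> ` basis_pairs C"
      using basis_pairs_image[OF iso] by simp_all
    then obtain p' q' where pq: "p' \<in> basis_pairs C" "p = ?\<beta> p'" "q' \<in> basis_pairs C" "q = ?\<beta> q'"
      by (elim imageE) simp
    then have "case_prod w p' = case_prod w q'" using order eq by (metis less_irrefl linorder_neqE)
    then show "p = q" using C.inj pq by (metis inj_onD)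
  qed
  then interpret D: distinct_weights D w' r' using D by unfold_locales
  let ?P = "simplified_pairs C w r" and ?Q = "simplified_pairs D w' r'"
  \<comment> \<open>By induction the incident pairs correspond, and a bijection that preserves the
    order of the weights maps the minimum to the minimum.\<close>
  have Q: "?Q i = map ?\<beta> (?P i)" for i
  proof (induction i)
    case (Suc i)
    note inc = incident_pairs_image[OF iso C.simplified_pairs_distinct(2)[of i]]
    show ?case
    proof (cases "incident_pairs C (?P i) = {}")
      case True
      then show ?thesis using Suc inc by (simp add: Let_def)
    next
      case False
      let ?p = "next_pair C w r (?P i)"
      have p: "?p \<in> incident_pairs C (?P i)" by (rule C.next_pair(1)[OF False])
      have "next_pair D w' r' (map ?\<beta> (?P i)) = ?\<beta> ?p"
      proof (rule D.next_pair_eqI)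
        show "?\<beta> ?p \<in> incident_pairs D (map ?\<beta> (?P i))" unfolding inc using p by (rule imageI)
        fix q assume "q \<in> incident_pairs D (map ?\<beta> (?P i))"
        then obtain q' where q': "q = ?\<beta> q'" "q' \<in> incident_pairs C (?P i)"
          unfolding inc by (rule imageE)
        have mem: "?p \<in> basis_pairs C" "q' \<in> basis_pairs C" by (rule subsetD[OF incident_pairs_subset p], rule subsetD[OF incident_pairs_subset q'(2)])
        have "case_prod w ?p \<le> case_prod w q'" by (rule C.next_pair(2)[OF False q'(2)])
        then have "case_prod w ?p < case_prod w q' \<or> ?p = q'"
          using C.inj mem by (metis inj_onD less_le)
        then show "case_prod w' (?\<beta> ?p) \<le> case_prod w' q"
          using order[OF mem] q'(1) by (metis less_imp_le order_refl)
      qed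
      then show ?thesis using False Suc inc by (simp add: Let_def)
    qed
  qed simp
  have time: "\<bar>simp_time D w' r' i - simp_time C w r i\<bar> \<le> e" for i
  proof -
    have "\<bar>sum_list (map (case_prod w') (map ?\<beta> ps)) - sum_list (map (case_prod w) ps)\<bar> \<le> real (length ps) * \<delta>"
      if "set ps \<subseteq> basis_pairs C" for ps using that
    proof (induction ps)
      case (Cons p ps)
      then have "\<bar>case_prod w' (?\<beta> p) - case_prod w p\<bar> \<le> \<delta>" using close by simp
      then show ?case using Cons by (simp add: distrib_right)
    qed simp
    from this[OF C.simplified_pairs_distinct(2)[of i]]
    have "\<bar>simp_time D w' r' i - simp_time C w r i\<bar> \<le> real (length (?P i)) * \<delta>"
      by (simp add: simp_time_def Q)
    also have "\<dots> \<le> real (card (basis_pairs C)) * \<delta>"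
      using C.length_simplified_pairs[of i] \<delta> by (intro mult_right_mono) auto
    finally show ?thesis using e(2) by simp
  qed
  have inc: "incident_pairs D (?Q i) = {} \<longleftrightarrow> incident_pairs C (?P i) = {}" for i
    using incident_pairs_image[OF iso C.simplified_pairs_distinct(2)[of i]] by (simp add: Q)
  \<comment> \<open>The stage of \<open>D\<close> at \<open>t + e\<close> passes the test for
    \<open>C\<close> at \<open>t\<close>: incident pairs correspond, and the next time of
    \<open>C\<close> is at most \<open>e\<close> earlier than that of \<open>D\<close>. So the least
    index for \<open>C\<close> is no larger.\<close>
  have stageCD: "simp_stage C w r t \<le> simp_stage D w' r' (t + e)" for t
    unfolding simp_stage_def[of C] using D.simp_stage[of "t + e"] time[of "Suc (simp_stage D w' r' (t + e))"]
    by (intro Least_le) (auto simp: inc)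
  have stageDC: "simp_stage D w' r' t \<le> simp_stage C w r (t + e)" for t
    unfolding simp_stage_def[of D] using C.simp_stage[of "t + e"] time[of "Suc (simp_stage C w r (t + e))"]
    by (intro Least_le) (auto simp: inc)
  have pairsCD: "?\<beta> ` set (pairs_at C w r t) \<subseteq> set (pairs_at D w' r' (t + e))" for t
    using D.simplified_pairs_mono[OF stageCD[of t]] by (simp add: pairs_at_def Q)
  have inv: "map_prod ?\<gamma> ?\<gamma> (?\<beta> p) = p" if "p \<in> basis_pairs C" for p
    using that based_iso_inverse_apply[OF iso] by (auto simp: basis_pairs_def)
  have pairsDC: "map_prod ?\<gamma> ?\<gamma> ` set (pairs_at D w' r' t) \<subseteq> set (pairs_at C w r (t + e))" for t
  proof -
    have "map_prod ?\<gamma> ?\<gamma> ` set (pairs_at D w' r' t) = (\<lambda>p. p) ` set (?P (simp_stage D w' r' t))"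
      unfolding pairs_at_def Q set_map image_image
      by (rule image_cong[OF refl]) (rule inv[OF subsetD[OF C.simplified_pairs_distinct(2)]])
    then show ?thesis using C.simplified_pairs_mono[OF stageDC[of t]] by (simp add: pairs_at_def)
  qed
  have mono: "mono (\<lambda>t. set (pairs_at C w r t))" "mono (\<lambda>t. set (pairs_at D w' r' t))"
    by (intro monoI C.pairs_at_mono D.pairs_at_mono; assumption)+
  define \<phi> where "\<phi> = (\<lambda>t k. quot_map (killed D (pairs_at D w' r' (t + e)) k) (induced_map C \<beta> k))"
  define \<psi> where "\<psi> = (\<lambda>t k. quot_map (killed C (pairs_at C w r (t + e)) k) (induced_map D ?\<gamma> k))"
  note nat\<phi> = natural_transformation_induced[OF C.C D(1) iso less_imp_le[OF e(1)] pairsCD mono]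
  note nat\<psi> = natural_transformation_induced[OF D(1) C.C iso' less_imp_le[OF e(1)] pairsDC mono(2,1)]
  have inv\<beta>: "induced_map D ?\<gamma> k (induced_map C \<beta> k x) = x" if "x \<in> chains C k" for x k
    by (rule induced_map_inverse[OF iso that])
  have inv\<gamma>: "induced_map C \<beta> k (induced_map D ?\<gamma> k y) = y" if y: "y \<in> chains D k" for y k
  proof
    fix d show "induced_map C \<beta> k (induced_map D ?\<gamma> k y) d = y d"
    proof (cases "d \<in> \<beta> ` basis C k")
      case True
      then obtain a where a: "a \<in> basis C k" "d = \<beta> a" by blast
      then have "?\<gamma> d = a" "d \<in> basis D k"
        using based_iso_image[OF iso] based_iso_inverse_apply[OF iso] by auto
      then show ?thesis using induced_map_apply[OF iso a(1)] induced_map_apply[OF iso', of d k] a by simp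
    next
      case False
      then show ?thesis using induced_map_outside[OF False] y based_iso_image[OF iso] by (simp add: chains_def)
    qed
  qed
  have trC: "quot_map (killed C (pairs_at C w r t) k) (\<lambda>x. x) (coset_of (killed C (pairs_at C w r s) k) x)
      = coset_of (killed C (pairs_at C w r t) k) x" if "s \<le> t" for s t k x
    using quot_map_coset[OF killed_subspace killed_subspace id_additive] killed_mono[OF C.pairs_at_mono[OF that]]
    by (metis image_ident)
  have trD: "quot_map (killed D (pairs_at D w' r' t) k) (\<lambda>x. x) (coset_of (killed D (pairs_at D w' r' s) k) x)
      = coset_of (killed D (pairs_at D w' r' t) k) x" if "s \<le> t" for s t k x
    using quot_map_coset[OF killed_subspace killed_subspace id_additive] killed_mono[OF D.pairs_at_mono[OF that]]
    by (metis image_ident)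
  \<comment> \<open>The maps induced by \<beta> and by its inverse cancel on chains, so each
    composite sends the coset of a chain at \<open>t\<close> to its coset at
    \<open>t + 2 * e\<close>, as the transition map does.\<close>
  have "interleaving e (pcomplex_of C w r) (pcomplex_of D w' r') \<phi> \<psi>"
    unfolding interleaving_def pcomplex_of_simps
  proof (intro conjI allI impI ballI)
    show "natural_transformation (pcomplex_of C w r) (pshift e (pcomplex_of D w' r')) \<phi>"
      unfolding \<phi>_def by (rule nat\<phi>(1))
    show "natural_transformation (pcomplex_of D w' r') (pshift e (pcomplex_of C w r)) \<psi>"
      unfolding \<psi>_def by (rule nat\<psi>(1))
    fix t k assume t: "(0 :: real) \<le> t"
    have te: "0 \<le> t + e" "t + e + e = t + 2 * e" "t \<le> t + 2 * e" using t e(1) by auto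
    have f1: "\<phi> (t) k (coset_of (killed C (pairs_at C w r (t)) k) x) = coset_of (killed D (pairs_at D w' r' (t + e)) k) (induced_map C \<beta> k x)" for x
      using nat\<phi>(2)[OF t] unfolding \<phi>_def .
    have g1: "\<psi> (t) k (coset_of (killed D (pairs_at D w' r' (t)) k) x) = coset_of (killed C (pairs_at C w r (t + e)) k) (induced_map D ?\<gamma> k x)" for x
      using nat\<psi>(2)[OF t] unfolding \<psi>_def .
    have f2: "\<phi> (t + e) k (coset_of (killed C (pairs_at C w r (t + e)) k) x) = coset_of (killed D (pairs_at D w' r' (t + 2 * e)) k) (induced_map C \<beta> k x)" for x
      using nat\<phi>(2)[OF te(1)] unfolding \<phi>_def te(2) .
    have g2: "\<psi> (t + e) k (coset_of (killed D (pairs_at D w' r' (t + e)) k) x) = coset_of (killed C (pairs_at C w r (t + 2 * e)) k) (induced_map D ?\<gamma> k x)" for x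
      using nat\<psi>(2)[OF te(1)] unfolding \<psi>_def te(2) .
    { fix A assume "A \<in> carrier (quot_space (chains C k) (killed C (pairs_at C w r t) k))"
      then show "\<psi> (t + e) k (\<phi> t k A) = quot_map (killed C (pairs_at C w r (t + 2 * e)) k) (\<lambda>x. x) A"
        using te(3) by (auto simp: quot_space_simps inv\<beta> trC f1 g2) }
    { fix A assume "A \<in> carrier (quot_space (chains D k) (killed D (pairs_at D w' r' t) k))"
      then show "\<phi> (t + e) k (\<psi> t k A) = quot_map (killed D (pairs_at D w' r' (t + 2 * e)) k) (\<lambda>x. x) A"
        using te(3) by (auto simp: quot_space_simps inv\<gamma> trD g1 f2) }
  qed
  then show ?thesis
    unfolding interleaving_distance_def
    using e(1) C.parametrized_complex D.parametrized_complex by (intro Inf_lower) blast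
qed

section \<open>Continuity of the distance\<close>

text \<open>The speed of a path is not known to be measurable, as it depends on a choice of charts; hence the
  inequalities for arbitrary integrands.\<close>

lemma nn_integral_le_split:
  assumes A: "A \<in> sets M"
  shows "(\<integral>\<^sup>+x. f x \<partial>M) \<le> (\<integral>\<^sup>+x. f x * indicator A x \<partial>M) + (\<integral>\<^sup>+x. f x * indicator (space M - A) x \<partial>M)"
  unfolding nn_integral_def[of M f]
\<comment> \<open>The integral is a supremum over simple functions below \<open>f\<close>. These are
  measurable, so their integrals split exactly, and \<open>f\<close> is put back by
  monotonicity.\<close>
proof (rule SUP_least, clarify)
  fix g assume g: "simple_function M g" and gf: "g \<le> f"
  have gm [measurable]: "g \<in> borel_measurable M" using g by (rule borel_measurable_simple_function)
  have "integral\<^sup>S M g = (\<integral>\<^sup>+x. g x \<partial>M)" using g by (simp add: nn_integral_eq_simple_integral)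
  also have "\<dots> = (\<integral>\<^sup>+x. g x * indicator A x + g x * indicator (space M - A) x \<partial>M)"
    by (rule nn_integral_cong) (auto split: split_indicator)
  also have "\<dots> = (\<integral>\<^sup>+x. g x * indicator A x \<partial>M) + (\<integral>\<^sup>+x. g x * indicator (space M - A) x \<partial>M)"
    using A by (intro nn_integral_add) auto
  also have "\<dots> \<le> (\<integral>\<^sup>+x. f x * indicator A x \<partial>M) + (\<integral>\<^sup>+x. f x * indicator (space M - A) x \<partial>M)"
    using gf by (intro add_mono nn_integral_mono mult_right_mono) (auto simp: le_fun_def)
  finally show "integral\<^sup>S M g \<le> \<dots>" .
qed

text \<open>Every simple function below the left integrand is pulled back along the substitution to
  a measurable function \<open>h\<close> below \<open>f\<close>, and the change of variables is
  applied to \<open>h\<close>.\<close>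

lemma nn_integral_affine_le:
  fixes f :: "real \<Rightarrow> ennreal"
  assumes c: "c > 0"
  shows "(\<integral>\<^sup>+x. ennreal c * f (c * x + d) \<partial>lborel) \<le> (\<integral>\<^sup>+x. f x \<partial>lborel)"
  unfolding nn_integral_def[of _ "\<lambda>x. ennreal c * f (c * x + d)"]
proof (rule SUP_least, clarify)
  fix g assume g: "simple_function lborel g" and gf: "g \<le> (\<lambda>x. ennreal c * f (c * x + d))"
  have "g \<in> borel_measurable lborel" using g by (rule borel_measurable_simple_function)
  then have gm [measurable]: "g \<in> borel_measurable borel" by simp
  define h where "h u = ennreal (1 / c) * g ((u - d) / c)" for u
  have hm: "h \<in> borel_measurable borel" unfolding h_def by measurable
  have inv: "ennreal c * (ennreal (1 / c) * z) = z" "ennreal (1 / c) * (ennreal c * z) = z" for z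
    using c by (simp_all add: mult.assoc[symmetric] ennreal_mult[symmetric])
  have "integral\<^sup>S lborel g = (\<integral>\<^sup>+x. g x \<partial>lborel)" using g by (simp add: nn_integral_eq_simple_integral)
  also have "\<dots> = (\<integral>\<^sup>+x. ennreal c * h (d + c * x) \<partial>lborel)"
    using c by (intro nn_integral_cong) (simp add: h_def inv)
  also have "\<dots> = ennreal c * (\<integral>\<^sup>+x. h (d + c * x) \<partial>lborel)"
    using hm by (intro nn_integral_cmult) simp
  also have "\<dots> = (\<integral>\<^sup>+x. h x \<partial>lborel)"
    using nn_integral_real_affine[OF hm, of c d] c by simp
  also have "\<dots> \<le> (\<integral>\<^sup>+x. f x \<partial>lborel)"
  proof (rule nn_integral_mono)
    fix u
    have "g ((u - d) / c) \<le> ennreal c * f u" using gf[unfolded le_fun_def, rule_format, of "(u - d) / c"] c by simp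
    then have "h u \<le> ennreal (1 / c) * (ennreal c * f u)" unfolding h_def by (intro mult_left_mono) auto
    then show "h u \<le> f u" by (simp add: inv)
  qed
  finally show "integral\<^sup>S lborel g \<le> \<dots>" .
qed

section \<open>Lengths of concatenated paths and the triangle inequality\<close>

definition inf_length :: "'m manifold \<Rightarrow> 'm \<Rightarrow> 'm \<Rightarrow> ennreal" where
  "inf_length M p q = (INF \<gamma>\<in>{\<gamma>. piecewise_C1_path M \<gamma> \<and> \<gamma> 0 = p \<and> \<gamma> 1 = q}. path_length M \<gamma>)"

definition concat_path :: "(real \<Rightarrow> 'm) \<Rightarrow> (real \<Rightarrow> 'm) \<Rightarrow> real \<Rightarrow> 'm" where
  "concat_path \<gamma> \<delta> t = (if t \<le> 1/2 then \<gamma> (2 * t) else \<delta> (2 * t - 1))"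

lemma pathin_concat_path:
  assumes "pathin X \<gamma>" "pathin X \<delta>" "\<gamma> 1 = \<delta> 0"
  shows "pathin X (concat_path \<gamma> \<delta>)"
proof -
  let ?T = "subtopology euclideanreal {0..1}"
  have "continuous_map ?T X (\<lambda>t. if t \<le> 1/2 then (\<gamma> \<circ> (\<lambda>t. 2 * t)) t else (\<delta> \<circ> (\<lambda>t. 2 * t - 1)) t)"
  proof (rule continuous_map_cases_le)
    show "continuous_map (subtopology ?T {x \<in> topspace ?T. x \<le> 1 / 2}) X (\<gamma> \<circ> (\<lambda>t. 2 * t))"
      using assms(1) unfolding pathin_def
      by (intro continuous_map_compose[where X' = ?T])
         (auto simp: continuous_map_in_subtopology subtopology_subtopology intro!: continuous_intros)
    show "continuous_map (subtopology ?T {x \<in> topspace ?T. 1 / 2 \<le> x}) X (\<delta> \<circ> (\<lambda>t. 2 * t - 1))"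
      using assms(2) unfolding pathin_def
      by (intro continuous_map_compose[where X' = ?T])
         (auto simp: continuous_map_in_subtopology subtopology_subtopology intro!: continuous_intros)
      show "(\<gamma> \<circ> (\<lambda>t. 2 * t)) t = (\<delta> \<circ> (\<lambda>t. 2 * t - 1)) t" if "t = 1/2" for t
      unfolding that using assms(3) by simp
  qed (auto simp: continuous_map_from_subtopology)
  then show ?thesis unfolding pathin_def concat_path_def[abs_def] comp_def .
qed

lemma C1_differentiable_affine:
  fixes f :: "real \<Rightarrow> real"
  assumes "f C1_differentiable_on T" "(\<lambda>t. a * t + b) ` S \<subseteq> T"
  shows "(\<lambda>t. f (a * t + b)) C1_differentiable_on S"
proof -
  obtain D where D: "\<And>x. x \<in> T \<Longrightarrow> (f has_real_derivative D x) (at x)" "continuous_on T D"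
    using assms(1) unfolding C1_differentiable_on_def has_real_derivative_iff_has_vector_derivative by blast
  have "((\<lambda>t. f (a * t + b)) has_real_derivative D (a * x + b) * a) (at x)" if "x \<in> S" for x
  proof (rule DERIV_chain'[where g = f])
    show "((\<lambda>t. a * t + b) has_real_derivative a) (at x)" by (auto intro!: derivative_eq_intros)
    show "(f has_real_derivative D (a * x + b)) (at (a * x + b))" using D(1) assms(2) that by blast
  qed
  moreover have "continuous_on S (\<lambda>x. D (a * x + b) * a)"
    by (intro continuous_intros continuous_on_compose2[OF D(2)] assms(2))
  ultimately show ?thesis
    unfolding C1_differentiable_on_def has_real_derivative_iff_has_vector_derivative[symmetric]
    by (intro exI[of _ "\<lambda>x. D (a * x + b) * a"]) simp
qed

text \<open>The condition asks for continuity of the derivative along \<open>A\<close>, which can be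
  glued from pieces that are open relative to \<open>A\<close>.\<close>

lemma C1_differentiable_on_open_Un:
  fixes f :: "real \<Rightarrow> real"
  assumes "f C1_differentiable_on A \<inter> U" "f C1_differentiable_on A \<inter> V" "open U" "open V" "A \<subseteq> U \<union> V"
  shows "f C1_differentiable_on A"
proof -
  have "continuous_on (A \<inter> U \<union> A \<inter> V) (\<lambda>x. vector_derivative f (at x))"
    using assms by (intro continuous_on_Un_local_open) (auto simp: C1_differentiable_on_eq openin_open)
  moreover have "A \<inter> U \<union> A \<inter> V = A" using assms by auto
  ultimately show ?thesis using assms by (auto simp: C1_differentiable_on_eq)
qed

text \<open>The derivatives are two-sided, so the functions have to agree on an open set around
  \<open>A\<close> and not merely on \<open>A\<close>.\<close>

lemma C1_differentiable_on_cong_open: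
  fixes f :: "real \<Rightarrow> real"
  assumes "f C1_differentiable_on A" "open U" "A \<subseteq> U" "\<And>x. x \<in> U \<Longrightarrow> f x = g x"
  shows "g C1_differentiable_on A"
  using assms(1) unfolding C1_differentiable_on_def
  by (meson assms has_vector_derivative_transform_within_open subsetD)

lemma piecewise_C1_path_concat:
  assumes \<gamma>: "piecewise_C1_path M \<gamma>" and \<delta>: "piecewise_C1_path M \<delta>" and eq: "\<gamma> 1 = \<delta> 0"
  shows "piecewise_C1_path M (concat_path \<gamma> \<delta>)"
proof -
  obtain S where S: "finite S" "\<And>c i. c \<in> atlas M \<Longrightarrow> i < mdim M \<Longrightarrow>
      (\<lambda>t. snd c (\<gamma> t) i) C1_differentiable_on {t \<in> {0..1} - S. \<gamma> t \<in> fst c}"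
    using \<gamma> unfolding piecewise_C1_path_def by blast
  obtain T where T: "finite T" "\<And>c i. c \<in> atlas M \<Longrightarrow> i < mdim M \<Longrightarrow>
      (\<lambda>t. snd c (\<delta> t) i) C1_differentiable_on {t \<in> {0..1} - T. \<delta> t \<in> fst c}"
    using \<delta> unfolding piecewise_C1_path_def by blast
  \<comment> \<open>The exceptional times are the midpoint, where the two paths may meet at an
    angle, and the exceptional times of both paths, rescaled.\<close>
  define R where "R = {1/2} \<union> (\<lambda>s. s / 2) ` S \<union> (\<lambda>s. (s + 1) / 2) ` T"
  have "(\<lambda>t. snd c (concat_path \<gamma> \<delta> t) i) C1_differentiable_on {t \<in> {0..1} - R. concat_path \<gamma> \<delta> t \<in> fst c}"
    if c: "c \<in> atlas M" "i < mdim M" for c i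
  proof (rule C1_differentiable_on_open_Un[where U = "{..<1/2}" and V = "{1/2<..}"])
    let ?A = "{t \<in> {0..1} - R. concat_path \<gamma> \<delta> t \<in> fst c}"
    have "(\<lambda>t. snd c (\<gamma> (2 * t + 0)) i) C1_differentiable_on ?A \<inter> {..<1/2}"
    proof (rule C1_differentiable_affine[OF S(2)[OF c]], rule image_subsetI)
      fix t assume "t \<in> ?A \<inter> {..<1/2}"
      then have t: "t \<in> {0..1}" "t \<notin> R" "t \<in> {..<1/2}" and m: "concat_path \<gamma> \<delta> t \<in> fst c" by auto
      have "2 * t + 0 \<notin> S"
      proof
        assume "2 * t + 0 \<in> S"
        then have "(2 * t + 0) / 2 \<in> R" unfolding R_def by blast
        then show False using t by simp
      qed
      then show "2 * t + 0 \<in> {t \<in> {0..1} - S. \<gamma> t \<in> fst c}"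
        using t m by (auto simp: concat_path_def)
    qed
    then show "(\<lambda>t. snd c (concat_path \<gamma> \<delta> t) i) C1_differentiable_on ?A \<inter> {..<1/2}"
      by (rule C1_differentiable_on_cong_open[where U = "{..<1/2}"]) (auto simp: concat_path_def)
    have "(\<lambda>t. snd c (\<delta> (2 * t + (-1))) i) C1_differentiable_on ?A \<inter> {1/2<..}"
    proof (rule C1_differentiable_affine[OF T(2)[OF c]], rule image_subsetI)
      fix t assume "t \<in> ?A \<inter> {1/2<..}"
      then have t: "t \<in> {0..1}" "t \<notin> R" "t \<in> {1/2<..}" and m: "concat_path \<gamma> \<delta> t \<in> fst c" by auto
      have "2 * t + (-1) \<notin> T"
      proof
        assume "2 * t + (-1) \<in> T"
        then have "((2 * t + (-1)) + 1) / 2 \<in> R" unfolding R_def by blast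
        then show False using t by simp
      qed
      then show "2 * t + (-1) \<in> {t \<in> {0..1} - T. \<delta> t \<in> fst c}"
        using t m by (auto simp: concat_path_def)
    qed
    then show "(\<lambda>t. snd c (concat_path \<gamma> \<delta> t) i) C1_differentiable_on ?A \<inter> {1/2<..}"
      by (rule C1_differentiable_on_cong_open[where U = "{1/2<..}"]) (auto simp: concat_path_def)
    show "?A \<subseteq> {..<1/2} \<union> {1/2<..}" by (auto simp: R_def)
  qed auto
  moreover have "finite R" using S T by (auto simp: R_def)
  moreover have "pathin (mtop M) (concat_path \<gamma> \<delta>)"
    using assms by (intro pathin_concat_path) (auto simp: piecewise_C1_path_def)
  ultimately show ?thesis unfolding piecewise_C1_path_def by blast
qed

text \<open>The chart selected in \<open>speed\<close> depends only on the point of the manifold, so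
  both sides are computed in the same chart and the factor comes from the chain rule in one
  variable. Agreement on an open set \<open>U\<close> allows \<open>\<delta>\<close> to be one half
  of a concatenation.\<close>

lemma speed_affine:
  assumes \<gamma>: "piecewise_C1_path M \<gamma>" and cov: "(\<Union>c\<in>atlas M. fst c) = topspace (mtop M)" and a: "a \<ge> 0"
  obtains S where "finite S"
    "\<And>\<delta> t U. open U \<Longrightarrow> t \<in> U \<Longrightarrow> (\<And>s. s \<in> U \<Longrightarrow> \<delta> s = \<gamma> (a * s + b)) \<Longrightarrow> a * t + b \<in> {0..1} - S \<Longrightarrow>
       speed M \<delta> t = a * speed M \<gamma> (a * t + b)"
proof -
  obtain S where S: "finite S" "\<And>c i. c \<in> atlas M \<Longrightarrow> i < mdim M \<Longrightarrow>
      (\<lambda>t. snd c (\<gamma> t) i) C1_differentiable_on {t \<in> {0..1} - S. \<gamma> t \<in> fst c}"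
    using \<gamma> unfolding piecewise_C1_path_def by blast
  show thesis
  proof (rule that[OF S(1)])
    fix \<delta> t U assume U: "open U" "t \<in> U" "\<And>s. s \<in> U \<Longrightarrow> \<delta> s = \<gamma> (a * s + b)" and t: "a * t + b \<in> {0..1} - S"
    have d: "\<delta> t = \<gamma> (a * t + b)" using U by blast
    have "\<gamma> (a * t + b) \<in> topspace (mtop M)"
      using \<gamma> t unfolding piecewise_C1_path_def pathin_def continuous_map_def by auto
    then have ex: "\<exists>c. c \<in> atlas M \<and> \<gamma> (a * t + b) \<in> fst c" unfolding cov[symmetric] by blast
    define c where "c = (SOME c. c \<in> atlas M \<and> \<gamma> (a * t + b) \<in> fst c)"
    have c: "c \<in> atlas M" "\<gamma> (a * t + b) \<in> fst c" using someI_ex[OF ex] unfolding c_def by auto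
    have D: "deriv (\<lambda>s. snd c (\<delta> s) i) t = a * deriv (\<lambda>s. snd c (\<gamma> s) i) (a * t + b)" if "i < mdim M" for i
    proof -
      have "(\<lambda>s. snd c (\<gamma> s) i) differentiable at (a * t + b)"
        using S(2)[OF c(1) that] t c(2) unfolding C1_differentiable_on_eq by auto
      then have "((\<lambda>s. snd c (\<gamma> s) i) has_real_derivative deriv (\<lambda>s. snd c (\<gamma> s) i) (a * t + b)) (at (a * t + b))"
        using DERIV_deriv_iff_real_differentiable by blast
      then have "((\<lambda>s. snd c (\<gamma> (a * s + b)) i) has_real_derivative deriv (\<lambda>s. snd c (\<gamma> s) i) (a * t + b) * a) (at t)"
        by (rule DERIV_chain'[rotated, where g = "\<lambda>s. snd c (\<gamma> s) i"]) (auto intro!: derivative_eq_intros)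
      then have "((\<lambda>s. snd c (\<delta> s) i) has_real_derivative deriv (\<lambda>s. snd c (\<gamma> s) i) (a * t + b) * a) (at t)"
        by (rule has_field_derivative_transform_within_open[OF _ U(1,2)]) (simp add: U(3))
      then show ?thesis by (simp add: DERIV_imp_deriv mult.commute)
    qed
    have "(\<Sum>i<mdim M. \<Sum>j<mdim M. rmetric M c (\<delta> t) i j * deriv (\<lambda>s. snd c (\<delta> s) i) t * deriv (\<lambda>s. snd c (\<delta> s) j) t)
       = a\<^sup>2 * (\<Sum>i<mdim M. \<Sum>j<mdim M. rmetric M c (\<gamma> (a * t + b)) i j * deriv (\<lambda>s. snd c (\<gamma> s) i) (a * t + b) * deriv (\<lambda>s. snd c (\<gamma> s) j) (a * t + b))"
      unfolding sum_distrib_left d by (intro sum.cong refl) (simp add: D power2_eq_square)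
    then show "speed M \<delta> t = a * speed M \<gamma> (a * t + b)"
      unfolding speed_def Let_def d c_def[symmetric] using a
      by (simp add: real_sqrt_mult)
  qed
qed

text \<open>On each half the speed is twice that of the corresponding path, except at finitely many
  times, which form a null set; the factor 2 is absorbed by the substitution.\<close>

lemma path_length_concat_le:
  assumes \<gamma>: "piecewise_C1_path M \<gamma>" and \<delta>: "piecewise_C1_path M \<delta>"
    and cov: "(\<Union>c\<in>atlas M. fst c) = topspace (mtop M)"
  shows "path_length M (concat_path \<gamma> \<delta>) \<le> path_length M \<gamma> + path_length M \<delta>"
proof -
  let ?f = "\<lambda>t. ennreal (speed M (concat_path \<gamma> \<delta>) t) * indicator {0..1} t"
  have two: "ennreal (2 * x) = ennreal 2 * ennreal x" for x by (simp add: ennreal_mult')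
  obtain S where S: "finite S" "\<And>\<beta> t U. open U \<Longrightarrow> t \<in> U \<Longrightarrow> (\<And>s. s \<in> U \<Longrightarrow> \<beta> s = \<gamma> (2 * s + 0)) \<Longrightarrow> 2 * t + 0 \<in> {0..1} - S \<Longrightarrow>
       speed M \<beta> t = 2 * speed M \<gamma> (2 * t + 0)"
    by (rule speed_affine[OF \<gamma> cov, of 2 0]) auto
  obtain T where T: "finite T" "\<And>\<beta> t U. open U \<Longrightarrow> t \<in> U \<Longrightarrow> (\<And>s. s \<in> U \<Longrightarrow> \<beta> s = \<delta> (2 * s + (-1))) \<Longrightarrow> 2 * t + (-1) \<in> {0..1} - T \<Longrightarrow>
       speed M \<beta> t = 2 * speed M \<delta> (2 * t + (-1))"
    by (rule speed_affine[OF \<delta> cov, of 2 "-1"]) auto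
  have "(\<integral>\<^sup>+t. ?f t * indicator {..1/2} t \<partial>lborel)
      \<le> (\<integral>\<^sup>+t. ennreal 2 * (ennreal (speed M \<gamma> (2 * t + 0)) * indicator {0..1} (2 * t + 0)) \<partial>lborel)"
  proof (rule nn_integral_mono_AE)
    \<comment> \<open>The time 1/2 is excluded too: it belongs to this half, but the concatenation
      need not follow the first path on its right.\<close>
    have "finite ({1/2} \<union> (\<lambda>s. s / 2) ` S)" using S by simp
    then have "AE t in lborel. t \<notin> {1/2} \<union> (\<lambda>s. s / 2) ` S"
      by (intro AE_not_in) (auto intro!: finite_imp_null_set_lborel)
    then show "AE t in lborel. ?f t * indicator {..1/2} t
      \<le> ennreal 2 * (ennreal (speed M \<gamma> (2 * t + 0)) * indicator {0..1} (2 * t + 0))"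
    proof (rule AE_mp, intro AE_I2 impI)
      fix t assume t: "t \<notin> {1/2} \<union> (\<lambda>s. s / 2) ` S"
      show "?f t * indicator {..1/2} t \<le> ennreal 2 * (ennreal (speed M \<gamma> (2 * t + 0)) * indicator {0..1} (2 * t + 0))"
      proof (cases "0 \<le> t \<and> t \<le> 1/2")
        case True
        have "2 * t \<notin> S"
        proof
          assume "2 * t \<in> S"
          then have "(2 * t) / 2 \<in> (\<lambda>s. s / 2) ` S" by (rule imageI)
          then show False using t by simp
        qed
        then have "speed M (concat_path \<gamma> \<delta>) t = 2 * speed M \<gamma> (2 * t + 0)"
          using True t by (intro S(2)[where U = "{..<1/2}"]) (auto simp: concat_path_def)
        then show ?thesis using True by (simp add: two)
      qed (auto split: split_indicator)
    qed
  qed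
  also have "\<dots> \<le> path_length M \<gamma>"
    unfolding path_length_def by (rule nn_integral_affine_le) simp
  finally have 1: "(\<integral>\<^sup>+t. ?f t * indicator {..1/2} t \<partial>lborel) \<le> path_length M \<gamma>" .
  have "(\<integral>\<^sup>+t. ?f t * indicator (space lborel - {..1/2}) t \<partial>lborel)
      \<le> (\<integral>\<^sup>+t. ennreal 2 * (ennreal (speed M \<delta> (2 * t + (-1))) * indicator {0..1} (2 * t + (-1))) \<partial>lborel)"
  proof (rule nn_integral_mono_AE)
    have "finite ((\<lambda>s. (s + 1) / 2) ` T)" using T by simp
    then have "AE t in lborel. t \<notin> (\<lambda>s. (s + 1) / 2) ` T"
      by (intro AE_not_in) (auto intro!: finite_imp_null_set_lborel)
    then show "AE t in lborel. ?f t * indicator (space lborel - {..1/2}) t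
      \<le> ennreal 2 * (ennreal (speed M \<delta> (2 * t + (-1))) * indicator {0..1} (2 * t + (-1)))"
    proof (rule AE_mp, intro AE_I2 impI)
      fix t assume t: "t \<notin> (\<lambda>s. (s + 1) / 2) ` T"
      show "?f t * indicator (space lborel - {..1/2}) t \<le> ennreal 2 * (ennreal (speed M \<delta> (2 * t + (-1))) * indicator {0..1} (2 * t + (-1)))"
      proof (cases "1/2 < t \<and> t \<le> 1")
        case True
        have "2 * t + (-1) \<notin> T" using t by (force simp: image_iff)
        then have "speed M (concat_path \<gamma> \<delta>) t = 2 * speed M \<delta> (2 * t + (-1))"
          using True t by (intro T(2)[where U = "{1/2<..}"]) (auto simp: concat_path_def)
        then show ?thesis using True by (simp add: two)
      qed (auto split: split_indicator)
    qed
  qed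
  also have "\<dots> \<le> path_length M \<delta>"
    unfolding path_length_def by (rule nn_integral_affine_le) simp
  finally have 2: "(\<integral>\<^sup>+t. ?f t * indicator (space lborel - {..1/2}) t \<partial>lborel) \<le> path_length M \<delta>" .
  have "path_length M (concat_path \<gamma> \<delta>) \<le> (\<integral>\<^sup>+t. ?f t * indicator {..1/2} t \<partial>lborel) + (\<integral>\<^sup>+t. ?f t * indicator (space lborel - {..1/2}) t \<partial>lborel)"
    unfolding path_length_def by (rule nn_integral_le_split) simp
  also have "\<dots> \<le> path_length M \<gamma> + path_length M \<delta>" using 1 2 by (rule add_mono)
  finally show ?thesis .
qed

lemma le_INF_add:
  fixes f :: "'a \<Rightarrow> ennreal"
  assumes "\<And>i. i \<in> I \<Longrightarrow> a \<le> f i + b"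
  shows "a \<le> (INF i\<in>I. f i) + b"
proof (cases "b = Orderings.top")
  case False
  then have "a - b \<le> (INF i\<in>I. f i)"
    using assms by (intro INF_greatest) (auto simp: ennreal_minus_le_iff add.commute)
  then show ?thesis using False by (simp add: ennreal_minus_le_iff add.commute)
qed simp

lemma inf_length_triangle:
  assumes cov: "(\<Union>c\<in>atlas M. fst c) = topspace (mtop M)"
  shows "inf_length M p q \<le> inf_length M p x + inf_length M x q"
proof -
  let ?P = "\<lambda>p q. {\<gamma>. piecewise_C1_path M \<gamma> \<and> \<gamma> 0 = p \<and> \<gamma> 1 = q}"
  have "inf_length M p q \<le> path_length M \<delta> + path_length M \<gamma>" if "\<gamma> \<in> ?P p x" "\<delta> \<in> ?P x q" for \<gamma> \<delta>
  proof -
    have "concat_path \<gamma> \<delta> \<in> ?P p q"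
      using that piecewise_C1_path_concat[of M \<gamma> \<delta>] by (auto simp: concat_path_def)
    then have "inf_length M p q \<le> path_length M (concat_path \<gamma> \<delta>)"
      unfolding inf_length_def by (rule INF_lower)
    then show ?thesis using path_length_concat_le[of M \<gamma> \<delta>, OF _ _ cov] that by (auto intro: order_trans simp: add.commute)
  qed
  then have "inf_length M p q \<le> inf_length M x q + path_length M \<gamma>" if "\<gamma> \<in> ?P p x" for \<gamma>
    unfolding inf_length_def[of M x q] using that by (intro le_INF_add) simp
  then have "inf_length M p q \<le> path_length M \<gamma> + inf_length M x q" if "\<gamma> \<in> ?P p x" for \<gamma>
    using that by (simp add: add.commute)
  then show ?thesis
    unfolding inf_length_def[of M p x] by (intro le_INF_add)
qed

section \<open>Coordinate boxes and inverse charts\<close>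

lemma openin_Euclidean_space_box:
  assumes "openin (Euclidean_space n) W" "y\<^sub>0 \<in> W"
  obtains r where "r > 0" "\<And>y. y \<in> topspace (Euclidean_space n) \<Longrightarrow> (\<And>i. i < n \<Longrightarrow> \<bar>y i - y\<^sub>0 i\<bar> < r) \<Longrightarrow> y \<in> W"
proof -
  let ?S = "{x. \<forall>i\<ge>n. x i = 0} :: (nat \<Rightarrow> real) set"
  obtain T where T: "openin (powertop_real UNIV) T" "W = T \<inter> ?S"
    using assms(1) unfolding Euclidean_space_def openin_subtopology by blast
  then obtain U where U: "\<And>i. open (U i)" "y\<^sub>0 \<in> PiE UNIV U" "PiE UNIV U \<subseteq> T"
    using assms(2) unfolding openin_product_topology_alt by (auto; metis)
  have "\<exists>\<rho>>0. \<forall>z. \<bar>z - y\<^sub>0 i\<bar> < \<rho> \<longrightarrow> z \<in> U i" for i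
    using U(1)[of i] U(2) unfolding open_dist dist_real_def by auto
  then obtain \<rho> where \<rho>: "\<And>i. \<rho> i > 0" "\<And>i z. \<bar>z - y\<^sub>0 i\<bar> < \<rho> i \<Longrightarrow> z \<in> U i" by metis
  \<comment> \<open>The 1 keeps the set non-empty in dimension 0.\<close>
  define r where "r = Min (insert 1 (\<rho> ` {..<n}))"
  have r: "r > 0" "\<And>i. i < n \<Longrightarrow> r \<le> \<rho> i" using \<rho>(1) by (auto simp: r_def)
  show thesis
  proof (rule that[OF r(1)])
    fix y assume y: "y \<in> topspace (Euclidean_space n)" "\<And>i. i < n \<Longrightarrow> \<bar>y i - y\<^sub>0 i\<bar> < r"
    have "y i \<in> U i" for i
    proof (cases "i < n")
      case True
      then show ?thesis using y(2)[OF True] r(2)[OF True] by (intro \<rho>(2)) linarith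
    next
      case False
      \<comment> \<open>From index \<open>n\<close> on all points of the space vanish, so only
        \<open>n\<close> of the radii matter.\<close>
      then have "y i = y\<^sub>0 i" using y(1) assms(2) T(2) by (auto simp: topspace_Euclidean_space)
      then show ?thesis using U(2) by auto
    qed
    then show "y \<in> W" using U(3) T(2) y(1) by (auto simp: topspace_Euclidean_space)
  qed
qed

lemma openin_Euclidean_space_boxes:
  "openin (Euclidean_space n) {y \<in> topspace (Euclidean_space n). \<forall>i<n. \<bar>y i - y\<^sub>0 i\<bar> < r}"
proof -
  have "open (\<Inter>i\<in>{..<n}. {y :: nat \<Rightarrow> real. \<bar>y i - y\<^sub>0 i\<bar> < r})"
    by (intro open_INT ballI open_Collect_less continuous_intros) auto
  then have "openin (powertop_real UNIV) (\<Inter>i\<in>{..<n}. {y :: nat \<Rightarrow> real. \<bar>y i - y\<^sub>0 i\<bar> < r})"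
    by (simp add: euclidean_product_topology)
  then have "openin (Euclidean_space n) ((\<Inter>i\<in>{..<n}. {y. \<bar>y i - y\<^sub>0 i\<bar> < r}) \<inter> {x. \<forall>i\<ge>n. x i = 0})"
    unfolding Euclidean_space_def openin_subtopology by blast
  also have "(\<Inter>i\<in>{..<n}. {y. \<bar>y i - y\<^sub>0 i\<bar> < r}) \<inter> {x. \<forall>i\<ge>n. x i = 0}
      = {y \<in> topspace (Euclidean_space n). \<forall>i<n. \<bar>y i - y\<^sub>0 i\<bar> < r}"
    by (auto simp: topspace_Euclidean_space)
  finally show ?thesis .
qed

lemma continuous_map_axis_line:
  assumes "y \<in> topspace (Euclidean_space n)" "i < n"
  shows "continuous_map euclideanreal (Euclidean_space n) (\<lambda>s. y(i := y i + s * d))"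
proof -
  have "continuous_map euclideanreal euclideanreal (\<lambda>s. (y(i := y i + s * d)) k)" for k
    by (cases "k = i") (auto intro!: continuous_intros)
  then show ?thesis
    using assms unfolding Euclidean_space_def continuous_map_in_subtopology continuous_map_componentwise_UNIV
    by (auto simp: topspace_Euclidean_space)
qed

text \<open>\<open>chart_inv\<close> is a set-theoretic inverse; it is continuous because it agrees
  on the image of the chart with the inverse of the homeomorphism.\<close>

lemma chart_inv:
  assumes "is_chart T n c"
  shows "q \<in> fst c \<Longrightarrow> chart_inv c (snd c q) = q"
    and "y \<in> snd c ` fst c \<Longrightarrow> chart_inv c y \<in> fst c \<and> snd c (chart_inv c y) = y"
    and "continuous_map (subtopology (Euclidean_space n) (snd c ` fst c)) T (chart_inv c)"
proof -
  have op: "openin T (fst c)" "openin (Euclidean_space n) (snd c ` fst c)"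
    and hom: "homeomorphic_map (subtopology T (fst c)) (subtopology (Euclidean_space n) (snd c ` fst c)) (snd c)"
    using assms by (auto simp: is_chart_def)
  have top: "topspace (subtopology T (fst c)) = fst c"
       "topspace (subtopology (Euclidean_space n) (snd c ` fst c)) = snd c ` fst c"
    using op[THEN openin_subset] by (auto simp: topspace_subtopology_subset)
  have inj: "inj_on (snd c) (fst c)" using homeomorphic_imp_injective_map[OF hom] top by simp
  show 1: "q \<in> fst c \<Longrightarrow> chart_inv c (snd c q) = q" for q
    using inj by (simp add: chart_inv_def)
  show "y \<in> snd c ` fst c \<Longrightarrow> chart_inv c y \<in> fst c \<and> snd c (chart_inv c y) = y"
    using inj by (auto simp: chart_inv_def)
  obtain g where g: "homeomorphic_maps (subtopology T (fst c)) (subtopology (Euclidean_space n) (snd c ` fst c)) (snd c) g"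
    using hom unfolding homeomorphic_map_maps by blast
  have "continuous_map (subtopology (Euclidean_space n) (snd c ` fst c)) T g"
    using g unfolding homeomorphic_maps_def continuous_map_in_subtopology by blast
  then show "continuous_map (subtopology (Euclidean_space n) (snd c ` fst c)) T (chart_inv c)"
  proof (rule continuous_map_eq)
    fix y assume "y \<in> topspace (subtopology (Euclidean_space n) (snd c ` fst c))"
    then obtain q where "q \<in> fst c" "y = snd c q" using top by auto
    then show "g y = chart_inv c y" using g 1 unfolding homeomorphic_maps_def top by auto
  qed
qed

lemma inf_length_le_path_length:
  "piecewise_C1_path M \<gamma> \<Longrightarrow> inf_length M (\<gamma> 0) (\<gamma> 1) \<le> path_length M \<gamma>"
  unfolding inf_length_def by (rule INF_lower) simp

lemma inf_length_refl:
  assumes "p \<in> topspace (mtop M)"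
  shows "inf_length M p p = 0"
proof -
  have "piecewise_C1_path M (\<lambda>_. p)"
    using assms unfolding piecewise_C1_path_def pathin_def by auto
  then have "inf_length M p p \<le> path_length M (\<lambda>_. p)" by (rule inf_length_le_path_length)
  also have "\<dots> = 0" by (simp add: path_length_def speed_def)
  finally show ?thesis by simp
qed

section \<open>Paths along one coordinate of a chart\<close>

context
  fixes M :: "'m manifold" and c :: "'m chart" and y :: "nat \<Rightarrow> real" and i :: nat and d :: real
    and \<gamma> :: "real \<Rightarrow> 'm"
  assumes man: "closed_oriented_manifold M" and c: "c \<in> atlas M" and i: "i < mdim M"
    and y: "y \<in> topspace (Euclidean_space (mdim M))"
    and seg: "\<And>s. s \<in> {0..1} \<Longrightarrow> y(i := y i + s * d) \<in> snd c ` fst c"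
  defines "\<gamma> \<equiv> \<lambda>s. chart_inv c (y(i := y i + s * d))"
begin

lemma atlas_is_chart: "c' \<in> atlas M \<Longrightarrow> is_chart (mtop M) (mdim M) c'"
  using man by (auto simp: closed_oriented_manifold_def Let_def)

lemma axis_path_in_chart:
  assumes "s \<in> {0..1}"
  shows "\<gamma> s \<in> fst c" "snd c (\<gamma> s) = y(i := y i + s * d)"
  using chart_inv(2)[OF atlas_is_chart[OF c] seg[OF assms]] by (auto simp: \<gamma>_def)

lemma axis_path_overlap:
  assumes "t \<in> {0..1}" "\<gamma> t \<in> fst c'"
  shows "y(i := y i + t * d) \<in> snd c ` (fst c \<inter> fst c')"
  using axis_path_in_chart[OF assms(1)] assms(2) by (metis IntI imageI)

lemma axis_path_smooth:
  assumes "c' \<in> atlas M" "k < mdim M"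
  shows "smooth_on (mdim M) (snd c ` (fst c \<inter> fst c')) (\<lambda>y. snd c' (chart_inv c y) k)"
  using man c assms by (auto simp: closed_oriented_manifold_def Let_def)

lemma axis_path_derivative:
  assumes c': "c' \<in> atlas M" "k < mdim M" and t: "t \<in> {0..1}" "\<gamma> t \<in> fst c'"
  shows "((\<lambda>s. snd c' (\<gamma> s) k) has_real_derivative jacobian c c' (\<gamma> t) k i * d) (at t)"
proof -
  let ?h = "\<lambda>y. snd c' (chart_inv c y) k" and ?l = "\<lambda>s. y(i := y i + s * d)"
  have "Ck_on (mdim M) (Suc 0) (snd c ` (fst c \<inter> fst c')) ?h"
    using axis_path_smooth[OF c'] unfolding smooth_on_def by blast
  then have "(\<lambda>s. ?h ((?l t)(i := s))) differentiable (at (?l t i))"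
    using i axis_path_overlap[OF t] by (simp only: Ck_on.simps)
  then have "((\<lambda>s. ?h ((?l t)(i := s))) has_real_derivative partial i ?h (?l t)) (at (?l t i))"
    unfolding partial_def DERIV_deriv_iff_real_differentiable .
  then have "((\<lambda>s. ?h (y(i := s))) has_real_derivative partial i ?h (?l t)) (at (y i + t * d))"
    by simp
  then have "((\<lambda>s. ?h (y(i := y i + s * d))) has_real_derivative partial i ?h (?l t) * d) (at t)"
    by (rule DERIV_chain'[rotated, where g = "\<lambda>s. ?h (y(i := s))"]) (auto intro!: derivative_eq_intros)
  then show ?thesis
    unfolding jacobian_def axis_path_in_chart(2)[OF t(1)] by (simp add: \<gamma>_def)
qed

text \<open>In every chart the derivative along the path is an entry of the Jacobian times
  \<open>d\<close>, and this is continuous because coordinate changes are smooth. So the set of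
  exceptional times is empty.\<close>

lemma axis_path_C1: "piecewise_C1_path M \<gamma>"
  unfolding piecewise_C1_path_def
proof (intro conjI exI[of _ "{}"] ballI allI impI)
  have line: "continuous_map (top_of_set A) (subtopology (Euclidean_space (mdim M)) B) (\<lambda>s. y(i := y i + s * d))"
    if "\<And>s. s \<in> A \<Longrightarrow> y(i := y i + s * d) \<in> B" for A B
    using that continuous_map_axis_line[OF y i, of d]
    by (auto simp: continuous_map_in_subtopology continuous_map_from_subtopology)
  have "continuous_map (top_of_set {0..1}) (mtop M) (chart_inv c \<circ> (\<lambda>s. y(i := y i + s * d)))"
    by (rule continuous_map_compose[OF line chart_inv(3)[OF atlas_is_chart[OF c]]]) (rule seg)
  then show "pathin (mtop M) \<gamma>" by (simp add: pathin_def comp_def \<gamma>_def)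
  fix c' k assume c': "c' \<in> atlas M" "k < mdim M"
  let ?A = "{t \<in> {0..1} - {}. \<gamma> t \<in> fst c'}" and ?B = "snd c ` (fst c \<inter> fst c')"
  let ?h = "\<lambda>y. snd c' (chart_inv c y) k"
  have AB: "y(i := y i + s * d) \<in> ?B" if "s \<in> ?A" for s using that by (intro axis_path_overlap) auto
  have "Ck_on (mdim M) (Suc 0) ?B ?h"
    using axis_path_smooth[OF c'] unfolding smooth_on_def by blast
  then have "continuous_map (subtopology (Euclidean_space (mdim M)) ?B) euclideanreal (partial i ?h)"
    using i by (simp only: Ck_on.simps)
  from continuous_map_compose[OF line this, of ?A] AB
  have "continuous_on ?A (\<lambda>t. partial i ?h (y(i := y i + t * d)))" by (simp add: comp_def)
  then have "continuous_on ?A (\<lambda>t. partial i ?h (y(i := y i + t * d)) * d)"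
    by (intro continuous_intros)
  then have "continuous_on ?A (\<lambda>t. jacobian c c' (\<gamma> t) k i * d)"
    by (rule continuous_on_eq) (simp add: jacobian_def axis_path_in_chart(2))
  then show "(\<lambda>t. snd c' (\<gamma> t) k) C1_differentiable_on ?A"
    unfolding C1_differentiable_on_def has_real_derivative_iff_has_vector_derivative[symmetric]
    using axis_path_derivative[OF c'] by (intro exI[of _ "\<lambda>t. jacobian c c' (\<gamma> t) k i * d"]) auto
qed simp

text \<open>On this path the derivative in any other chart is a single column of the Jacobian, so that
  no multivariate chain rule is needed to see that the speed does not depend on the chart.\<close>

lemma axis_path_speed:
  assumes met: "riemannian_metric M" and t: "t \<in> {0..1}"
  shows "speed M \<gamma> t = \<bar>d\<bar> * sqrt (rmetric M c (\<gamma> t) i i)"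
proof -
  have ex: "\<exists>c. c \<in> atlas M \<and> \<gamma> t \<in> fst c" using c axis_path_in_chart(1)[OF t] by blast
  define c' where "c' = (SOME c. c \<in> atlas M \<and> \<gamma> t \<in> fst c)"
  have c': "c' \<in> atlas M" "\<gamma> t \<in> fst c'" using someI_ex[OF ex] unfolding c'_def by auto
  have D: "deriv (\<lambda>s. snd c' (\<gamma> s) k) t = jacobian c c' (\<gamma> t) k i * d" if "k < mdim M" for k
    using axis_path_derivative[OF c'(1) that t c'(2)] by (rule DERIV_imp_deriv)
  have g: "rmetric M c (\<gamma> t) i i = (\<Sum>k<mdim M. \<Sum>l<mdim M. jacobian c c' (\<gamma> t) k i * jacobian c c' (\<gamma> t) l i * rmetric M c' (\<gamma> t) k l)"
    using met unfolding riemannian_metric_def Let_def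
    by (elim conjE) (drule bspec[OF _ c], drule bspec[OF _ c'(1)], drule bspec[of _ _ "\<gamma> t"],
        simp add: axis_path_in_chart(1)[OF t] c'(2), simp add: i)
  have "(\<Sum>k<mdim M. \<Sum>l<mdim M. rmetric M c' (\<gamma> t) k l * deriv (\<lambda>s. snd c' (\<gamma> s) k) t * deriv (\<lambda>s. snd c' (\<gamma> s) l) t)
      = d\<^sup>2 * rmetric M c (\<gamma> t) i i"
    unfolding g sum_distrib_left by (intro sum.cong refl) (simp add: D power2_eq_square)
  then show ?thesis
    unfolding speed_def Let_def c'_def[symmetric] by (simp add: real_sqrt_mult)
qed

lemma inf_length_axis_le:
  assumes met: "riemannian_metric M" and G: "\<And>s. s \<in> {0..1} \<Longrightarrow> rmetric M c (\<gamma> s) i i \<le> G"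
  shows "inf_length M (chart_inv c y) (chart_inv c (y(i := y i + d))) \<le> ennreal (\<bar>d\<bar> * sqrt G)"
proof -
  have "inf_length M (\<gamma> 0) (\<gamma> 1) \<le> path_length M \<gamma>"
    by (rule inf_length_le_path_length[OF axis_path_C1])
  also have "\<dots> \<le> (\<integral>\<^sup>+t. ennreal (\<bar>d\<bar> * sqrt G) * indicator {0..1::real} t \<partial>lborel)"
    unfolding path_length_def
    by (intro nn_integral_mono)
      (auto split: split_indicator simp: axis_path_speed[OF met] G intro!: ennreal_leI mult_left_mono)
  also have "\<dots> = ennreal (\<bar>d\<bar> * sqrt G)" by (subst nn_integral_cmult_indicator) auto
  finally show ?thesis by (simp add: \<gamma>_def)
qed

end

text \<open>Both directions are recorded, in place of a proof that lengths are invariant under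
  reversal of paths.\<close>

definition near :: "'m manifold \<Rightarrow> real \<Rightarrow> 'm \<Rightarrow> 'm \<Rightarrow> bool" where
  "near M \<delta> p q \<longleftrightarrow> inf_length M p q \<le> ennreal \<delta> \<and> inf_length M q p \<le> ennreal \<delta>"

text \<open>The coordinates of \<open>y\<close> are replaced by those of \<open>z\<close> one at a
  time, \<open>u m\<close> having the first \<open>m\<close> of them. Each segment stays in the box
  and is parallel to an axis, so bounds on the diagonal entries of the metric suffice.\<close>

lemma inf_length_box_le:
  assumes man: "closed_oriented_manifold M" and met: "riemannian_metric M" and c: "c \<in> atlas M"
    and box: "\<And>y. y \<in> topspace (Euclidean_space (mdim M)) \<Longrightarrow> (\<And>i. i < mdim M \<Longrightarrow> \<bar>y i - y\<^sub>0 i\<bar> < r) \<Longrightarrow>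
      y \<in> snd c ` fst c \<and> (\<forall>i<mdim M. rmetric M c (chart_inv c y) i i \<le> G)"
    and y: "y \<in> topspace (Euclidean_space (mdim M))" "\<And>i. i < mdim M \<Longrightarrow> \<bar>y i - y\<^sub>0 i\<bar> < r"
    and z: "z \<in> topspace (Euclidean_space (mdim M))" "\<And>i. i < mdim M \<Longrightarrow> \<bar>z i - y\<^sub>0 i\<bar> < r"
    and G: "G \<ge> 0"
  shows "inf_length M (chart_inv c y) (chart_inv c z) \<le> ennreal ((\<Sum>j<mdim M. \<bar>z j - y j\<bar>) * sqrt G)"
proof -
  let ?n = "mdim M"
  define u where "u m = (\<lambda>j. if j < m then z j else y j)" for m
  have cov: "(\<Union>c\<in>atlas M. fst c) = topspace (mtop M)"
    using man by (simp add: closed_oriented_manifold_def Let_def)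
  have ch: "is_chart (mtop M) ?n c" using man c by (auto simp: closed_oriented_manifold_def Let_def)
  have L: "inf_length M (chart_inv c y) (chart_inv c (u m)) \<le> ennreal ((\<Sum>j<m. \<bar>z j - y j\<bar>) * sqrt G)"
    if "m \<le> ?n" for m using that
  proof (induction m)
    case 0
    have "chart_inv c y \<in> topspace (mtop M)"
      using chart_inv(2)[OF ch] box[OF y] cov c by blast
    then show ?case by (simp add: u_def inf_length_refl)
  next
    case (Suc m)
    let ?d = "z m - y m"
    have m: "m < ?n" using Suc by simp
    have um: "u m \<in> topspace (Euclidean_space ?n)" using y(1) z(1) by (auto simp: u_def topspace_Euclidean_space)
    have eq: "u (Suc m) = (u m)(m := u m m + ?d)" by (auto simp: u_def fun_eq_iff)
    have B: "(u m)(m := u m m + s * ?d) \<in> snd c ` fst c \<and>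
       (\<forall>i<?n. rmetric M c (chart_inv c ((u m)(m := u m m + s * ?d))) i i \<le> G)" if s: "s \<in> {0..1}" for s
    proof (rule box)
      show "(u m)(m := u m m + s * ?d) \<in> topspace (Euclidean_space ?n)"
        using um m by (auto simp: topspace_Euclidean_space)
      fix i assume i: "i < ?n"
      have "\<bar>(1 - s) * (y m - y\<^sub>0 m) + s * (z m - y\<^sub>0 m)\<bar> < r"
      proof -
        have "\<bar>(1 - s) * (y m - y\<^sub>0 m) + s * (z m - y\<^sub>0 m)\<bar> \<le> (1 - s) * \<bar>y m - y\<^sub>0 m\<bar> + s * \<bar>z m - y\<^sub>0 m\<bar>"
          using s abs_triangle_ineq[of "(1 - s) * (y m - y\<^sub>0 m)" "s * (z m - y\<^sub>0 m)"] by (simp add: abs_mult)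
        also have "\<dots> \<le> max \<bar>y m - y\<^sub>0 m\<bar> \<bar>z m - y\<^sub>0 m\<bar>"
          using s by (intro convex_bound_le) auto
        also have "\<dots> < r" using y(2)[OF m] z(2)[OF m] by simp
        finally show ?thesis .
      qed
      moreover have "u m m + s * ?d - y\<^sub>0 m = (1 - s) * (y m - y\<^sub>0 m) + s * (z m - y\<^sub>0 m)"
        by (simp add: u_def algebra_simps)
      ultimately show "\<bar>((u m)(m := u m m + s * ?d)) i - y\<^sub>0 i\<bar> < r"
        using y(2)[OF i] z(2)[OF i] by (auto simp: u_def)
    qed
    have "inf_length M (chart_inv c y) (chart_inv c (u (Suc m)))
        \<le> inf_length M (chart_inv c y) (chart_inv c (u m)) + inf_length M (chart_inv c (u m)) (chart_inv c (u (Suc m)))"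
      by (rule inf_length_triangle[OF cov])
    also have "\<dots> \<le> ennreal ((\<Sum>j<m. \<bar>z j - y j\<bar>) * sqrt G) + ennreal (\<bar>?d\<bar> * sqrt G)"
    proof (rule add_mono)
      show "inf_length M (chart_inv c (u m)) (chart_inv c (u (Suc m))) \<le> ennreal (\<bar>?d\<bar> * sqrt G)"
        unfolding eq using B m by (intro inf_length_axis_le[OF man c m um _ met]) auto
    qed (use Suc in simp)
    also have "\<dots> = ennreal ((\<Sum>j<Suc m. \<bar>z j - y j\<bar>) * sqrt G)"
      using G by (subst ennreal_plus[symmetric]) (auto simp: distrib_right intro!: mult_nonneg_nonneg sum_nonneg)
    finally show ?case .
  qed
  have "u ?n = z" using y(1) z(1) by (auto simp: u_def fun_eq_iff topspace_Euclidean_space)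
  then show ?thesis using L[OF order_refl] by simp
qed

text \<open>On a small coordinate box around \<open>p\<close> the diagonal entries of the metric are
  bounded by continuity, so the coordinatewise paths between \<open>p\<close> and a point of the box
  are short.\<close>

lemma near_nbhd:
  assumes man: "closed_oriented_manifold M" and met: "riemannian_metric M"
    and p: "p \<in> topspace (mtop M)" and \<delta>: "\<delta> > 0"
  obtains U where "openin (mtop M) U" "p \<in> U" "\<And>q. q \<in> U \<Longrightarrow> near M \<delta> p q"
proof -
  let ?n = "mdim M" and ?E = "Euclidean_space (mdim M)"
  have cov: "(\<Union>c\<in>atlas M. fst c) = topspace (mtop M)"
    using man by (simp add: closed_oriented_manifold_def Let_def)
  obtain c where c: "c \<in> atlas M" "p \<in> fst c" using p unfolding cov[symmetric] by blast
  have ch: "is_chart (mtop M) ?n c" using man c by (auto simp: closed_oriented_manifold_def Let_def)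
  let ?O = "snd c ` fst c" and ?g = "\<lambda>i y. rmetric M c (chart_inv c y) i i"
  have O: "openin ?E ?O" "openin (mtop M) (fst c)"
    and cont: "continuous_map (subtopology (mtop M) (fst c)) ?E (snd c)"
    using ch homeomorphic_imp_continuous_map continuous_map_in_subtopology unfolding is_chart_def by blast+
  define y\<^sub>0 where "y\<^sub>0 = snd c p"
  \<comment> \<open>The 1 makes the bound strict at \<open>p\<close>, so that it persists on an open
    set, and makes \<open>sqrt G\<close> positive.\<close>
  define G where "G = 1 + (\<Sum>i<?n. \<bar>?g i y\<^sub>0\<bar>)"
  have G1: "G \<ge> 1" by (simp add: G_def sum_nonneg)
  have gG: "?g i y\<^sub>0 < G" if "i < ?n" for i
    using member_le_sum[of i "{..<?n}" "\<lambda>i. \<bar>?g i y\<^sub>0\<bar>"] that by (auto simp: G_def)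
  have "openin (subtopology ?E ?O) ((\<Inter>i\<in>{..<?n}. {y \<in> topspace (subtopology ?E ?O). ?g i y \<in> {..<G}}) \<inter> topspace (subtopology ?E ?O))"
  proof (rule openin_INT)
    fix i assume i: "i \<in> {..<?n}"
    have "smooth_on ?n ?O (?g i)"
      using met c(1) i unfolding riemannian_metric_def Let_def by simp
    then have "Ck_on ?n 0 ?O (?g i)" unfolding smooth_on_def by blast
    then have "continuous_map (subtopology ?E ?O) euclideanreal (?g i)" by simp
    then show "openin (subtopology ?E ?O) {y \<in> topspace (subtopology ?E ?O). ?g i y \<in> {..<G}}"
      by (rule openin_continuous_map_preimage) simp
  qed simp
  then have W: "openin ?E ((\<Inter>i\<in>{..<?n}. {y \<in> topspace (subtopology ?E ?O). ?g i y \<in> {..<G}}) \<inter> topspace (subtopology ?E ?O))" (is "openin ?E ?W")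
    using O(1) openin_trans_full by blast
  have y0E: "y\<^sub>0 \<in> topspace ?E" using openin_subset[OF O(1)] c by (auto simp: y\<^sub>0_def)
  have "y\<^sub>0 \<in> ?W" using c gG y0E by (auto simp: y\<^sub>0_def)
  then obtain r where r: "r > 0" "\<And>y. y \<in> topspace ?E \<Longrightarrow> (\<And>i. i < ?n \<Longrightarrow> \<bar>y i - y\<^sub>0 i\<bar> < r) \<Longrightarrow> y \<in> ?W"
    using openin_Euclidean_space_box[OF W] by blast
  have box: "y \<in> ?O \<and> (\<forall>i<?n. ?g i y \<le> G)"
    if "y \<in> topspace ?E" "\<And>i. i < ?n \<Longrightarrow> \<bar>y i - y\<^sub>0 i\<bar> < r" for y
    using r(2)[OF that] by force
  \<comment> \<open>At most \<open>?n\<close> segments of length at most \<open>r' * sqrt G\<close>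
    each are used; \<open>?n + 1\<close> avoids a division by 0 in dimension 0.\<close>
  define r' where "r' = min r (\<delta> / (real (?n + 1) * sqrt G))"
  have r': "r' > 0" "r' \<le> r" "r' \<le> \<delta> / (real (?n + 1) * sqrt G)"
    using r(1) \<delta> G1 by (auto simp: r'_def)
  define U where "U = {q \<in> topspace (subtopology (mtop M) (fst c)). snd c q \<in> {y \<in> topspace ?E. \<forall>i<?n. \<bar>y i - y\<^sub>0 i\<bar> < r'}}"
  show thesis
  proof (rule that)
    have "openin (subtopology (mtop M) (fst c)) U"
      unfolding U_def by (rule openin_continuous_map_preimage[OF cont openin_Euclidean_space_boxes])
    then show "openin (mtop M) U" using O(2) openin_trans_full by blast
    show "p \<in> U" using p c y0E r' by (auto simp: U_def y\<^sub>0_def)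
    fix q assume "q \<in> U"
    then have q: "q \<in> fst c" "snd c q \<in> topspace ?E" "\<And>i. i < ?n \<Longrightarrow> \<bar>snd c q i - y\<^sub>0 i\<bar> < r'"
      by (auto simp: U_def)
    have q': "\<bar>snd c q i - y\<^sub>0 i\<bar> < r" if "i < ?n" for i using q(3)[OF that] r'(2) by simp
    have ci: "chart_inv c y\<^sub>0 = p" "chart_inv c (snd c q) = q"
      using chart_inv(1)[OF ch] c q(1) by (auto simp: y\<^sub>0_def)
    have le: "(\<Sum>j<?n. \<bar>snd c q j - y\<^sub>0 j\<bar>) * sqrt G \<le> \<delta>"
    proof -
      have "(\<Sum>j<?n. \<bar>snd c q j - y\<^sub>0 j\<bar>) \<le> (\<Sum>j<?n. r')"
        using q(3) by (intro sum_mono) (simp add: less_imp_le)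
      also have "\<dots> \<le> real (?n + 1) * r'" using r'(1) by (simp add: distrib_right)
      finally have "(\<Sum>j<?n. \<bar>snd c q j - y\<^sub>0 j\<bar>) * sqrt G \<le> real (?n + 1) * r' * sqrt G"
        using G1 by (intro mult_right_mono) auto
      also have "\<dots> \<le> \<delta>"
        using r'(3) G1 by (simp add: pos_le_divide_eq mult_ac)
      finally show ?thesis .
    qed
    have "inf_length M p q \<le> ennreal ((\<Sum>j<?n. \<bar>snd c q j - y\<^sub>0 j\<bar>) * sqrt G)"
      using inf_length_box_le[OF man met c(1) box y0E _ q(2) q'] r(1) G1 by (simp add: ci)
    moreover have "inf_length M q p \<le> ennreal ((\<Sum>j<?n. \<bar>y\<^sub>0 j - snd c q j\<bar>) * sqrt G)"
      using inf_length_box_le[OF man met c(1) box q(2) q' y0E] r(1) G1 by (simp add: ci)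
    ultimately show "near M \<delta> p q"
      using ennreal_leI[OF le] by (auto simp: near_def abs_minus_commute)
  qed
qed

text \<open>A finite infimum is not taken over the empty set, so there is a path. Hence replacing
  both points by near ones does not change the case distinction in \<open>dist_M\<close>.\<close>

lemma near_connected:
  assumes "near M \<delta> p q"
  shows "connected_component_of (mtop M) p q"
proof -
  have "inf_length M p q < Orderings.top" using assms unfolding near_def
    by (meson ennreal_less_top le_less_trans)
  then obtain \<gamma> where "piecewise_C1_path M \<gamma>" "\<gamma> 0 = p" "\<gamma> 1 = q"
    unfolding inf_length_def INF_less_iff by blast
  then have "path_component_of (mtop M) p q"
    unfolding piecewise_C1_path_def path_component_of_def by blast
  then show ?thesis by (rule path_imp_connected_component_of)
qed

text \<open>Both sides are \<open>0\<close> if there is no path of finite length, as \<^const>\<open>enn2real\<close> maps \<open>\<infinity>\<close> to \<open>0\<close>.\<close>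

lemma length_distance_near:
  assumes cov: "(\<Union>c\<in>atlas M. fst c) = topspace (mtop M)" and \<delta>: "\<delta> \<ge> 0"
    and near: "near M \<delta> p x" "near M \<delta> q y"
  shows "\<bar>length_distance M x y - length_distance M p q\<bar> \<le> 2 * \<delta>"
proof -
  note tri = inf_length_triangle[OF cov]
  have two: "ennreal (2 * \<delta>) = ennreal \<delta> + ennreal \<delta>"
    using \<delta> by (subst ennreal_plus[symmetric]) auto
  have 1: "inf_length M x y \<le> inf_length M p q + ennreal (2 * \<delta>)"
  proof -
    have "inf_length M x y \<le> inf_length M x p + (inf_length M p q + inf_length M q y)"
      by (meson tri add_left_mono order_trans)
    also have "\<dots> \<le> ennreal \<delta> + (inf_length M p q + ennreal \<delta>)"
      using near by (intro add_mono) (auto simp: near_def)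
    also have "\<dots> = inf_length M p q + ennreal (2 * \<delta>)"
      unfolding two by (simp only: add_ac)
    finally show ?thesis .
  qed
  have 2: "inf_length M p q \<le> inf_length M x y + ennreal (2 * \<delta>)"
  proof -
    have "inf_length M p q \<le> inf_length M p x + (inf_length M x y + inf_length M y q)"
      by (meson tri add_left_mono order_trans)
    also have "\<dots> \<le> ennreal \<delta> + (inf_length M x y + ennreal \<delta>)"
      using near by (intro add_mono) (auto simp: near_def)
    also have "\<dots> = inf_length M x y + ennreal (2 * \<delta>)"
      unfolding two by (simp only: add_ac)
    finally show ?thesis .
  qed
  show ?thesis
  proof (cases "inf_length M p q")
    case (real a)
    then obtain b where b: "inf_length M x y = ennreal b" "b \<ge> 0"
      using 1 by (cases "inf_length M x y") (auto simp: ennreal_plus[symmetric] top_unique simp del: ennreal_plus)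
    then show ?thesis
      using 1 2 real \<delta> unfolding length_distance_def inf_length_def[symmetric]
      by (auto simp: ennreal_plus[symmetric] simp del: ennreal_plus)
  next
    case top
    then have "inf_length M x y = Orderings.top" using 2 by (cases "inf_length M x y") (auto simp: ennreal_plus[symmetric] top_unique simp del: ennreal_plus)
    then show ?thesis using top \<delta> unfolding length_distance_def inf_length_def[symmetric] by simp
  qed
qed

lemma dist_M_near:
  assumes cov: "(\<Union>c\<in>atlas M. fst c) = topspace (mtop M)" and \<delta>: "\<delta> \<ge> 0"
    and near: "near M \<delta> p x" "near M \<delta> q y"
  shows "\<bar>dist_M M x y - dist_M M p q\<bar> \<le> 2 * \<delta>"
proof -
  have "connected_component_of (mtop M) x y \<longleftrightarrow> connected_component_of (mtop M) p q"
    using near[THEN near_connected] by (meson connected_component_of_sym connected_component_of_trans)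
  then show ?thesis using length_distance_near[OF assms] \<delta> by (simp add: dist_M_def)
qed

section \<open>Barycentric subdivision\<close>

text \<open>Simplices are mere point sets; their vertices are recovered as the extreme points, as in
  \<open>barycenter\<close>.\<close>

definition verts :: "'w::euclidean_space set \<Rightarrow> 'w set" where
  "verts \<sigma> = {x. x extreme_point_of \<sigma>}"

lemma verts_convex_hull:
  "\<not> affine_dependent A \<Longrightarrow> verts (convex hull A) = A"
  by (auto simp: verts_def extreme_point_of_convex_hull_affine_independent)

lemma simplicial_complex_verts:
  assumes "simplicial_complex K" "\<sigma> \<in> K"
  shows "\<not> affine_dependent (verts \<sigma>)" "finite (verts \<sigma>)" "convex hull (verts \<sigma>) = \<sigma>"
proof -
  obtain A where "\<not> affine_dependent A" "\<sigma> = convex hull A"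
    using assms unfolding simplicial_complex_def simplex_def by blast
  then show "\<not> affine_dependent (verts \<sigma>)" "finite (verts \<sigma>)" "convex hull (verts \<sigma>) = \<sigma>"
    by (auto simp: verts_convex_hull aff_independent_finite)
qed

lemma simplicial_complex_hull_subset:
  assumes "simplicial_complex K" "\<sigma> \<in> K" "A \<subseteq> verts \<sigma>"
  shows "convex hull A \<in> K" "verts (convex hull A) = A"
proof -
  note v = simplicial_complex_verts[OF assms(1,2)]
  have "convex hull A face_of \<sigma>"
    using face_of_convex_hull_affine_independent[OF v(1)] v(3) assms(3) by metis
  then show "convex hull A \<in> K" using assms(1,2) unfolding simplicial_complex_def by blast
  show "verts (convex hull A) = A"
    using verts_convex_hull affine_dependent_subset[of A "verts \<sigma>"] v(1) assms(3) by blast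
qed

lemma verts_mono:
  assumes "simplicial_complex K" "\<sigma> \<in> K" "\<tau> \<in> K" "\<sigma> \<subseteq> \<tau>"
  shows "verts \<sigma> \<subseteq> verts \<tau>"
proof -
  have "\<sigma> \<inter> \<tau> face_of \<tau>" using assms(1-3) unfolding simplicial_complex_def by (metis Int_commute)
  then have "\<sigma> face_of \<tau>" using assms(4) by (simp add: Int_absorb2)
  then show ?thesis using extreme_point_of_face by (auto simp: verts_def)
qed

lemma verts_inj_on: "simplicial_complex K \<Longrightarrow> inj_on verts K"
  by (metis inj_onI simplicial_complex_verts(3))

lemma verts_nonempty:
  assumes "simplicial_complex K" "\<sigma> \<in> cells K"
  shows "verts \<sigma> \<noteq> {}" "card (verts \<sigma>) > 0"
proof -
  have \<sigma>: "\<sigma> \<in> K" "\<sigma> \<noteq> {}" using assms(2) by (auto simp: cells_def)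
  show "verts \<sigma> \<noteq> {}" using simplicial_complex_verts(3)[OF assms(1) \<sigma>(1)] \<sigma>(2) by auto
  then show "card (verts \<sigma>) > 0"
    using simplicial_complex_verts(2)[OF assms(1) \<sigma>(1)] by (simp add: card_gt_0_iff)
qed

lemma barycenter_verts: "barycenter \<sigma> = (\<Sum>v\<in>verts \<sigma>. (1 / card (verts \<sigma>)) *\<^sub>R v)"
  by (simp add: barycenter_def verts_def scaleR_sum_right divide_inverse)

lemma barycenter_in:
  assumes "simplicial_complex K" "\<sigma> \<in> cells K"
  shows "barycenter \<sigma> \<in> \<sigma>"
proof -
  have \<sigma>: "\<sigma> \<in> K" using assms(2) by (simp add: cells_def)
  note v = simplicial_complex_verts[OF assms(1) \<sigma>] and ne = verts_nonempty[OF assms]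
  have "barycenter \<sigma> \<in> convex hull (verts \<sigma>)"
    unfolding convex_hull_finite[OF v(2)] barycenter_verts using ne
    by (intro CollectI exI[of _ "\<lambda>_. 1 / card (verts \<sigma>)"]) auto
  then show ?thesis using v(3) by simp
qed

lemma affine_independent_coeffs_eq:
  fixes A :: "'a::real_vector set"
  assumes "\<not> affine_dependent A" "finite A" "sum u A = sum c A"
    "(\<Sum>v\<in>A. u v *\<^sub>R v) = (\<Sum>v\<in>A. c v *\<^sub>R v)" "v \<in> A"
  shows "u v = c v"
proof (rule ccontr)
  assume "u v \<noteq> c v"
  then have "\<exists>U. sum U A = 0 \<and> (\<exists>v\<in>A. U v \<noteq> 0) \<and> (\<Sum>v\<in>A. U v *\<^sub>R v) = 0"
    using assms by (intro exI[of _ "\<lambda>v. u v - c v"])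
      (auto simp: sum_subtractf scaleR_left_diff_distrib)
  then show False using assms affine_dependent_explicit_finite by blast
qed

text \<open>The point lies in the common face of the two simplices. Its coordinates there, extended
  by 0, are also its coordinates in each simplex by affine independence.\<close>

lemma simplicial_complex_coords_unique:
  assumes K: "simplicial_complex K" and \<sigma>: "\<sigma> \<in> K" and \<tau>: "\<tau> \<in> K"
    and u: "\<And>v. u v \<ge> 0" "\<And>v. v \<notin> verts \<sigma> \<Longrightarrow> u v = 0" "sum u (verts \<sigma>) = 1"
    and w: "\<And>v. w v \<ge> 0" "\<And>v. v \<notin> verts \<tau> \<Longrightarrow> w v = 0" "sum w (verts \<tau>) = 1"
    and eq: "(\<Sum>v\<in>verts \<sigma>. u v *\<^sub>R v) = (\<Sum>v\<in>verts \<tau>. w v *\<^sub>R v)"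
  shows "u v = w v"
proof -
  let ?x = "\<Sum>v\<in>verts \<sigma>. u v *\<^sub>R v"
  note v\<sigma> = simplicial_complex_verts[OF K \<sigma>] and v\<tau> = simplicial_complex_verts[OF K \<tau>]
  have "?x \<in> convex hull (verts \<sigma>)"
    unfolding convex_hull_finite[OF v\<sigma>(2)] using u by blast
  moreover have "?x \<in> convex hull (verts \<tau>)"
    unfolding convex_hull_finite[OF v\<tau>(2)] eq using w by blast
  ultimately have x: "?x \<in> \<sigma> \<inter> \<tau>" using v\<sigma>(3) v\<tau>(3) by simp
  have f: "\<sigma> \<inter> \<tau> face_of \<sigma>" "\<sigma> \<inter> \<tau> face_of \<tau>"
    using K \<sigma> \<tau> unfolding simplicial_complex_def by (metis, metis Int_commute)
  have \<rho>: "\<sigma> \<inter> \<tau> \<in> K" using K \<sigma> f(1) unfolding simplicial_complex_def by blast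
  note v\<rho> = simplicial_complex_verts[OF K \<rho>]
  have sub: "verts (\<sigma> \<inter> \<tau>) \<subseteq> verts \<sigma>" "verts (\<sigma> \<inter> \<tau>) \<subseteq> verts \<tau>"
    using verts_mono[OF K \<rho>] \<sigma> \<tau> by auto
  have "?x \<in> convex hull verts (\<sigma> \<inter> \<tau>)" using x v\<rho>(3) by simp
  then obtain c where c: "sum c (verts (\<sigma> \<inter> \<tau>)) = 1" "(\<Sum>v\<in>verts (\<sigma> \<inter> \<tau>). c v *\<^sub>R v) = ?x"
    unfolding convex_hull_finite[OF v\<rho>(2)] by auto
  define c' where "c' v = (if v \<in> verts (\<sigma> \<inter> \<tau>) then c v else 0)" for v
  have ext: "sum c' B = 1" "(\<Sum>v\<in>B. c' v *\<^sub>R v) = ?x" if "finite B" "verts (\<sigma> \<inter> \<tau>) \<subseteq> B" for B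
  proof -
    have "sum c' B = sum c (verts (\<sigma> \<inter> \<tau>))"
      by (intro sum.mono_neutral_cong_right that) (auto simp: c'_def)
    then show "sum c' B = 1" using c by simp
    have "(\<Sum>v\<in>B. c' v *\<^sub>R v) = (\<Sum>v\<in>verts (\<sigma> \<inter> \<tau>). c v *\<^sub>R v)"
      by (intro sum.mono_neutral_cong_right that) (auto simp: c'_def)
    then show "(\<Sum>v\<in>B. c' v *\<^sub>R v) = ?x" using c by simp
  qed
  have "u v = c' v"
  proof (cases "v \<in> verts \<sigma>")
    case True
    then show ?thesis
      using affine_independent_coeffs_eq[OF v\<sigma>(1,2), of u c' v] u ext[OF v\<sigma>(2) sub(1)] by simp
  qed (use u sub c'_def in auto)
  moreover have "w v = c' v"
  proof (cases "v \<in> verts \<tau>")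
    case True
    then show ?thesis
      using affine_independent_coeffs_eq[OF v\<tau>(1,2), of w c' v] w ext[OF v\<tau>(2) sub(2)] eq by simp
  qed (use w sub c'_def in auto)
  ultimately show ?thesis by simp
qed

section \<open>Uniqueness of coefficients for chains of sets\<close>

lemma chain_top:
  fixes A :: "'i \<Rightarrow> 'v set"
  assumes "finite F" "F \<noteq> {}" "\<And>i j. i \<in> F \<Longrightarrow> j \<in> F \<Longrightarrow> A i \<subseteq> A j \<or> A j \<subseteq> A i"
  obtains i where "i \<in> F" "\<And>j. j \<in> F \<Longrightarrow> A j \<subseteq> A i"
proof -
  obtain i where "i \<in> F" "\<forall>j\<in>F. A i \<subseteq> A j \<longrightarrow> A i = A j"
    using finite_has_maximal[of "A ` F"] assms by auto
  then show thesis using assms(3) that by (metis order_refl)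
qed

text \<open>The top set properly contains the largest of the others, and a point of the difference
  lies in none of them.\<close>

lemma chain_top_exposed:
  fixes A :: "'i \<Rightarrow> 'v set"
  assumes "finite F" "\<And>i j. i \<in> F \<Longrightarrow> j \<in> F \<Longrightarrow> A i \<subseteq> A j \<or> A j \<subseteq> A i" "inj_on A F"
    and i: "i \<in> F" "\<And>j. j \<in> F \<Longrightarrow> A j \<subseteq> A i" "A i \<noteq> {}"
  obtains v where "v \<in> A i" "\<And>j. j \<in> F \<Longrightarrow> j \<noteq> i \<Longrightarrow> v \<notin> A j"
proof (cases "F - {i} = {}")
  case True
  then show thesis using i that by blast
next
  case False
  then obtain k where k: "k \<in> F - {i}" "\<And>j. j \<in> F - {i} \<Longrightarrow> A j \<subseteq> A k"
    using chain_top[of "F - {i}" A] assms by (metis Diff_iff finite_Diff)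
  have "A k \<noteq> A i" using k(1) assms(3) i by (auto dest: inj_onD)
  moreover have "A k \<subseteq> A i" using k(1) i(2) by blast
  ultimately obtain v where "v \<in> A i" "v \<notin> A k" by blast
  then show thesis using that k(2) by blast
qed

lemma weighted_indicator_sum_pos_iff:
  fixes a :: "'i \<Rightarrow> real"
  assumes "finite F" "\<And>i. i \<in> F \<Longrightarrow> a i > 0"
  shows "(\<Sum>i\<in>F. a i * indicator (A i) v) > 0 \<longleftrightarrow> (\<exists>i\<in>F. v \<in> A i)"
proof
  assume "(\<Sum>i\<in>F. a i * indicator (A i) v) > 0"
  then show "\<exists>i\<in>F. v \<in> A i" by (rule contrapos_pp) (simp add: sum.neutral)
next
  assume "\<exists>i\<in>F. v \<in> A i"
  then obtain i where i: "i \<in> F" "v \<in> A i" by blast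
  then show "(\<Sum>i\<in>F. a i * indicator (A i) v) > 0"
    using assms by (intro sum_pos2[of F i]) (auto simp: less_imp_le)
qed

text \<open>The top set of a chain carries the minimal positive value of the step function as its coefficient;
  hence the chain and its coefficients can be recovered from the step function.\<close>

lemma chain_coeffs_unique:
  fixes A :: "'i \<Rightarrow> 'v set" and a b :: "'i \<Rightarrow> real"
  assumes "finite F" "\<And>i j. i \<in> F \<Longrightarrow> j \<in> F \<Longrightarrow> A i \<subseteq> A j \<or> A j \<subseteq> A i" "\<And>i. i \<in> F \<Longrightarrow> a i > 0"
    and "finite G" "\<And>i j. i \<in> G \<Longrightarrow> j \<in> G \<Longrightarrow> A i \<subseteq> A j \<or> A j \<subseteq> A i" "\<And>i. i \<in> G \<Longrightarrow> b i > 0"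
    and "inj_on A (F \<union> G)" "\<And>i. i \<in> F \<union> G \<Longrightarrow> A i \<noteq> {}"
    and "\<And>v. (\<Sum>i\<in>F. a i * indicator (A i) v) = (\<Sum>i\<in>G. b i * indicator (A i) v)"
  shows "F = G \<and> (\<forall>i\<in>F. a i = b i)"
  using assms
proof (induction "card F" arbitrary: F G)
  case 0
  then have F: "F = {}" by simp
  have "G = {}"
  proof (rule ccontr)
    assume "G \<noteq> {}"
    then obtain i v where iv: "i \<in> G" "v \<in> A i" using "0.prems"(8) by blast
    have "b i * indicator (A i) v \<le> (\<Sum>i\<in>G. b i * indicator (A i) v)"
      using 0 iv(1) by (intro member_le_sum) (auto simp: less_imp_le)
    also have "\<dots> = 0" using "0.prems"(9)[of v] F by simp
    finally show False using iv(2) "0.prems"(6)[OF iv(1)] by simp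
  qed
  then show ?case using F by simp
next
  case (Suc n)
  let ?f = "\<lambda>v. \<Sum>i\<in>F. a i * indicator (A i) v" and ?g = "\<lambda>v. \<Sum>i\<in>G. b i * indicator (A i) v"
  note P = Suc.prems
  have ge: "a i \<le> ?f v" if "i \<in> F" "v \<in> A i" for i v
    using member_le_sum[of i F "\<lambda>i. a i * indicator (A i) v"] that P(1,3) by (auto simp: less_imp_le)
  have ge': "b i \<le> ?g v" if "i \<in> G" "v \<in> A i" for i v
    using member_le_sum[of i G "\<lambda>i. b i * indicator (A i) v"] that P(4,6) by (auto simp: less_imp_le)
  note suppF = weighted_indicator_sum_pos_iff[of F a A, OF P(1,3)]
    and suppG = weighted_indicator_sum_pos_iff[of G b A, OF P(4,6)]
  have "F \<noteq> {}" using Suc.hyps(2) by auto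
  then obtain i where i: "i \<in> F" "\<And>j. j \<in> F \<Longrightarrow> A j \<subseteq> A i" using chain_top[of F A] P(1,2) by metis
  \<comment> \<open>Both step functions are positive exactly on the union of their chain, which is
    its top set; so the two top sets agree.\<close>
  have supp: "(\<exists>j\<in>G. v \<in> A j) \<longleftrightarrow> v \<in> A i" for v
    using suppF[of v] suppG[of v] i unfolding P(9) by auto
  have "G \<noteq> {}" using supp P(8)[of i] i(1) by blast
  then obtain j where j: "j \<in> G" "\<And>k. k \<in> G \<Longrightarrow> A k \<subseteq> A j" using chain_top[of G A] P(4,5) by metis
  have "A i = A j" using supp j by blast
  then have [simp]: "j = i" using P(7) i(1) j(1) by (auto dest: inj_onD)
  have injF: "inj_on A F" and injG: "inj_on A G" using P(7) by (auto simp: inj_on_Un)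
  \<comment> \<open>At a point of the top set outside all other sets of \<open>F\<close>, the step
    function equals \<open>a i\<close>, while the other representation shows that it is at least
    \<open>b i\<close>. Exchanging the roles gives equality, and the top set can be removed.\<close>
  obtain v where v: "v \<in> A i" "\<And>j. j \<in> F \<Longrightarrow> j \<noteq> i \<Longrightarrow> v \<notin> A j"
    using chain_top_exposed[OF P(1,2) injF i] P(8) i(1) by blast
  have "?f v = (\<Sum>j\<in>F. if j = i then a i else 0)" by (intro sum.cong) (use v in auto)
  also have "\<dots> = a i" using P(1) i(1) by simp
  finally have ba: "b i \<le> a i" using ge'[OF j(1), of v] v(1) unfolding P(9)[symmetric] by simp
  obtain w where w: "w \<in> A j" "\<And>k. k \<in> G \<Longrightarrow> k \<noteq> j \<Longrightarrow> w \<notin> A k"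
    using chain_top_exposed[OF P(4,5) injG j] P(8) j(1) by blast
  have "?g w = (\<Sum>k\<in>G. if k = i then b i else 0)" by (intro sum.cong) (use w in auto)
  also have "\<dots> = b i" using P(4) j(1) by simp
  finally have "a i \<le> b i" using ge[OF i(1), of w] w(1) unfolding P(9) by simp
  then have ab: "a i = b i" using ba by simp
  have "F - {i} = G - {i} \<and> (\<forall>k\<in>F - {i}. a k = b k)"
  proof (rule Suc.hyps(1))
    show "n = card (F - {i})" using Suc.hyps(2) P(1) i(1) by simp
    show "inj_on A (F - {i} \<union> (G - {i}))" using P(7) by (rule inj_on_subset) auto
    fix v
    show "(\<Sum>i\<in>F - {i}. a i * indicator (A i) v) = (\<Sum>i\<in>G - {i}. b i * indicator (A i) v)"
      using P(9)[of v] unfolding sum.remove[OF P(1) i(1)] sum.remove[OF P(4) j(1)]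
      by (simp only: ab \<open>j = i\<close> add_left_cancel)
  qed (use P in auto)
  then show ?case using i(1) j(1) ab by auto
qed

section \<open>Flags and the subdivided complex\<close>

definition flag :: "'w::euclidean_space set set \<Rightarrow> 'w set set \<Rightarrow> bool" where
  "flag K F \<longleftrightarrow> finite F \<and> F \<subseteq> cells K \<and> (\<forall>\<sigma>\<in>F. \<forall>\<tau>\<in>F. \<sigma> \<subseteq> \<tau> \<or> \<tau> \<subseteq> \<sigma>)"

lemma sd_flags: "sd K = (\<lambda>F. convex hull (barycenter ` F)) ` {F. flag K F}"
  by (auto simp: sd_def flag_def)

lemma flag_subset: "flag K F \<Longrightarrow> G \<subseteq> F \<Longrightarrow> flag K G"
  unfolding flag_def by (meson finite_subset subset_iff)

context
  fixes K :: "'w::euclidean_space set set"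
  assumes K: "simplicial_complex K"
begin

lemma flag_verts_chain:
  assumes "flag K F" "\<sigma> \<in> F" "\<tau> \<in> F"
  shows "verts \<sigma> \<subseteq> verts \<tau> \<or> verts \<tau> \<subseteq> verts \<sigma>"
  using assms verts_mono[OF K] unfolding flag_def cells_def by (metis (no_types, lifting) mem_Collect_eq subset_iff)

text \<open>Expanding each barycenter into vertices gives vertex coordinates \<open>u\<close> that
  form a step function on the chain of vertex sets, the situation of
  \<open>chain_coeffs_unique\<close>; \<tau> is the top cell of the flag.\<close>

lemma flag_coords:
  fixes c :: "'w set \<Rightarrow> real"
  assumes F: "flag K F" and c: "\<And>\<sigma>. c \<sigma> \<ge> 0" "sum c F = 1"
  defines "u \<equiv> \<lambda>v. \<Sum>\<sigma>\<in>F. c \<sigma> / card (verts \<sigma>) * indicator (verts \<sigma>) v"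
  obtains \<tau> where "\<tau> \<in> K" "\<And>v. u v \<ge> 0" "\<And>v. v \<notin> verts \<tau> \<Longrightarrow> u v = 0" "sum u (verts \<tau>) = 1"
    "(\<Sum>\<sigma>\<in>F. c \<sigma> *\<^sub>R barycenter \<sigma>) = (\<Sum>v\<in>verts \<tau>. u v *\<^sub>R v)"
proof -
  have fin: "finite F" "F \<subseteq> cells K" using F by (auto simp: flag_def)
  have "F \<noteq> {}" using c(2) by auto
  then obtain \<tau> where \<tau>: "\<tau> \<in> F" "\<And>\<sigma>. \<sigma> \<in> F \<Longrightarrow> verts \<sigma> \<subseteq> verts \<tau>"
    using chain_top[of F verts] fin(1) flag_verts_chain[OF F] by metis
  have \<tau>K: "\<tau> \<in> K" using \<tau> fin by (auto simp: cells_def)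
  note v\<tau> = simplicial_complex_verts[OF K \<tau>K]
  have ind: "(\<Sum>v\<in>verts \<tau>. indicator (verts \<sigma>) v) = real (card (verts \<sigma>))" if "\<sigma> \<in> F" for \<sigma>
    using \<tau>(2)[OF that] v\<tau>(2) by (simp add: indicator_def of_bool_def sum.If_cases Int_absorb1)
  have pos: "card (verts \<sigma>) > 0" if "\<sigma> \<in> F" for \<sigma>
    using verts_nonempty[OF K] that fin by blast
  show thesis
  proof (rule that[OF \<tau>K])
    show "u v \<ge> 0" for v unfolding u_def using c by (intro sum_nonneg mult_nonneg_nonneg) auto
    show "u v = 0" if "v \<notin> verts \<tau>" for v unfolding u_def
      using \<tau>(2) that by (intro sum.neutral) (auto simp: indicator_def)
    have "sum u (verts \<tau>) = (\<Sum>\<sigma>\<in>F. \<Sum>v\<in>verts \<tau>. c \<sigma> / card (verts \<sigma>) * indicator (verts \<sigma>) v)"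
      unfolding u_def by (rule sum.swap)
    also have "\<dots> = (\<Sum>\<sigma>\<in>F. c \<sigma>)"
      by (intro sum.cong refl, subst sum_distrib_left[symmetric]) (use ind pos in auto)
    finally show "sum u (verts \<tau>) = 1" using c by simp
    have "(\<Sum>v\<in>verts \<tau>. u v *\<^sub>R v) = (\<Sum>\<sigma>\<in>F. \<Sum>v\<in>verts \<tau>. (c \<sigma> / card (verts \<sigma>) * indicator (verts \<sigma>) v) *\<^sub>R v)"
      unfolding u_def scaleR_sum_left by (rule sum.swap)
    also have "\<dots> = (\<Sum>\<sigma>\<in>F. c \<sigma> *\<^sub>R barycenter \<sigma>)"
    proof (intro sum.cong refl)
      fix \<sigma> assume \<sigma>: "\<sigma> \<in> F"
      have "(\<Sum>v\<in>verts \<tau>. (c \<sigma> / card (verts \<sigma>) * indicator (verts \<sigma>) v) *\<^sub>R v)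
          = (\<Sum>v\<in>verts \<sigma>. (c \<sigma> / card (verts \<sigma>)) *\<^sub>R v)"
        using v\<tau>(2) \<tau>(2)[OF \<sigma>] by (intro sum.mono_neutral_cong_right) auto
      then show "(\<Sum>v\<in>verts \<tau>. (c \<sigma> / card (verts \<sigma>) * indicator (verts \<sigma>) v) *\<^sub>R v) = c \<sigma> *\<^sub>R barycenter \<sigma>"
        by (simp add: barycenter_verts scaleR_sum_right)
    qed
    finally show "(\<Sum>\<sigma>\<in>F. c \<sigma> *\<^sub>R barycenter \<sigma>) = (\<Sum>v\<in>verts \<tau>. u v *\<^sub>R v)" by simp
  qed
qed

text \<open>Both combinations have the same vertex coordinates, from which the cells with positive
  coefficients and these coefficients are recovered. The two flags may differ: so this yields affine
  independence within a flag as well as the intersection of two simplices.\<close>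

lemma flag_coeffs_unique:
  fixes c d :: "'w set \<Rightarrow> real"
  assumes F: "flag K F" and c: "\<And>\<sigma>. c \<sigma> \<ge> 0" "\<And>\<sigma>. \<sigma> \<notin> F \<Longrightarrow> c \<sigma> = 0" "sum c F = 1"
    and G: "flag K G" and d: "\<And>\<sigma>. d \<sigma> \<ge> 0" "\<And>\<sigma>. \<sigma> \<notin> G \<Longrightarrow> d \<sigma> = 0" "sum d G = 1"
    and eq: "(\<Sum>\<sigma>\<in>F. c \<sigma> *\<^sub>R barycenter \<sigma>) = (\<Sum>\<sigma>\<in>G. d \<sigma> *\<^sub>R barycenter \<sigma>)"
  shows "c = d"
proof -
  let ?a = "\<lambda>\<sigma>. c \<sigma> / card (verts \<sigma>)" and ?b = "\<lambda>\<sigma>. d \<sigma> / card (verts \<sigma>)"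
  let ?F = "{\<sigma> \<in> F. c \<sigma> > 0}" and ?G = "{\<sigma> \<in> G. d \<sigma> > 0}"
  have fin: "finite F" "F \<subseteq> cells K" "finite G" "G \<subseteq> cells K" using F G by (auto simp: flag_def)
  have E: "(\<Sum>\<sigma>\<in>F. ?a \<sigma> * indicator (verts \<sigma>) v) = (\<Sum>\<sigma>\<in>G. ?b \<sigma> * indicator (verts \<sigma>) v)" for v
  proof -
    let ?u = "\<lambda>v. \<Sum>\<sigma>\<in>F. ?a \<sigma> * indicator (verts \<sigma>) v" and ?w = "\<lambda>v. \<Sum>\<sigma>\<in>G. ?b \<sigma> * indicator (verts \<sigma>) v"
    obtain \<sigma> where \<sigma>: "\<sigma> \<in> K" "\<And>v. ?u v \<ge> 0" "\<And>v. v \<notin> verts \<sigma> \<Longrightarrow> ?u v = 0" "sum ?u (verts \<sigma>) = 1"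
        "(\<Sum>\<sigma>\<in>F. c \<sigma> *\<^sub>R barycenter \<sigma>) = (\<Sum>v\<in>verts \<sigma>. ?u v *\<^sub>R v)"
      using flag_coords[OF F c(1,3)] by blast
    obtain \<tau> where \<tau>: "\<tau> \<in> K" "\<And>v. ?w v \<ge> 0" "\<And>v. v \<notin> verts \<tau> \<Longrightarrow> ?w v = 0" "sum ?w (verts \<tau>) = 1"
        "(\<Sum>\<sigma>\<in>G. d \<sigma> *\<^sub>R barycenter \<sigma>) = (\<Sum>v\<in>verts \<tau>. ?w v *\<^sub>R v)"
      using flag_coords[OF G d(1,3)] by blast
    show ?thesis
      by (rule simplicial_complex_coords_unique[OF K \<sigma>(1) \<tau>(1) \<sigma>(2-4) \<tau>(2-4)], assumption, assumption)
        (rule trans[OF trans[OF \<sigma>(5)[symmetric] eq] \<tau>(5)])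
  qed
  have pos: "card (verts \<sigma>) > 0" "verts \<sigma> \<noteq> {}" if "\<sigma> \<in> F \<union> G" for \<sigma>
    using verts_nonempty[OF K] that fin by blast+
  have "?F = ?G \<and> (\<forall>\<sigma>\<in>?F. ?a \<sigma> = ?b \<sigma>)"
  proof (rule chain_coeffs_unique[where A = verts])
    show "inj_on verts (?F \<union> ?G)"
      using verts_inj_on[OF K] by (rule inj_on_subset) (use fin in \<open>auto simp: cells_def\<close>)
    show "(\<Sum>\<sigma>\<in>?F. ?a \<sigma> * indicator (verts \<sigma>) v) = (\<Sum>\<sigma>\<in>?G. ?b \<sigma> * indicator (verts \<sigma>) v)" for v
    proof -
      have "(\<Sum>\<sigma>\<in>?F. ?a \<sigma> * indicator (verts \<sigma>) v) = (\<Sum>\<sigma>\<in>F. ?a \<sigma> * indicator (verts \<sigma>) v)"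
        by (rule sum.mono_neutral_left[OF fin(1)]) (use c(1) in \<open>auto simp: not_less order_antisym\<close>)
      moreover have "(\<Sum>\<sigma>\<in>?G. ?b \<sigma> * indicator (verts \<sigma>) v) = (\<Sum>\<sigma>\<in>G. ?b \<sigma> * indicator (verts \<sigma>) v)"
        by (rule sum.mono_neutral_left[OF fin(3)]) (use d(1) in \<open>auto simp: not_less order_antisym\<close>)
      ultimately show ?thesis using E by simp
    qed
  qed (use fin pos flag_verts_chain[OF F] flag_verts_chain[OF G] in auto)
  then have FG: "?F = ?G" "\<And>\<sigma>. \<sigma> \<in> ?F \<Longrightarrow> ?a \<sigma> = ?b \<sigma>" by auto
  show "c = d"
  proof
    fix \<sigma>
    show "c \<sigma> = d \<sigma>"
    proof (cases "\<sigma> \<in> ?F")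
      case True
      then show ?thesis using FG(2)[OF True] pos[of \<sigma>] by auto
    next
      case False
      then have "\<sigma> \<notin> ?G" using FG by simp
      then show ?thesis using False c(1)[of \<sigma>] c(2)[of \<sigma>] d(1)[of \<sigma>] d(2)[of \<sigma>] by (auto simp: not_less)
    qed
  qed
qed

lemma barycenter_inj_on: "inj_on barycenter (cells K)"
proof (rule inj_onI)
  fix \<sigma> \<tau> assume \<sigma>: "\<sigma> \<in> cells K" and \<tau>: "\<tau> \<in> cells K" and eq: "barycenter \<sigma> = barycenter \<tau>"
  have "flag K {\<sigma>}" "flag K {\<tau>}" using \<sigma> \<tau> by (auto simp: flag_def)
  then have "(\<lambda>\<rho>. indicator {\<sigma>} \<rho> :: real) = indicator {\<tau>}"
    using eq by (intro flag_coeffs_unique[of "{\<sigma>}" _ "{\<tau>}"]) auto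
  then show "\<sigma> = \<tau>" by (metis indicator_simps singletonD singletonI zero_neq_one)
qed

lemma flag_barycenter_inj_on: "flag K F \<Longrightarrow> inj_on barycenter F"
  using barycenter_inj_on inj_on_subset by (auto simp: flag_def)

lemma in_hull_barycenters:
  assumes "flag K F" "x \<in> convex hull (barycenter ` F)"
  obtains c :: "'w set \<Rightarrow> real" where "\<And>\<sigma>. c \<sigma> \<ge> 0" "\<And>\<sigma>. \<sigma> \<notin> F \<Longrightarrow> c \<sigma> = 0" "sum c F = 1"
    "(\<Sum>\<sigma>\<in>F. c \<sigma> *\<^sub>R barycenter \<sigma>) = x"
proof -
  have fin: "finite F" and inj: "inj_on barycenter F"
    using assms flag_barycenter_inj_on by (auto simp: flag_def)
  obtain u where u: "\<And>y. y \<in> barycenter ` F \<Longrightarrow> 0 \<le> u y" "sum u (barycenter ` F) = 1"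
      "(\<Sum>y\<in>barycenter ` F. u y *\<^sub>R y) = x"
    using assms(2) fin by (auto simp: convex_hull_finite)
  show thesis
  proof (rule that[of "\<lambda>\<sigma>. if \<sigma> \<in> F then u (barycenter \<sigma>) else 0"])
    show "(\<Sum>\<sigma>\<in>F. if \<sigma> \<in> F then u (barycenter \<sigma>) else 0) = 1"
      using u(2) by (simp add: sum.reindex[OF inj])
    show "(\<Sum>\<sigma>\<in>F. (if \<sigma> \<in> F then u (barycenter \<sigma>) else 0) *\<^sub>R barycenter \<sigma>) = x"
      using u(3) by (simp add: sum.reindex[OF inj])
  qed (use u(1) in auto)
qed

text \<open>\<open>flag_coeffs_unique\<close> compares convex combinations, so an affine dependence
  is split into its positive and negative parts. They have the same total \<open>P > 0\<close>, and
  division by \<open>P\<close> gives two convex combinations of the same point.\<close>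

lemma flag_barycenters_affine_independent:
  assumes F: "flag K F"
  shows "\<not> affine_dependent (barycenter ` F)"
proof
  assume dep: "affine_dependent (barycenter ` F)"
  have fin: "finite F" and inj: "inj_on barycenter F"
    using F flag_barycenter_inj_on by (auto simp: flag_def)
  obtain U where U: "sum U (barycenter ` F) = 0" "\<exists>v\<in>barycenter ` F. U v \<noteq> 0"
     "(\<Sum>v\<in>barycenter ` F. U v *\<^sub>R v) = 0"
    using dep affine_dependent_explicit_finite[of "barycenter ` F"] fin by auto
  define u where "u \<sigma> = U (barycenter \<sigma>)" for \<sigma>
  have u: "sum u F = 0" "\<exists>\<sigma>\<in>F. u \<sigma> \<noteq> 0" "(\<Sum>\<sigma>\<in>F. u \<sigma> *\<^sub>R barycenter \<sigma>) = 0"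
    using U by (auto simp: sum.reindex[OF inj] u_def)
  define P where "P = (\<Sum>\<sigma>\<in>F. max 0 (u \<sigma>))"
  have parts: "u \<sigma> = max 0 (u \<sigma>) - max 0 (- u \<sigma>)" for \<sigma> by auto
  have P': "P = (\<Sum>\<sigma>\<in>F. max 0 (- u \<sigma>))"
    using u(1) unfolding P_def by (subst (asm) sum.cong[OF refl parts]) (simp add: sum_subtractf)
  have "P \<noteq> 0"
  proof
    assume "P = 0"
    then have "\<forall>\<sigma>\<in>F. max 0 (u \<sigma>) = 0" "\<forall>\<sigma>\<in>F. max 0 (- u \<sigma>) = 0"
      using P' fin unfolding P_def by (auto simp: sum_nonneg_eq_0_iff)
    then show False using u(2) by (metis diff_0_right parts)
  qed
  then have P: "P > 0" using sum_nonneg[of F "\<lambda>\<sigma>. max 0 (u \<sigma>)"] by (simp add: P_def)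
  let ?c = "\<lambda>\<sigma>. if \<sigma> \<in> F then max 0 (u \<sigma>) / P else 0" and ?d = "\<lambda>\<sigma>. if \<sigma> \<in> F then max 0 (- u \<sigma>) / P else 0"
  have "?c = ?d"
  proof (rule flag_coeffs_unique[OF F _ _ _ F])
    show "sum ?c F = 1" using P by (simp add: sum_divide_distrib[symmetric] P_def[symmetric])
    show "sum ?d F = 1" using P by (simp add: sum_divide_distrib[symmetric] P'[symmetric])
    have "(\<Sum>\<sigma>\<in>F. ?c \<sigma> *\<^sub>R barycenter \<sigma>) - (\<Sum>\<sigma>\<in>F. ?d \<sigma> *\<^sub>R barycenter \<sigma>) = (\<Sum>\<sigma>\<in>F. (1 / P) *\<^sub>R (u \<sigma> *\<^sub>R barycenter \<sigma>))"
      unfolding sum_subtractf[symmetric]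
      by (intro sum.cong refl) (auto simp: max_def scaleR_left_diff_distrib[symmetric] diff_divide_distrib[symmetric])
    also have "\<dots> = 0" unfolding scaleR_sum_right[symmetric] u(3) by simp
    finally show "(\<Sum>\<sigma>\<in>F. ?c \<sigma> *\<^sub>R barycenter \<sigma>) = (\<Sum>\<sigma>\<in>F. ?d \<sigma> *\<^sub>R barycenter \<sigma>)" by simp
  qed (use P in auto)
  then have "max 0 (u \<sigma>) = max 0 (- u \<sigma>)" if "\<sigma> \<in> F" for \<sigma>
    using fun_cong[of ?c ?d \<sigma>] that P by simp
  then show False using u(2) by (metis diff_self parts)
qed

text \<open>The coefficients of a common point with respect to \<open>F\<close> and to
  \<open>G\<close> coincide, hence vanish outside \<open>F \<inter> G\<close>.\<close>

lemma hull_barycenters_Int: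
  assumes F: "flag K F" and G: "flag K G"
  shows "convex hull (barycenter ` F) \<inter> convex hull (barycenter ` G) = convex hull (barycenter ` (F \<inter> G))"
proof
  show "convex hull (barycenter ` F) \<inter> convex hull (barycenter ` G) \<subseteq> convex hull (barycenter ` (F \<inter> G))"
  proof
    fix x assume x: "x \<in> convex hull (barycenter ` F) \<inter> convex hull (barycenter ` G)"
    obtain c where c: "\<And>\<sigma>. c \<sigma> \<ge> 0" "\<And>\<sigma>. \<sigma> \<notin> F \<Longrightarrow> c \<sigma> = 0" "sum c F = 1" "(\<Sum>\<sigma>\<in>F. c \<sigma> *\<^sub>R barycenter \<sigma>) = x"
      using in_hull_barycenters[OF F] x by blast
    obtain d where d: "\<And>\<sigma>. d \<sigma> \<ge> 0" "\<And>\<sigma>. \<sigma> \<notin> G \<Longrightarrow> d \<sigma> = 0" "sum d G = 1" "(\<Sum>\<sigma>\<in>G. d \<sigma> *\<^sub>R barycenter \<sigma>) = x"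
      using in_hull_barycenters[OF G] x by blast
    have cd: "c = d" by (rule flag_coeffs_unique[OF F c(1-3) G d(1-3)]) (use c d in auto)
    have fin: "finite F" using F by (simp add: flag_def)
    have "(\<Sum>\<sigma>\<in>F \<inter> G. c \<sigma>) = 1" "(\<Sum>\<sigma>\<in>F \<inter> G. c \<sigma> *\<^sub>R barycenter \<sigma>) = x"
      using c(3,4) d(2) cd fin by (auto simp: sum.mono_neutral_left[of F "F \<inter> G"])
    then show "x \<in> convex hull (barycenter ` (F \<inter> G))"
      using fin c(1) convex_sum[of "F \<inter> G" "convex hull (barycenter ` (F \<inter> G))" c barycenter]
      by (auto simp: hull_inc)
  qed
qed (intro Int_greatest hull_mono image_mono; auto)

text \<open>This makes the properties in \<open>subdivision_construction\<close> available at every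
  step of the iteration.\<close>

lemma simplicial_complex_sd: "simplicial_complex (sd K)"
  unfolding simplicial_complex_def
proof (intro conjI ballI allI impI)
  have "finite (cells K)" using K by (auto simp: cells_def simplicial_complex_def)
  then have "finite {F. flag K F}"
    by (rule finite_subset[rotated, OF finite_Pow_iff[THEN iffD2]]) (auto simp: flag_def)
  then show "finite (sd K)" unfolding sd_flags by simp
next
  fix S assume "S \<in> sd K"
  then obtain F where F: "flag K F" "S = convex hull (barycenter ` F)" by (auto simp: sd_flags)
  then show "\<exists>n. n simplex S"
    unfolding simplex_def using flag_barycenters_affine_independent[OF F(1)]
    by (intro exI[of _ "int (card (barycenter ` F)) - 1"] exI[of _ "barycenter ` F"]) auto
next
  fix T S assume "S \<in> sd K \<and> T face_of S"
  then obtain F where F: "flag K F" "T face_of convex hull (barycenter ` F)" by (auto simp: sd_flags)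
  then obtain C where "C \<subseteq> barycenter ` F" "T = convex hull C"
    using face_of_convex_hull_affine_independent[OF flag_barycenters_affine_independent[OF F(1)]] by blast
  then obtain G where "G \<subseteq> F" "T = convex hull (barycenter ` G)" by (auto simp: subset_image_iff)
  then show "T \<in> sd K" using flag_subset[OF F(1)] by (auto simp: sd_flags)
next
  fix S T assume "S \<in> sd K \<and> T \<in> sd K"
  then obtain F G where F: "flag K F" "S = convex hull (barycenter ` F)" and G: "flag K G" "T = convex hull (barycenter ` G)"
    by (auto simp: sd_flags)
  have "convex hull (barycenter ` (F \<inter> G)) face_of convex hull (barycenter ` F)"
    unfolding face_of_convex_hull_affine_independent[OF flag_barycenters_affine_independent[OF F(1)]]
    by (intro exI[of _ "barycenter ` (F \<inter> G)"]) auto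
  then show "S \<inter> T face_of S" using F G hull_barycenters_Int[OF F(1) G(1)] by simp
qed

section \<open>Flags of full length through a given point\<close>

text \<open>Splitting off the minimal barycentric coordinate writes \<open>x\<close> as a convex combination of the
  barycenter and a point of the opposite facet.\<close>

lemma full_flag_through_point:
  assumes \<sigma>: "\<sigma> \<in> K" and "A \<subseteq> verts \<sigma>" "A \<noteq> {}" "x \<in> convex hull A"
  shows "\<exists>F. flag K F \<and> (\<forall>\<rho>\<in>F. \<rho> \<subseteq> convex hull A) \<and> card F = card A \<and> x \<in> convex hull (barycenter ` F)"
  using assms(2-)
proof (induction "card A" arbitrary: A x rule: less_induct)
  case less
  note v\<sigma> = simplicial_complex_verts[OF K \<sigma>]
  have fin: "finite A" using less.prems v\<sigma>(2) finite_subset by blast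
  note hA = simplicial_complex_hull_subset[OF K \<sigma> less.prems(1)]
  have cellA: "convex hull A \<in> cells K" using hA less.prems by (simp add: cells_def)
  have bA: "barycenter (convex hull A) = (\<Sum>v\<in>A. (1 / card A) *\<^sub>R v)"
    by (simp add: barycenter_verts hA(2))
  have cA: "real (card A) > 0" using fin less.prems by (simp add: card_gt_0_iff)
  obtain u where u: "\<And>v. v \<in> A \<Longrightarrow> u v \<ge> 0" "sum u A = 1" "(\<Sum>v\<in>A. u v *\<^sub>R v) = x"
    using less.prems(3) fin by (auto simp: convex_hull_finite)
  obtain v where v: "v \<in> A" "\<And>w. w \<in> A \<Longrightarrow> u v \<le> u w"
    using fin less.prems(2) by (metis arg_min_if_finite(1) arg_min_least)
  show ?case
  proof (cases "A - {v} = {}")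
    case True
    then have A: "A = {v}" using v(1) by blast
    show ?thesis
      using cellA bA less.prems(3) by (intro exI[of _ "{convex hull A}"]) (auto simp: flag_def A)
  next
    case False
    let ?B = "A - {v}" and ?m = "u v" and ?n = "real (card A)"
    \<comment> \<open>The term of \<open>v\<close> vanishes, so the sum may be taken over all of
      \<open>A\<close>; as \<open>?m\<close> is the minimal coordinate, the total is
      non-negative.\<close>
    have sum0: "(\<Sum>w\<in>?B. u w - ?m) = 1 - ?n * ?m"
    proof -
      have "(\<Sum>w\<in>?B. u w - ?m) = (\<Sum>w\<in>A. u w - ?m)"
        using fin by (intro sum.mono_neutral_left) auto
      then show ?thesis using u(2) by (simp add: sum_subtractf)
    qed
    have le: "?n * ?m \<le> 1" using sum0 v by (smt (verit) Diff_iff sum_nonneg)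
    have x: "x = (?n * ?m) *\<^sub>R barycenter (convex hull A) + (\<Sum>w\<in>?B. (u w - ?m) *\<^sub>R w)"
    proof -
      have "(\<Sum>w\<in>?B. (u w - ?m) *\<^sub>R w) = (\<Sum>w\<in>A. (u w - ?m) *\<^sub>R w)"
        using fin by (intro sum.mono_neutral_left) auto
      also have "\<dots> = x - ?m *\<^sub>R \<Sum>A"
        using u(3) by (simp add: scaleR_left_diff_distrib sum_subtractf scaleR_sum_right)
      finally show ?thesis using cA by (simp add: bA scaleR_sum_right[symmetric])
    qed
    \<comment> \<open>If \<open>?n * ?m = 1\<close>, all coordinates are equal, \<open>x\<close> is
      the barycenter, the remainder has weight 0 and any vertex of the facet serves as
      \<open>y\<close>. Otherwise the remainder is normalized.\<close>
    obtain y where y: "y \<in> convex hull ?B" "(\<Sum>w\<in>?B. (u w - ?m) *\<^sub>R w) = (1 - ?n * ?m) *\<^sub>R y"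
    proof (cases "?n * ?m = 1")
      case True
      then have "\<forall>w\<in>?B. u w - ?m = 0" using sum0 v fin sum_nonneg_eq_0_iff[of ?B "\<lambda>w. u w - ?m"] by simp
      moreover obtain w where "w \<in> ?B" using False by blast
      ultimately show ?thesis using that[of w] True by (simp add: hull_inc)
    next
      case False
      show ?thesis
      proof (rule that[of "\<Sum>w\<in>?B. ((u w - ?m) / (1 - ?n * ?m)) *\<^sub>R w"])
        show "(\<Sum>w\<in>?B. ((u w - ?m) / (1 - ?n * ?m)) *\<^sub>R w) \<in> convex hull ?B"
          using fin False le sum0 v
          by (subst convex_hull_finite) (auto intro!: exI[of _ "\<lambda>w. (u w - ?m) / (1 - ?n * ?m)"] simp: sum_divide_distrib[symmetric])
        show "(\<Sum>w\<in>?B. (u w - ?m) *\<^sub>R w) = (1 - ?n * ?m) *\<^sub>R (\<Sum>w\<in>?B. ((u w - ?m) / (1 - ?n * ?m)) *\<^sub>R w)"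
          using False by (simp add: scaleR_sum_right)
      qed
    qed
    have "card ?B < card A" using fin v(1) by (rule card_Diff1_less)
    from less.hyps[OF this _ False y(1)] less.prems(1)
    obtain F where F: "flag K F" "\<And>\<rho>. \<rho> \<in> F \<Longrightarrow> \<rho> \<subseteq> convex hull ?B" "card F = card ?B" "y \<in> convex hull (barycenter ` F)"
      by blast
    have sub: "convex hull ?B \<subseteq> convex hull A" by (intro hull_mono) auto
    \<comment> \<open>Otherwise \<open>v\<close> would be a vertex of the opposite facet. So the new
      cell raises the number of cells by one.\<close>
    have notin: "convex hull A \<notin> F"
    proof
      assume "convex hull A \<in> F"
      then have "convex hull A \<subseteq> convex hull ?B" by (rule F(2))
      moreover have B: "?B \<subseteq> verts \<sigma>" using less.prems(1) by auto
      ultimately have "A \<subseteq> ?B"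
        using verts_mono[OF K hA(1) simplicial_complex_hull_subset(1)[OF K \<sigma> B]]
          hA(2) simplicial_complex_hull_subset(2)[OF K \<sigma> B] by simp
      then show False using v(1) by blast
    qed
    show ?thesis
    proof (intro exI[of _ "insert (convex hull A) F"] conjI)
      show "flag K (insert (convex hull A) F)"
        using F(1,2) sub cellA unfolding flag_def by blast
      show "\<forall>\<rho>\<in>insert (convex hull A) F. \<rho> \<subseteq> convex hull A" using F(2) sub by blast
      have "finite F" using F(1) by (simp add: flag_def)
      then show "card (insert (convex hull A) F) = card A"
        using notin F(3) card_Suc_Diff1[OF fin v(1)] by simp
      have "barycenter (convex hull A) \<in> convex hull (barycenter ` insert (convex hull A) F)"
        by (intro hull_inc) simp
      moreover have "y \<in> convex hull (barycenter ` insert (convex hull A) F)"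
        using F(4) hull_mono[of "barycenter ` F" "barycenter ` insert (convex hull A) F"] by blast
      moreover have "0 \<le> ?n * ?m" using u(1)[OF v(1)] by simp
      ultimately show "x \<in> convex hull (barycenter ` insert (convex hull A) F)"
        unfolding x y(2) using le by (intro convexD[OF convex_convex_hull]) auto
    qed
  qed
qed

text \<open>A flag with as many cells as \<sigma> has vertices spans a simplex of the dimension of
  \<sigma>. This provides a valid choice of a cell that contains a prescribed point.\<close>

lemma sd_cell_through_point:
  assumes \<sigma>: "\<sigma> \<in> cells K" and x: "x \<in> \<sigma>"
  obtains \<rho> where "\<rho> \<in> cells (sd K)" "aff_dim \<rho> = aff_dim \<sigma>" "\<rho> \<subseteq> \<sigma>" "x \<in> \<rho>"
proof -
  have \<sigma>K: "\<sigma> \<in> K" using \<sigma> by (simp add: cells_def)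
  note v\<sigma> = simplicial_complex_verts[OF K \<sigma>K]
  obtain F where F: "flag K F" "\<And>\<rho>. \<rho> \<in> F \<Longrightarrow> \<rho> \<subseteq> \<sigma>" "card F = card (verts \<sigma>)" "x \<in> convex hull (barycenter ` F)"
    using full_flag_through_point[OF \<sigma>K order_refl verts_nonempty(1)[OF K \<sigma>], of x] x v\<sigma>(3) by auto
  let ?\<rho> = "convex hull (barycenter ` F)"
  have "aff_dim ?\<rho> = int (card (barycenter ` F)) - 1"
    using flag_barycenters_affine_independent[OF F(1)]
    by (simp add: aff_dim_convex_hull affine_independent_iff_card)
  also have "\<dots> = int (card (verts \<sigma>)) - 1"
    using F(3) flag_barycenter_inj_on[OF F(1)] by (simp add: card_image)
  also have "\<dots> = aff_dim \<sigma>"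
    using v\<sigma>(1) by (subst v\<sigma>(3)[symmetric]) (simp add: aff_dim_convex_hull affine_independent_iff_card)
  finally have dim: "aff_dim ?\<rho> = aff_dim \<sigma>" .
  have "barycenter ` F \<subseteq> \<sigma>"
    using F(1,2) barycenter_in[OF K] by (fastforce simp: flag_def)
  moreover have "convex \<sigma>" by (subst v\<sigma>(3)[symmetric]) simp
  ultimately have "?\<rho> \<subseteq> \<sigma>" by (rule hull_minimal)
  moreover have "?\<rho> \<in> cells (sd K)" using F(1,4) by (auto simp: cells_def sd_flags)
  ultimately show thesis using that dim F(4) by blast
qed

end

section \<open>Mesh of the subdivisions\<close>

lemma dist_hull_le:
  fixes S :: "'a::real_normed_vector set"
  assumes "\<And>p q. p \<in> S \<Longrightarrow> q \<in> S \<Longrightarrow> dist p q \<le> r" "x \<in> convex hull S" "y \<in> convex hull S"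
  shows "dist x y \<le> r"
proof -
  have 1: "convex hull S \<subseteq> cball p r" if "p \<in> S" for p
    using assms(1) that by (intro hull_minimal convex_cball) auto
  \<comment> \<open>Convexity of balls is used twice: the balls around points of \<open>S\<close>
    contain the hull, so the ball around any point of the hull contains \<open>S\<close> and then
    the hull.\<close>
  have "convex hull S \<subseteq> cball y r"
    using 1 assms(3) by (intro hull_minimal convex_cball) (auto simp: dist_commute subset_iff)
  then show ?thesis using assms(2) by (auto simp: dist_commute)
qed

definition mesh_le :: "'w::euclidean_space set set \<Rightarrow> real \<Rightarrow> bool" where
  "mesh_le K r \<longleftrightarrow> (\<forall>\<sigma>\<in>K. \<forall>x\<in>\<sigma>. \<forall>y\<in>\<sigma>. dist x y \<le> r)"

text \<open>The barycenter minus a vertex \<open>v\<close> is the average of the differences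
  \<open>w - v\<close> over \<open>m\<close> vertices, of which one is 0; this gives the factor
  \<open>1 - 1 / m\<close>. The dimension of the ambient space bounds \<open>m\<close> and so yields
  the same factor at every iteration.\<close>

lemma mesh_le_sd:
  fixes K :: "'w::euclidean_space set set"
  assumes K: "simplicial_complex K" and r: "mesh_le K r" "r \<ge> 0"
  shows "mesh_le (sd K) (DIM('w) / (DIM('w) + 1) * r)"
proof -
  let ?R = "DIM('w) / (DIM('w) + 1) * r"
  have vert: "dist (barycenter \<tau>) v \<le> ?R" if \<tau>: "\<tau> \<in> cells K" and v: "v \<in> verts \<tau>" for \<tau> v
  proof -
    have \<tau>K: "\<tau> \<in> K" using \<tau> by (simp add: cells_def)
    note v\<tau> = simplicial_complex_verts[OF K \<tau>K]
    let ?m = "card (verts \<tau>)"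
    have m: "?m > 0" using verts_nonempty(2)[OF K \<tau>] .
    have "int ?m - 1 \<le> int DIM('w)"
      using v\<tau>(1) aff_dim_le_DIM[of "verts \<tau>"] by (simp add: affine_independent_iff_card)
    then have mD: "?m \<le> DIM('w) + 1" by linarith
    have sub: "verts \<tau> \<subseteq> \<tau>" using v\<tau>(3) hull_subset by metis
    have "barycenter \<tau> - v = (1 / ?m) *\<^sub>R (\<Sum>w\<in>verts \<tau>. w - v)"
      using m by (simp add: barycenter_verts sum_subtractf scaleR_right_diff_distrib scaleR_sum_right sum_constant_scaleR del: sum_constant)
    also have "(\<Sum>w\<in>verts \<tau>. w - v) = (\<Sum>w\<in>verts \<tau> - {v}. w - v)"
      using v\<tau>(2) by (intro sum.mono_neutral_right) auto
    finally have "norm (barycenter \<tau> - v) = (1 / ?m) * norm (\<Sum>w\<in>verts \<tau> - {v}. w - v)" by simp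
    also have "\<dots> \<le> (1 / ?m) * (\<Sum>w\<in>verts \<tau> - {v}. r)"
    proof (intro mult_left_mono sum_norm_le)
      fix w assume "w \<in> verts \<tau> - {v}"
      then show "norm (w - v) \<le> r"
        using r(1) \<tau>K sub v unfolding mesh_le_def dist_norm by blast
    qed simp
    also have "\<dots> = (1 - 1 / ?m) * r"
      using v v\<tau>(2) m by (auto simp: card_Diff_singleton of_nat_diff Suc_leI left_diff_distrib diff_divide_distrib)
    also have "\<dots> \<le> (1 - 1 / (DIM('w) + 1)) * r"
      using r(2) m mD by (intro mult_right_mono diff_left_mono divide_left_mono) auto
    also have "\<dots> = ?R" by (simp add: field_simps)
    finally show ?thesis by (simp add: dist_norm)
  qed
  \<comment> \<open>The ball around the barycenter of \<tau> contains the vertices of \<tau>, hence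
    all of \<tau>, in particular the barycenter of \<sigma>. Cells of a flag are nested, so this
    covers all pairs of vertices of a simplex of \<open>sd K\<close>.\<close>
  have nested: "dist (barycenter \<tau>) (barycenter \<sigma>) \<le> ?R"
    if "\<tau> \<in> cells K" "\<sigma> \<in> cells K" "\<sigma> \<subseteq> \<tau>" for \<sigma> \<tau>
  proof -
    have "\<tau> \<in> K" using that by (simp add: cells_def)
    then have "\<tau> \<subseteq> cball (barycenter \<tau>) ?R"
      using vert[OF that(1)] simplicial_complex_verts(3)[OF K, of \<tau>]
      by (metis (no_types, lifting) convex_cball hull_minimal mem_cball subsetI)
    then show ?thesis using barycenter_in[OF K that(2)] that(3) by auto
  qed
  show ?thesis
    unfolding mesh_le_def
  proof (intro ballI)
    fix \<rho> x y assume "\<rho> \<in> sd K" and xy: "x \<in> \<rho>" "y \<in> \<rho>"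
    then obtain F where F: "flag K F" "\<rho> = convex hull (barycenter ` F)" by (auto simp: sd_flags)
    have "dist (barycenter \<sigma>) (barycenter \<tau>) \<le> ?R" if "\<sigma> \<in> F" "\<tau> \<in> F" for \<sigma> \<tau>
      using F(1) that nested[of \<sigma> \<tau>] nested[of \<tau> \<sigma>] unfolding flag_def by (auto simp: dist_commute)
    then show "dist x y \<le> ?R" using xy F(2) by (auto intro: dist_hull_le[of "barycenter ` F"])
  qed
qed

lemma simplicial_complex_iterated_sd: "simplicial_complex K \<Longrightarrow> simplicial_complex ((sd ^^ n) K)"
  by (induction n) (auto intro: simplicial_complex_sd)

lemma mesh_le_iterated_sd:
  fixes K :: "'w::euclidean_space set set"
  assumes K: "simplicial_complex K" and r: "mesh_le K r" "r \<ge> 0"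
  shows "mesh_le ((sd ^^ n) K) ((DIM('w) / (DIM('w) + 1)) ^ n * r)"
proof (induction n)
  case (Suc n)
  have "mesh_le (sd ((sd ^^ n) K)) (DIM('w) / (DIM('w) + 1) * ((DIM('w) / (DIM('w) + 1)) ^ n * r))"
    using simplicial_complex_iterated_sd[OF K] Suc by (rule mesh_le_sd) (use r in simp)
  then show ?case by (simp add: mult.assoc)
qed (use r in simp)

lemma iterated_sd_fine:
  fixes K :: "'w::euclidean_space set set"
  assumes K: "simplicial_complex K" and e: "e > 0"
  obtains n where "mesh_le ((sd ^^ n) K) e"
proof -
  have fin: "finite K" using K by (simp add: simplicial_complex_def)
  have "bounded (\<Union>K)"
    using K fin simplex_imp_polytope polytope_imp_bounded unfolding simplicial_complex_def by (metis bounded_Union)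
  then obtain r where r: "\<And>x y. x \<in> \<Union>K \<Longrightarrow> y \<in> \<Union>K \<Longrightarrow> dist x y \<le> r"
    unfolding bounded_two_points by blast
  \<comment> \<open>If \<open>\<Union>K\<close> is empty, \<open>r\<close> may be negative, whereas
    \<open>mesh_le_iterated_sd\<close> asks for a non-negative bound.\<close>
  have m: "mesh_le K (max r 0)" unfolding mesh_le_def using r by (metis UnionI le_max_iff_disj)
  have "((\<lambda>n. (DIM('w) / (DIM('w) + 1)) ^ n * max r 0) \<longlongrightarrow> 0 * max r 0) sequentially"
    by (intro tendsto_mult tendsto_const LIMSEQ_power_zero) auto
  then have "eventually (\<lambda>n. (DIM('w) / (DIM('w) + 1)) ^ n * max r 0 < e) sequentially"
    using e by (intro order_tendstoD(2)) auto
  then obtain n where n: "(DIM('w) / (DIM('w) + 1)) ^ n * max r 0 < e"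
    by (auto simp: eventually_sequentially)
  have "mesh_le ((sd ^^ n) K) e"
    using mesh_le_iterated_sd[OF K m, of n] n unfolding mesh_le_def by fastforce
  then show thesis by (rule that)
qed

section \<open>Critical cells of iterated subdivisions\<close>

lemma critical_cells_disjoint: "k \<noteq> l \<Longrightarrow> critical_cells K V k \<inter> critical_cells K V l = {}"
  unfolding critical_cells_def by auto

lemma Sing_index_disjoint: "p \<in> Sing_index M v k \<Longrightarrow> p \<in> Sing_index M v l \<Longrightarrow> k = l"
  by (auto simp: Sing_index_def)

lemma Sing_Union_index: "(\<Union>k. Sing_index M v k) = Sing M v"
  by (auto simp: Sing_index_def)

text \<open>General position speaks of unordered pairs. As the first component of a basis pair has
  the larger index, an unordered pair can occur in one order only.\<close>

lemma general_position_distinct_weights: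
  assumes gp: "general_position M v" and C: "is_complex (morse_complex M v)" and tie: "tie_order (morse_complex M v) r"
  shows "distinct_weights (morse_complex M v) (dist_M M) r"
proof
  show "inj_on (\<lambda>(x, y). dist_M M x y) (basis_pairs (morse_complex M v))"
  proof (rule inj_onI, clarify)
    fix a b a' b'
    assume "(a, b) \<in> basis_pairs (morse_complex M v)" "(a', b') \<in> basis_pairs (morse_complex M v)"
      and eq: "dist_M M a b = dist_M M a' b'"
    then obtain k l where kl: "a \<in> Sing_index M v (Suc k)" "b \<in> Sing_index M v k"
        "a' \<in> Sing_index M v (Suc l)" "b' \<in> Sing_index M v l"
      by (auto simp: basis_pairs_def morse_complex_def)
    then have "a \<noteq> b" "a' \<noteq> b'" using Sing_index_disjoint by (metis n_not_Suc_n)+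
    moreover have "a \<in> Sing M v" "b \<in> Sing M v" "a' \<in> Sing M v" "b' \<in> Sing M v"
      using kl by (auto simp: Sing_index_def)
    ultimately have "{a, b} = {a', b'}" using gp eq unfolding general_position_def by blast
    moreover have "\<not> (a = b' \<and> b = a')"
    proof
      assume "a = b' \<and> b = a'"
      then have "Suc k = l" "k = Suc l" using kl Sing_index_disjoint by metis+
      then show False by simp
    qed
    ultimately show "a = a' \<and> b = b'" by (auto simp: doubleton_eq_iff)
  qed
qed (use C tie in auto)

section \<open>Following the singular points through the subdivisions\<close>

primrec tracked_cell :: "('m \<Rightarrow> 'w set) \<Rightarrow> (nat \<Rightarrow> 'w set \<Rightarrow> 'w set) \<Rightarrow> nat \<Rightarrow> 'm \<Rightarrow> 'w set" where
  "tracked_cell \<beta> c 0 = \<beta>"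
| "tracked_cell \<beta> c (Suc n) = c n \<circ> tracked_cell \<beta> c n"

lemma tracked_cell_cong:
  "(\<And>i. i < n \<Longrightarrow> c i = c' i) \<Longrightarrow> tracked_cell \<beta> c n = tracked_cell \<beta> c' n"
  by (induction n) auto

text \<open>\<open>x p\<close> is a preimage under \<phi> of the singular point \<open>p\<close> in
  the cell that corresponds to \<open>p\<close>; it is the point that the chosen cells should
  contain.\<close>

locale triangulated_field =
  fixes M :: "'m manifold" and v :: "'m vector_field"
    and K :: "'w::euclidean_space set set" and \<phi> :: "'w \<Rightarrow> 'm" and V :: "'w cvf"
    and Z :: "'w set set \<Rightarrow> 'w cvf \<Rightarrow> ('w set \<Rightarrow> 'w set) \<Rightarrow> 'w cvf"
    and \<beta> :: "'m \<Rightarrow> 'w set" and x :: "'m \<Rightarrow> 'w"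
  assumes K: "simplicial_complex K" and V: "gradient_like_cvf K V"
    and Z: "subdivision_construction Z"
    and base: "based_iso (morse_complex M v) (comb_morse_complex K V) \<beta>"
    and complex: "is_complex (morse_complex M v)" "is_complex (comb_morse_complex K V)"
    and x: "\<And>p. p \<in> Sing M v \<Longrightarrow> x p \<in> \<beta> p \<and> \<phi> (x p) = p"
begin

text \<open>Each step preserves the numbers of paths between critical cells, hence the incidence
  coefficients, and the correspondences compose.\<close>

lemma tracked_iso:
  assumes "\<forall>i<n. valid_choice_at Z K V c i"
  shows "gradient_like_cvf ((sd ^^ n) K) (iterated_cvf Z K V c n) \<and>
    based_iso (morse_complex M v) (iterated_complex Z K V c n) (tracked_cell \<beta> c n) \<and>
    is_complex (iterated_complex Z K V c n)"
  using assms
proof (induction n)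
  case 0
  then show ?case using V base complex by (simp add: iterated_complex_def)
next
  case (Suc n)
  let ?K = "(sd ^^ n) K" and ?V = "iterated_cvf Z K V c n"
  have sK: "simplicial_complex ?K" by (rule simplicial_complex_iterated_sd[OF K])
  have IH: "gradient_like_cvf ?K ?V" "based_iso (morse_complex M v) (comb_morse_complex ?K ?V) (tracked_cell \<beta> c n)"
    using Suc by (auto simp: iterated_complex_def)
  have "valid_choice ?K ?V (c n)" using Suc.prems by (simp add: valid_choice_at_def)
  with Z sK IH(1) have *: "gradient_like_cvf (sd ?K) (Z ?K ?V (c n))"
      "\<And>k. bij_betw (c n) (critical_cells ?K ?V k) (critical_cells (sd ?K) (Z ?K ?V (c n)) k)"
      "\<And>k \<tau> \<sigma>. \<tau> \<in> critical_cells ?K ?V (Suc k) \<Longrightarrow> \<sigma> \<in> critical_cells ?K ?V k \<Longrightarrow>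
         \<exists>f. bij_betw f (V_paths_between ?K ?V \<tau> \<sigma>) (V_paths_between (sd ?K) (Z ?K ?V (c n)) (c n \<tau>) (c n \<sigma>))"
      "induces_iso (comb_morse_complex ?K ?V) (comb_morse_complex (sd ?K) (Z ?K ?V (c n))) (c n)"
    unfolding subdivision_construction_def by blast+
  have "based_iso (comb_morse_complex ?K ?V) (comb_morse_complex (sd ?K) (Z ?K ?V (c n))) (c n)"
  proof (rule based_isoI)
    fix k a b assume "a \<in> basis (comb_morse_complex ?K ?V) (Suc k)" "b \<in> basis (comb_morse_complex ?K ?V) k"
    then show "bcoef (comb_morse_complex (sd ?K) (Z ?K ?V (c n))) (c n a) (c n b) = bcoef (comb_morse_complex ?K ?V) a b"
      using *(3)[of a k b] by (auto simp: comb_morse_complex_def dest: bij_betw_same_card)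
  qed (simp_all add: comb_morse_complex_def *(2) critical_cells_disjoint)
  from based_iso_trans[OF IH(2) this] show ?case
    using *(1,4) unfolding iterated_complex_def induces_iso_def funpow.simps o_apply
      iterated_cvf.simps tracked_cell.simps by blast
qed

lemma tracked_cell_critical:
  assumes "\<forall>i<n. valid_choice_at Z K V c i"
  shows "tracked_cell \<beta> c n ` Sing_index M v k = critical_cells ((sd ^^ n) K) (iterated_cvf Z K V c n) k"
    and "inj_on (tracked_cell \<beta> c n) (Sing M v)"
  using tracked_iso[OF assms]
  by (auto simp: based_iso_def iterated_complex_def morse_complex_def comb_morse_complex_def Sing_Union_index)

lemma tracked_cell_critical_Sing:
  assumes "\<forall>i<n. valid_choice_at Z K V c i" "p \<in> Sing M v"
  obtains k where "tracked_cell \<beta> c n p \<in> critical_cells ((sd ^^ n) K) (iterated_cvf Z K V c n) k"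
proof -
  obtain k where "p \<in> Sing_index M v k" using assms(2) by (auto simp: Sing_index_def)
  then show thesis using that tracked_cell_critical(1)[OF assms(1), of k] by blast
qed

lemma tracked_cell_decreasing:
  assumes c: "\<forall>i. valid_choice_at Z K V c i" and p: "p \<in> Sing M v" and mn: "m \<le> n"
  shows "tracked_cell \<beta> c n p \<subseteq> tracked_cell \<beta> c m p"
  using mn
proof (induction n rule: dec_induct)
  case (step n)
  obtain k where "tracked_cell \<beta> c n p \<in> critical_cells ((sd ^^ n) K) (iterated_cvf Z K V c n) k"
    using tracked_cell_critical_Sing[of n c p] c p by blast
  then have "c n (tracked_cell \<beta> c n p) \<subseteq> tracked_cell \<beta> c n p"
    using c unfolding valid_choice_at_def valid_choice_def by blast
  then show ?case using step.IH by simp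
qed simp

definition chosen_cell :: "nat \<Rightarrow> 'w set \<Rightarrow> 'w \<Rightarrow> 'w set" where
  "chosen_cell n \<sigma> y = (SOME \<rho>. \<rho> \<in> cells (sd ((sd ^^ n) K)) \<and> aff_dim \<rho> = aff_dim \<sigma> \<and> \<rho> \<subseteq> \<sigma> \<and> y \<in> \<rho>)"

text \<open>This recursion makes no reference to \<open>good_choice\<close>, which is defined by
  inverting it; that it agrees with the track of \<open>good_choice\<close> is proved below.\<close>

primrec chosen_track :: "nat \<Rightarrow> 'm \<Rightarrow> 'w set" where
  "chosen_track 0 = \<beta>"
| "chosen_track (Suc n) = (\<lambda>p. chosen_cell n (chosen_track n p) (x p))"

text \<open>A choice takes a cell as its argument, so the singular point has to be recovered from
  its cell.\<close>

definition good_choice :: "nat \<Rightarrow> 'w set \<Rightarrow> 'w set" where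
  "good_choice n \<sigma> = chosen_cell n \<sigma> (x (inv_into (Sing M v) (chosen_track n) \<sigma>))"

lemma chosen_cell:
  assumes "\<sigma> \<in> cells ((sd ^^ n) K)" "y \<in> \<sigma>"
  shows "chosen_cell n \<sigma> y \<in> cells (sd ((sd ^^ n) K)) \<and> aff_dim (chosen_cell n \<sigma> y) = aff_dim \<sigma> \<and>
    chosen_cell n \<sigma> y \<subseteq> \<sigma> \<and> y \<in> chosen_cell n \<sigma> y"
  unfolding chosen_cell_def
  by (rule someI_ex) (use sd_cell_through_point[OF simplicial_complex_iterated_sd[OF K] assms] in blast)

text \<open>Both claims need a single induction: validity of the earlier choices makes the track
  injective on \<open>Sing M v\<close>, injectivity allows it to be inverted, and this shows that
  the next choice is valid and contains the singular point.\<close>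

lemma good_choice:
  "(\<forall>i<n. valid_choice_at Z K V good_choice i) \<and>
   (\<forall>p\<in>Sing M v. tracked_cell \<beta> good_choice n p = chosen_track n p \<and> x p \<in> chosen_track n p)"
proof (induction n)
  case 0
  then show ?case using x by simp
next
  case (Suc n)
  let ?K = "(sd ^^ n) K" and ?V = "iterated_cvf Z K V good_choice n"
  have valid: "\<forall>i<n. valid_choice_at Z K V good_choice i"
    and track: "\<And>p. p \<in> Sing M v \<Longrightarrow> tracked_cell \<beta> good_choice n p = chosen_track n p"
    and mem: "\<And>p. p \<in> Sing M v \<Longrightarrow> x p \<in> chosen_track n p"
    using Suc by auto
  have inj: "inj_on (chosen_track n) (Sing M v)"
    using tracked_cell_critical(2)[OF valid] inj_on_cong[of "Sing M v" "tracked_cell \<beta> good_choice n" "chosen_track n"]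
      track by blast
  have gc: "good_choice n (chosen_track n p) = chosen_cell n (chosen_track n p) (x p)" if "p \<in> Sing M v" for p
    using inj that by (simp add: good_choice_def)
  have cell: "chosen_track n p \<in> cells ?K" if "p \<in> Sing M v" for p
    using tracked_cell_critical_Sing[OF valid that] track[OF that] by (metis (no_types, lifting) critical_cells_def mem_Collect_eq)
  note chosen = chosen_cell[OF cell mem]
  have "valid_choice ?K ?V (good_choice n)"
    unfolding valid_choice_def
  proof (intro allI ballI)
    fix k \<sigma> assume \<sigma>: "\<sigma> \<in> critical_cells ?K ?V k"
    then have "\<sigma> \<in> tracked_cell \<beta> good_choice n ` Sing_index M v k"
      using tracked_cell_critical(1)[OF valid] by simp
    then obtain p where p: "p \<in> Sing M v" "\<sigma> = chosen_track n p"
      using track by (auto simp: Sing_index_def)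
    have "aff_dim \<sigma> = int k" using \<sigma> by (simp add: critical_cells_def)
    then show "good_choice n \<sigma> \<in> cells (sd ?K) \<and> aff_dim (good_choice n \<sigma>) = int k \<and> good_choice n \<sigma> \<subseteq> \<sigma>"
      using chosen[OF p(1) p(1)] gc[OF p(1)] p(2) by simp
  qed
  then have "valid_choice_at Z K V good_choice n" by (simp add: valid_choice_at_def)
  then show ?case
    using valid track gc chosen less_Suc_eq by simp
qed

text \<open>At stage \<open>N\<close> the tracked cell contains \<open>x p\<close>, and all later
  cells lie inside it; so the barycenter and \<open>x p\<close> lie in one cell of the
  \<open>N\<close>-th subdivision.\<close>

lemma tracked_barycenter:
  assumes agree: "\<And>i. i < N \<Longrightarrow> c i = good_choice i" and c: "\<forall>i. valid_choice_at Z K V c i"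
    and mesh: "mesh_le ((sd ^^ N) K) e" and n: "N \<le> n" and p: "p \<in> Sing M v"
  shows "barycenter (tracked_cell \<beta> c n p) \<in> \<Union>K" "dist (barycenter (tracked_cell \<beta> c n p)) (x p) \<le> e"
proof -
  have cell: "tracked_cell \<beta> c m p \<in> cells ((sd ^^ m) K)" for m
    using tracked_cell_critical_Sing[of m c p] c p by (metis (no_types, lifting) critical_cells_def mem_Collect_eq)
  have b: "barycenter (tracked_cell \<beta> c n p) \<in> tracked_cell \<beta> c n p"
    by (rule barycenter_in[OF simplicial_complex_iterated_sd[OF K] cell])
  then show "barycenter (tracked_cell \<beta> c n p) \<in> \<Union>K"
    using tracked_cell_decreasing[OF c p, of 0 n] cell[of 0] by (auto simp: cells_def)
  have "x p \<in> tracked_cell \<beta> c N p"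
    using good_choice[of N] p tracked_cell_cong[of N c good_choice \<beta>] agree by simp
  moreover have "barycenter (tracked_cell \<beta> c n p) \<in> tracked_cell \<beta> c N p"
    using b tracked_cell_decreasing[OF c p n] by blast
  moreover have "tracked_cell \<beta> c N p \<in> (sd ^^ N) K" using cell[of N] by (simp add: cells_def)
  ultimately show "dist (barycenter (tracked_cell \<beta> c n p)) (x p) \<le> e"
    using mesh by (simp add: mesh_le_def)
qed

end

section \<open>Uniform estimates and the conclusion\<close>

lemma finite_Sing:
  assumes "is_complex (morse_complex M v)"
  shows "finite (Sing M v)"
proof -
  have "Sing M v = (\<Union>k\<in>{k. Sing_index M v k \<noteq> {}}. Sing_index M v k)"
    by (auto simp: Sing_index_def)
  then show ?thesis using assms by (auto simp: is_complex_def morse_complex_def)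
qed

lemma finite_gap:
  fixes f :: "'a \<Rightarrow> real"
  assumes "finite A"
  obtains g where "g > 0" "\<And>p q. p \<in> A \<Longrightarrow> q \<in> A \<Longrightarrow> f p < f q \<Longrightarrow> g \<le> f q - f p"
proof -
  define D where "D = (\<lambda>(p, q). f q - f p) ` {(p, q) \<in> A \<times> A. f p < f q}"
  have "finite {(p, q) \<in> A \<times> A. f p < f q}"
    by (rule finite_subset[of _ "A \<times> A"]) (use assms in auto)
  then have "finite D" unfolding D_def by (rule finite_imageI)
  \<comment> \<open>The 1 covers the case that no two values differ.\<close>
  then have "Min (insert 1 D) > 0" "\<And>d. d \<in> D \<Longrightarrow> Min (insert 1 D) \<le> d"
    by (auto simp: D_def)
  then show thesis using that[of "Min (insert 1 D)"] by (force simp: D_def)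
qed

text \<open>Continuity of \<phi> pulls the neighbourhoods from \<open>near_nbhd\<close> back to
  balls around the points \<open>x p\<close>; as \<open>P\<close> is finite, the smallest radius
  serves for all.\<close>

lemma uniformly_near:
  assumes man: "closed_oriented_manifold M" and met: "riemannian_metric M"
    and \<phi>: "continuous_map (top_of_set S) (mtop M) \<phi>" and fin: "finite P"
    and x: "\<And>p. p \<in> P \<Longrightarrow> x p \<in> S \<and> \<phi> (x p) = p" and \<delta>: "\<delta> > 0"
  obtains \<eta> where "\<eta> > 0" "\<And>p y. p \<in> P \<Longrightarrow> y \<in> S \<Longrightarrow> dist y (x p) < \<eta> \<Longrightarrow> near M \<delta> p (\<phi> y)"
proof -
  have "\<exists>\<eta>>0. \<forall>y\<in>S. dist y (x p) < \<eta> \<longrightarrow> near M \<delta> p (\<phi> y)" if p: "p \<in> P" for p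
  proof -
    have "p \<in> topspace (mtop M)" using continuous_map_image_subset_topspace[OF \<phi>] x[OF p] by auto
    then obtain U where U: "openin (mtop M) U" "p \<in> U" "\<And>q. q \<in> U \<Longrightarrow> near M \<delta> p q"
      using near_nbhd[OF man met _ \<delta>] by blast
    have "openin (top_of_set S) {y \<in> S. \<phi> y \<in> U}"
      using openin_continuous_map_preimage[OF \<phi> U(1)] by simp
    moreover have "x p \<in> {y \<in> S. \<phi> y \<in> U}" using x[OF p] U(2) by auto
    ultimately obtain \<eta> where "\<eta> > 0" "ball (x p) \<eta> \<inter> S \<subseteq> {y \<in> S. \<phi> y \<in> U}"
      unfolding openin_contains_ball by blast
    then show ?thesis using U(3) by (auto simp: dist_commute subset_iff)
  qed
  then obtain h where h: "\<And>p. p \<in> P \<Longrightarrow> h p > 0 \<and> (\<forall>y\<in>S. dist y (x p) < h p \<longrightarrow> near M \<delta> p (\<phi> y))"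
    by metis
  show thesis
  proof (rule that[of "Min (insert 1 (h ` P))"])
    show "Min (insert 1 (h ` P)) > 0" using fin h by auto
    fix p y assume "p \<in> P" "y \<in> S" "dist y (x p) < Min (insert 1 (h ` P))"
    then show "near M \<delta> p (\<phi> y)" using fin h by auto
  qed
qed

text \<open>Flow lines and \<open>V\<close>-paths are in bijection, so their numbers agree and
  \<beta> preserves the coefficients themselves.\<close>

lemma vf_triangulation_tracks:
  assumes "vf_triangulation M v K \<phi> V" "subdivision_construction Z"
  obtains \<beta> x where "triangulated_field M v K \<phi> V Z \<beta> x"
proof -
  obtain \<beta> where \<beta>: "\<And>k. bij_betw \<beta> (Sing_index M v k) (critical_cells K V k)"
      "\<And>k p. p \<in> Sing_index M v k \<Longrightarrow> p \<in> \<phi> ` \<beta> p"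
      "\<And>k p q. p \<in> Sing_index M v (Suc k) \<Longrightarrow> q \<in> Sing_index M v k \<Longrightarrow>
         \<exists>f. bij_betw f (flow_lines M v p q) (V_paths_between K V (\<beta> p) (\<beta> q))"
      "induces_iso (morse_complex M v) (comb_morse_complex K V) \<beta>"
    using assms(1) unfolding vf_triangulation_def by blast
  have "based_iso (morse_complex M v) (comb_morse_complex K V) \<beta>"
  proof (rule based_isoI)
    fix k a b assume "a \<in> basis (morse_complex M v) (Suc k)" "b \<in> basis (morse_complex M v) k"
    then show "bcoef (comb_morse_complex K V) (\<beta> a) (\<beta> b) = bcoef (morse_complex M v) a b"
      using \<beta>(3)[of a k b] by (auto simp: comb_morse_complex_def morse_complex_def dest: bij_betw_same_card)
  qed (simp_all add: comb_morse_complex_def morse_complex_def \<beta>(1) critical_cells_disjoint)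
  moreover have "\<exists>y. y \<in> \<beta> p \<and> \<phi> y = p" if "p \<in> Sing M v" for p
    using \<beta>(2)[of p] that by (auto simp: Sing_index_def)
  then obtain x where "\<And>p. p \<in> Sing M v \<Longrightarrow> x p \<in> \<beta> p \<and> \<phi> (x p) = p" by metis
  ultimately have "triangulated_field M v K \<phi> V Z \<beta> x"
    using assms \<beta>(4) unfolding vf_triangulation_def induces_iso_def by unfold_locales auto
  then show thesis by (rule that)
qed

theorem theorem3p16:
  fixes M :: "'m manifold" and v :: "'m vector_field"
    and K :: "'w::euclidean_space set set" and \<phi> :: "'w \<Rightarrow> 'm" and V :: "'w cvf"
    and Z :: "'w set set \<Rightarrow> 'w cvf \<Rightarrow> ('w set \<Rightarrow> 'w set) \<Rightarrow> 'w cvf"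
    and r :: "('m \<times> 'm) rel" and \<epsilon> :: real
  assumes "closed_oriented_riemannian_manifold M"
    and "gradient_like_morse_smale M v"
    and "general_position M v"
    and "vf_triangulation M v K \<phi> V"
    and "subdivision_construction Z"
    and "tie_order (morse_complex M v) r"
    and "\<epsilon> > 0"
  shows "\<exists>N c\<^sub>0. (\<forall>n<N. valid_choice_at Z K V c\<^sub>0 n) \<and>
    (\<forall>c. (\<forall>n<N. c n = c\<^sub>0 n) \<and> (\<forall>n. valid_choice_at Z K V c n) \<longrightarrow>
      (\<forall>n\<ge>N. \<forall>r'. tie_order (iterated_complex Z K V c n) r' \<longrightarrow>
        interleaving_distance
          (pcomplex_of (morse_complex M v) (dist_M M) r)
          (pcomplex_of (iterated_complex Z K V c n) (cell_weight M \<phi>) r') < ereal \<epsilon>))"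
proof -
  have man: "closed_oriented_manifold M" and met: "riemannian_metric M"
    using assms(1) by (auto simp: closed_oriented_riemannian_manifold_def)
  have cov: "(\<Union>c\<in>atlas M. fst c) = topspace (mtop M)"
    using man by (simp add: closed_oriented_manifold_def Let_def)
  have \<phi>: "continuous_map (top_of_set (\<Union>K)) (mtop M) \<phi>"
    using assms(4) homeomorphic_imp_continuous_map unfolding vf_triangulation_def by blast
  obtain \<beta> x where "triangulated_field M v K \<phi> V Z \<beta> x"
    using vf_triangulation_tracks[OF assms(4,5)] .
  then interpret triangulated_field M v K \<phi> V Z \<beta> x .
  let ?C = "morse_complex M v" and ?w = "case_prod (dist_M M)"
  have weights: "distinct_weights ?C (dist_M M) r"
    by (rule general_position_distinct_weights[OF assms(3) complex(1) assms(6)])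
  \<comment> \<open>Stage 0 of the track is \<open>\<beta> p\<close> for every sequence of choices,
    whence the argument \<open>undefined\<close>.\<close>
  have xS: "x p \<in> \<Union>K \<and> \<phi> (x p) = p" if "p \<in> Sing M v" for p
    using tracked_cell_critical_Sing[of 0 undefined p] that x[OF that] by (auto simp: critical_cells_def cells_def)
  obtain g where g: "g > 0" "\<And>p q. p \<in> basis_pairs ?C \<Longrightarrow> q \<in> basis_pairs ?C \<Longrightarrow> ?w p < ?w q \<Longrightarrow> g \<le> ?w q - ?w p"
    using finite_gap[OF finite_basis_pairs[OF complex(1)]] by metis
  define B where "B = real (card (basis_pairs ?C))"
  \<comment> \<open>Two weights move by at most \<open>2 * \<delta>\<close> each, so a gap of
    \<open>5 * \<delta>\<close> preserves their strict order. The second term makes the total change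
    of the times at most \<open>\<epsilon> / 2\<close>, with \<open>B + 1\<close> to keep the
    denominator positive when there are no pairs.\<close>
  define \<delta> where "\<delta> = min (g / 5) (\<epsilon> / (4 * (B + 1)))"
  have B: "B \<ge> 0" by (simp add: B_def)
  have \<delta>: "\<delta> > 0" "5 * \<delta> \<le> g" "B * (2 * \<delta>) \<le> \<epsilon> / 2"
  proof -
    show "\<delta> > 0" using g(1) B assms(7) by (simp add: \<delta>_def)
    have "\<delta> \<le> g / 5" unfolding \<delta>_def by (rule min.cobounded1)
    then show "5 * \<delta> \<le> g" by simp
    have "B * (2 * \<delta>) \<le> B * (2 * (\<epsilon> / (4 * (B + 1))))"
      using B by (intro mult_left_mono) (auto simp: \<delta>_def)
    also have "\<dots> \<le> \<epsilon> / 2" using B assms(7) by (simp add: field_simps)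
    finally show "B * (2 * \<delta>) \<le> \<epsilon> / 2" .
  qed
  obtain \<eta> where \<eta>: "\<eta> > 0" "\<And>p y. p \<in> Sing M v \<Longrightarrow> y \<in> \<Union>K \<Longrightarrow> dist y (x p) < \<eta> \<Longrightarrow> near M \<delta> p (\<phi> y)"
    using uniformly_near[OF man met \<phi> finite_Sing[OF complex(1)] xS \<delta>(1)] by blast
  \<comment> \<open>The mesh gives a non-strict bound and \<eta> is a strict one, hence the
    half.\<close>
  obtain N where N: "mesh_le ((sd ^^ N) K) (\<eta> / 2)"
    using iterated_sd_fine[OF K, of "\<eta> / 2"] \<eta>(1) by auto
  show ?thesis
  proof (intro exI[of _ N] exI[of _ good_choice] conjI allI impI)
    show "valid_choice_at Z K V good_choice n" if "n < N" for n using good_choice[of N] that by blast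
    fix c n r'
    assume c: "(\<forall>n<N. c n = good_choice n) \<and> (\<forall>n. valid_choice_at Z K V c n)" and n: "N \<le> n"
      and r': "tie_order (iterated_complex Z K V c n) r'"
    let ?D = "iterated_complex Z K V c n" and ?w' = "case_prod (cell_weight M \<phi>)"
    let ?b = "tracked_cell \<beta> c n"
    have near: "near M \<delta> p (\<phi> (barycenter (?b p)))" if "p \<in> Sing M v" for p
      using tracked_barycenter[of N c "\<eta> / 2" n p] c N n that \<eta> by auto
    have close: "\<bar>?w' (map_prod ?b ?b P) - ?w P\<bar> \<le> 2 * \<delta>" if "P \<in> basis_pairs ?C" for P
    proof -
      obtain p q where P: "P = (p, q)" "p \<in> Sing M v" "q \<in> Sing M v"
        using \<open>P \<in> basis_pairs ?C\<close> by (auto simp: basis_pairs_def morse_complex_def Sing_index_def)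
      then show ?thesis
        using dist_M_near[OF cov less_imp_le[OF \<delta>(1)] near near] by (simp add: cell_weight_def)
    qed
    \<comment> \<open>The lemma bounds the infimum only by \<open>\<le>\<close>; half of \<epsilon>
      leaves room for the strict inequality.\<close>
    have "interleaving_distance (pcomplex_of ?C (dist_M M) r) (pcomplex_of ?D (cell_weight M \<phi>) r') \<le> ereal (\<epsilon> / 2)"
    proof (rule interleaving_distance_le[OF weights _ r'])
      show "is_complex ?D" "based_iso ?C ?D ?b" using tracked_iso[of n c] c by auto
      show "?w' (map_prod ?b ?b P) < ?w' (map_prod ?b ?b Q)"
        if "P \<in> basis_pairs ?C" "Q \<in> basis_pairs ?C" "?w P < ?w Q" for P Q
        using close[OF that(1)] close[OF that(2)] g(2)[OF that] \<delta>(1,2) by linarith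
      show "\<bar>?w' (map_prod ?b ?b P) - ?w P\<bar> \<le> 2 * \<delta>" if "P \<in> basis_pairs ?C" for P by (rule close[OF that])
    qed (use assms(7) \<delta> in \<open>auto simp: B_def\<close>)
    also have "\<dots> < ereal \<epsilon>" using assms(7) by simp
    finally show "interleaving_distance (pcomplex_of ?C (dist_M M) r) (pcomplex_of ?D (cell_weight M \<phi>) r') < ereal \<epsilon>" .
  qed
qed

end
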